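(* Let $\lambda>0$, $P>0$, $N_0>0$, $r_0>0$, $\eta>2$, and let $\mathbf S=\{s_1,\dots,s_M\}$ be the unit-power square $M$-QAM constellation. Consider the downlink of a single-tier cellular network modeled via a Poisson point process of intensity $\lambda$, with Rayleigh fading, universal frequency reuse, nearest-base-station association and no intra-cell interference, in which the useful symbol and all interfering symbols are $M$-QAM modulated, as described in the context. Then the average symbol error probability $\bar{\mathcal S}(r_0)$ of a user located at distance $r_0$ from its serving base station is $$\bar{\mathcal{S}}(r_0)=\sum_{c=1}^2 w_c\left(1-\frac{c}{\sqrt{\pi}}\int_0^{\infty}\frac{\operatorname{erfc}\left(\sqrt{z}\,\mathbf 1_{\{c=2\}}\right)}{\sqrt{z}}\exp\left\{-z\left(1+\frac{N_0r_0^\eta}{P\beta_c}\right)-\pi\lambda r_0^{2}\left(\frac1M\sum_{m=1}^{M}{}_1F_1\left(-\frac{2}{\eta};1-\frac{2}{\eta};-\frac{z|s_m|^2}{\beta_c}\right)-1\right)\right\}\mathrm dz\right),$$ where $$w_1=2\,\frac{\sqrt M-1}{\sqrt M},\qquad w_2=-\left(\frac{\sqrt M-1}{\sqrt M}\right)^2,\qquad \beta_1=\beta_2=\frac{3}{2(M-1)}.$$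
   Context: Constellation. $M\ge 4$ is a perfect square. The square $M$-QAM constellation with unit average power is the set $\mathbf S=\{s_1,\dots,s_M\}$ of the points $\sqrt{\tfrac{3}{2(M-1)}}\,\big((2a-\sqrt M-1)+\jmath(2b-\sqrt M-1)\big)$, $a,b\in\{1,\dots,\sqrt M\}$, so that $\frac1M\sum_m|s_m|^2=1$. Network and received signal. All base stations (BSs) form a homogeneous Poisson point process in $\mathbb R^2$ of intensity $\lambda$. All BSs transmit with power $P$ on the same channel. The test user is at the origin and is served by its nearest BS, at distance $r_0$. Everything is conditioned on $r_0$, so the interfering BSs form a homogeneous Poisson point process of intensity $\lambda$ on $\{x\in\mathbb R^2:\|x\|>r_0\}$. Let $\{r_k\}_{k\ge1}$ be the distances of the interfering BSs to the origin. The received baseband signal is $$y_0=\sqrt P\,s_0h_0r_0^{-\eta/2}+\sum_{k\ge1}\sqrt P\,\sigma_kh_kr_k^{-\eta/2}+n ,$$ where the useful symbol $s_0$ and the interfering symbols $\sigma_k$ ($k\ge 1$) are i.i.d. uniform on $\mathbf S$, the fading coefficients $h_0,h_k$ are i.i.d. $\mathcal{CN}(0,1)$ (circularly symmetric complex Gaussian with mean $0$ and variance $1$; Rayleigh fading), $n\sim\mathcal{CN}(0,N_0)$, and all of these variables and the point process are mutually independent. Average symbol error probability. The receiver is the coherent maximum-likelihood detector for $M$-QAM treating interference as Gaussian noise, that is, it knows $h_0$ and outputs $\hat s\in\arg\min_{s\in\mathbf S}\left|y_0-\sqrt P\,h_0r_0^{-\eta/2}s\right|$. The average symbol error probability is $\bar{\mathcal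 S}(r_0)=\mathbb P\{\hat s\ne s_0\}$, where the probability is over all of the random quantities above with $r_0$ fixed. Notation. $\operatorname{erfc}(x)=\frac{2}{\sqrt\pi}\int_x^\infty e^{-t^2}\mathrm dt$. ${}_1F_1(a;b;x)=\sum_{n\ge0}\frac{(a)_n}{(b)_n}\frac{x^n}{n!}$ is the Kummer confluent hypergeometric function with $(a)_n=\Gamma(a+n)/\Gamma(a)$. $\mathbf 1_{\{c=2\}}$ equals $1$ if $c=2$ and $0$ otherwise. *)

theory Defs
  imports "HOL-Probability.Probability"
begin

definition erfc :: "real \<Rightarrow> real" where
  "erfc x = 2 / sqrt pi * (LBINT t:{x..}. exp (- (t\<^sup>2)))"

definition kummer_1F1 :: "real \<Rightarrow> real \<Rightarrow> real \<Rightarrow> real" where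
  "kummer_1F1 a b x = (\<Sum>n. pochhammer a n / pochhammer b n * (x ^ n / fact n))"

text \<open>Meant for a perfect square \<open>M \<ge> 4\<close>, so that \<open>sqrt M\<close> is an integer.\<close>

definition qam :: "nat \<Rightarrow> complex set" where
  "qam M = {of_real (sqrt (3 / (2 * (real M - 1)))) *
              Complex (2 * real a - sqrt (real M) - 1) (2 * real b - sqrt (real M) - 1) | a b :: nat.
              1 \<le> a \<and> real a \<le> sqrt (real M) \<and> 1 \<le> b \<and> real b \<le> sqrt (real M)}"

definition uniform_rv :: "'a measure \<Rightarrow> 'b set \<Rightarrow> ('a \<Rightarrow> 'b) \<Rightarrow> bool" where
  "uniform_rv \<Omega> S X \<longleftrightarrow>
     X \<in> measurable \<Omega> (count_space S) \<and> distr \<Omega> (count_space S) X = uniform_count_measure S"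

text \<open>Circularly symmetric complex Gaussian with mean \<open>0\<close> and \<open>E |Z|\<^sup>2 = v\<close>: real and imaginary part
  are independent, each with variance \<open>v / 2\<close> (the library density takes the standard deviation).\<close>

definition complex_gaussian :: "'a measure \<Rightarrow> real \<Rightarrow> ('a \<Rightarrow> complex) \<Rightarrow> bool" where
  "complex_gaussian \<Omega> v Z \<longleftrightarrow>
     distributed \<Omega> lborel (\<lambda>\<omega>. Re (Z \<omega>)) (normal_density 0 (sqrt (v / 2))) \<and>
     distributed \<Omega> lborel (\<lambda>\<omega>. Im (Z \<omega>)) (normal_density 0 (sqrt (v / 2))) \<and>
     prob_space.indep_var \<Omega> borel (\<lambda>\<omega>. Re (Z \<omega>)) borel (\<lambda>\<omega>. Im (Z \<omega>))"

text \<open>Homogeneous Poisson point process of intensity \<open>lam\<close> on the Borel set \<open>D\<close>, as a random locally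
  finite set.  The probability mass function is written out because \<open>poisson_pmf\<close> requires a positive
  rate, whereas null sets have rate \<open>0\<close>.  The finiteness condition matters: \<open>card\<close> is \<open>0\<close> on infinite
  sets.\<close>

definition poisson_point_process ::
    "'a measure \<Rightarrow> real \<Rightarrow> 'b::euclidean_space set \<Rightarrow> ('a \<Rightarrow> 'b set) \<Rightarrow> bool" where
  "poisson_point_process \<Omega> lam D \<Phi> \<longleftrightarrow>
     (AE \<omega> in \<Omega>. \<Phi> \<omega> \<subseteq> D) \<and>
     (\<forall>A\<in>sets borel. A \<subseteq> D \<longrightarrow> bounded A \<longrightarrow>
        (AE \<omega> in \<Omega>. finite (\<Phi> \<omega> \<inter> A)) \<and>
        (\<lambda>\<omega>. card (\<Phi> \<omega> \<inter> A)) \<in> measurable \<Omega> (count_space UNIV) \<and>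
        (\<forall>k. measure \<Omega> {\<omega>\<in>space \<Omega>. card (\<Phi> \<omega> \<inter> A) = k} =
               (lam * measure lborel A) ^ k / fact k * exp (- (lam * measure lborel A)))) \<and>
     (\<forall>(A :: nat \<Rightarrow> 'b set) m.
        (\<forall>i<m. A i \<in> sets borel \<and> A i \<subseteq> D \<and> bounded (A i)) \<longrightarrow>
        disjoint_family_on A {..<m} \<longrightarrow>
        prob_space.indep_vars \<Omega> (\<lambda>_. count_space UNIV) (\<lambda>i \<omega>. card (\<Phi> \<omega> \<inter> A i)) {..<m})"

text \<open>The sources of randomness.  Mutual independence is stated through the generated sigma-algebras,
  since \<open>indep_vars\<close> needs variables with values in a common type; \<open>Points\<close> is the whole sequence of
  base-station positions as one random element.\<close>

datatype component =
  Useful_Symbol | Symbol nat | Useful_Fading | Fading nat | Noise | Points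

definition mutually_independent ::
    "'a measure \<Rightarrow> ('a \<Rightarrow> complex) \<Rightarrow> (nat \<Rightarrow> 'a \<Rightarrow> complex) \<Rightarrow> ('a \<Rightarrow> complex) \<Rightarrow> (nat \<Rightarrow> 'a \<Rightarrow> complex) \<Rightarrow>
       ('a \<Rightarrow> complex) \<Rightarrow> (nat \<Rightarrow> 'a \<Rightarrow> 'b::euclidean_space) \<Rightarrow> bool" where
  "mutually_independent \<Omega> s0 \<sigma> h0 h n X \<longleftrightarrow>
     prob_space.indep_sets \<Omega>
       (\<lambda>c. case c of
          Useful_Symbol \<Rightarrow> sets (vimage_algebra (space \<Omega>) s0 borel)
        | Symbol k \<Rightarrow> sets (vimage_algebra (space \<Omega>) (\<sigma> k) borel)
        | Useful_Fading \<Rightarrow> sets (vimage_algebra (space \<Omega>) h0 borel)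
        | Fading k \<Rightarrow> sets (vimage_algebra (space \<Omega>) (h k) borel)
        | Noise \<Rightarrow> sets (vimage_algebra (space \<Omega>) n borel)
        | Points \<Rightarrow> sets (vimage_algebra (space \<Omega>) (\<lambda>\<omega> k. X k \<omega>) (\<Pi>\<^sub>M k\<in>UNIV. borel)))
       UNIV"

text \<open>Baseband signal for given realisations; the interferers are numbered from \<open>0\<close>, and \<open>x k\<close> is the
  position of the \<open>k\<close>-th one.  An ordered series is essential: for \<open>\<eta> \<le> 4\<close> the interference does not
  converge absolutely.\<close>

definition received_signal ::
    "real \<Rightarrow> real \<Rightarrow> real \<Rightarrow> complex \<Rightarrow> (nat \<Rightarrow> complex) \<Rightarrow> complex \<Rightarrow> (nat \<Rightarrow> complex) \<Rightarrow>
       complex \<Rightarrow> (nat \<Rightarrow> 'b::euclidean_space) \<Rightarrow> complex" where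
  "received_signal P \<eta> r0 s0 \<sigma> h0 h n x =
     of_real (sqrt P) * s0 * h0 * of_real (r0 powr (- \<eta> / 2))
     + (\<Sum>k. of_real (sqrt P) * \<sigma> k * h k * of_real (norm (x k) powr (- \<eta> / 2)))
     + n"

definition sep_weight :: "nat \<Rightarrow> nat \<Rightarrow> real" where
  "sep_weight M c =
     (if c = 1 then 2 * ((sqrt (real M) - 1) / sqrt (real M))
      else - (((sqrt (real M) - 1) / sqrt (real M))\<^sup>2))"

definition sep_beta :: "nat \<Rightarrow> nat \<Rightarrow> real" where
  "sep_beta M c = 3 / (2 * (real M - 1))"

end

theory Submission
  imports Defs
begin

text \<open>Given the interfering symbols and the base-station positions, the interference is a series of
  independent complex Gaussians with square-summable coefficients, hence it converges almost surely
  (Kolmogorov's maximal inequality) and interference plus noise is complex Gaussian.  Dividing the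
  received signal by the useful channel gives the transmitted symbol plus a complex Gaussian error, and
  the detector is correct iff this error lies in a rectangle, so that averaging over the useful symbol gives
  the conditional success probability \<open>(1 - (1 - 1/q) * erfc \<surd>(\<beta> SINR))\<^sup>2\<close> with \<open>q = \<surd>M\<close>.
  Since \<open>|h0|\<^sup>2\<close> is exponential, writing \<open>1 - erfc(y)^c\<close> as an integral over \<open>0 < z \<le> y\<^sup>2\<close> turns the
  average over \<open>h0\<close> into the Laplace transform of \<open>1 / SINR\<close>, which is the Laplace functional of the
  Poisson process; its exponent is the integral of \<open>1 - exp (- A * w powr (- \<eta> / 2))\<close> over \<open>w \<ge> 1\<close>, which
  integrates termwise to the Kummer series.\<close>

section \<open>Complex Gaussian variables and characteristic functions\<close>

text \<open>Conditioning is never formalised as such: it is Fubini on the product law of two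
  independent blocks. The coefficients \<open>U\<close> (positions, interfering symbols,
  \<open>h0\<close>) are frozen against the Gaussians \<open>H\<close> (noise, fading), then
  \<open>T\<close> against \<open>h0\<close>, then the path losses against the symbols. The noise is
  term 0 of the series, so that the conditional variance is positive and degenerate Gaussians never
  occur. The enumeration of the points is arbitrary, not sorted by distance; hence the Laplace
  functional is a limit of finite products along it, and finiteness of the conditional variance is
  itself extracted from that functional by letting its parameter tend to 0. The two values of
  \<open>c\<close> come from a square: in \<open>1 - (1 - (1 - 1/q) * e)\<^sup>2\<close> the
  coefficients of \<open>e\<close> and \<open>e\<^sup>2\<close> are the two weights, and the factor
  \<open>erfc (sqrt z)\<close> present only for \<open>c = 2\<close> is what differentiating
  \<open>erfc (sqrt z) ^ c\<close> leaves behind. Ties of the detector, a vanishing channel and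
  divergent series, where \<open>suminf\<close> carries no information, are confined to null
  sets.\<close>

lemma of_real_cos_mult_iexp:
  "complex_of_real (cos u) * iexp w = (iexp (w + u) + iexp (w - u)) / 2"
proof -
  have "iexp (w + u) = iexp w * iexp u" "iexp (w - u) = iexp w * exp (- (\<i> * complex_of_real u))"
    by (simp_all add: ring_distribs flip: exp_add)
  thus ?thesis by (simp only: cos_of_real[symmetric] cos_exp_eq) (simp add: algebra_simps)
qed

lemma of_real_sin_mult_iexp:
  "complex_of_real (sin u) * iexp w = (iexp (w + u) - iexp (w - u)) / (2 * \<i>)"
proof -
  have "iexp (w + u) = iexp w * iexp u" "iexp (w - u) = iexp w * exp (- (\<i> * complex_of_real u))"
    by (simp_all add: ring_distribs flip: exp_add)
  thus ?thesis by (simp only: sin_of_real[symmetric] sin_exp_eq) (simp add: algebra_simps)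
qed

context prob_space
begin

lemma expectation_indicator_comp:
  "expectation (\<lambda>w. indicator A (X w) :: real) = prob {w\<in>space M. X w \<in> A}"
proof -
  have "expectation (\<lambda>w. indicator A (X w) :: real) = expectation (indicator {w\<in>space M. X w \<in> A})"
    by (intro Bochner_Integration.integral_cong) (auto simp: indicator_def)
  moreover have "{w\<in>space M. X w \<in> A} \<inter> space M = {w\<in>space M. X w \<in> A}" by auto
  ultimately show ?thesis by simp
qed

text \<open>Under the probability measure with density \<open>W / expectation W\<close>, the
  hypothesis \<open>char\<close> says that \<open>X\<close> keeps its characteristic function, hence
  its law by Levy's theorem; the claim is this equality of laws evaluated on
  \<open>A\<close>.\<close>

lemma weighted_distribution_unique:
  fixes X W :: "'a \<Rightarrow> real"
  assumes [measurable]: "random_variable borel X" "random_variable borel W"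
    and pos: "\<And>w. 0 < W w" and bound: "\<And>w. W w \<le> B"
    and char: "\<And>s. expectation (\<lambda>w. complex_of_real (W w) * iexp (s * X w)) =
                    char (distr M borel X) s * complex_of_real (expectation W)"
    and [measurable]: "A \<in> sets borel"
  shows "expectation (\<lambda>w. W w * indicator A (X w)) = prob {w\<in>space M. X w \<in> A} * expectation W"
proof -
  have intW: "integrable M W"
    using pos bound by (intro integrable_const_bound[where B=B]) (auto intro: less_imp_le simp: abs_of_pos)
  define m where "m = expectation W"
  have m: "m > 0"
  proof (rule ccontr)
    assume "\<not> m > 0"
    moreover have "m \<ge> 0" unfolding m_def using pos by (intro integral_nonneg_AE) (auto intro: less_imp_le)
    ultimately have "expectation W = 0" unfolding m_def by simp
    hence "AE w in M. W w = 0"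
      using integral_nonneg_eq_0_iff_AE[OF intW] pos by (auto intro: less_imp_le)
    moreover have "AE w in M. W w \<noteq> 0" using pos by (intro AE_I2) (metis less_irrefl)
    ultimately have "AE w in M. False" by eventually_elim simp
    thus False by simp
  qed
  define N where "N = density M (\<lambda>w. ennreal (W w / m))"
  have [simp]: "sets N = sets M" "space N = space M" unfolding N_def by auto
  have pN: "prob_space N"
  proof
    have "emeasure N (space N) = (\<integral>\<^sup>+w. ennreal (W w / m) \<partial>M)"
      unfolding N_def by (subst emeasure_density) (auto intro!: nn_integral_cong)
    also have "\<dots> = ennreal (expectation (\<lambda>w. W w / m))"
      using intW m pos by (intro nn_integral_eq_integral) (auto intro!: AE_I2 divide_nonneg_pos less_imp_le)
    also have "expectation (\<lambda>w. W w / m) = 1" using m unfolding m_def by simp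
    finally show "emeasure N (space N) = 1" by simp
  qed
  interpret N: prob_space N by (rule pN)
  have [measurable]: "X \<in> borel_measurable N" by (simp add: N_def)
  have "distr N borel X = distr M borel X"
  proof (rule Levy_uniqueness)
    show "real_distribution (distr N borel X)" by (rule N.real_distribution_distr) simp
    show "real_distribution (distr M borel X)" by (rule real_distribution_distr) simp
    show "char (distr N borel X) = char (distr M borel X)"
    proof
      fix s
      have "char (distr N borel X) s = (\<integral>w. iexp (s * X w) \<partial>N)"
        unfolding char_def by (subst integral_distr) auto
      also have "\<dots> = expectation (\<lambda>w. (W w / m) *\<^sub>R iexp (s * X w))"
        unfolding N_def using m pos by (subst integral_density) (auto intro!: AE_I2 divide_nonneg_pos less_imp_le)
      also have "\<dots> = expectation (\<lambda>w. complex_of_real (W w) * iexp (s * X w) / complex_of_real m)"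
        by (intro Bochner_Integration.integral_cong) (auto simp: scaleR_conv_of_real)
      also have "\<dots> = char (distr M borel X) s"
        using m char[of s] by (simp add: m_def)
      finally show "char (distr N borel X) s = char (distr M borel X) s" .
    qed
  qed
  hence "measure (distr N borel X) A = measure (distr M borel X) A" by simp
  hence eq: "measure N {w\<in>space M. X w \<in> A} = prob {w\<in>space M. X w \<in> A}"
    by (simp add: measure_distr vimage_def Int_def conj_commute)
  have "measure N {w\<in>space M. X w \<in> A} = (\<integral>w. indicator {w\<in>space M. X w \<in> A} w \<partial>N)"
    by simp
  also have "\<dots> = expectation (\<lambda>w. (W w / m) *\<^sub>R indicator {w\<in>space M. X w \<in> A} w)"
    unfolding N_def using m pos by (subst integral_density) (auto intro!: AE_I2 divide_nonneg_pos less_imp_le)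
  also have "\<dots> = expectation (\<lambda>w. W w * indicator A (X w) / m)"
    by (intro Bochner_Integration.integral_cong) (auto simp: indicator_def)
  also have "\<dots> = expectation (\<lambda>w. W w * indicator A (X w)) / m" by simp
  finally show ?thesis using m eq by (simp add: m_def field_simps)
qed

text \<open>Weighting the measure by positive bounded functions of one variable reduces the two-dimensional
  uniqueness problem to Levy's one-dimensional theorem.\<close>

lemma indep_var_real_charI:
  fixes X Y :: "'a \<Rightarrow> real"
  assumes [measurable]: "random_variable borel X" "random_variable borel Y"
    and char: "\<And>s t. expectation (\<lambda>w. iexp (s * X w + t * Y w)) =
                  char (distr M borel X) s * char (distr M borel Y) t"
  shows "indep_var borel X borel Y"
proof -
  let ?\<phi> = "char (distr M borel X)" and ?\<psi> = "char (distr M borel Y)"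
  interpret dX: real_distribution "distr M borel X" by (rule real_distribution_distr) simp
  interpret dY: real_distribution "distr M borel Y" by (rule real_distribution_distr) simp
  have psi: "?\<psi> t = expectation (\<lambda>w. iexp (t * Y w))" for t
    unfolding char_def by (subst integral_distr) auto
  have phi: "?\<phi> t = expectation (\<lambda>w. iexp (t * X w))" for t
    unfolding char_def by (subst integral_distr) auto
  have ie: "integrable M (\<lambda>w. iexp (s * X w + t * Y w))" for s t
    by (rule integrable_iexp) auto
  have ie': "integrable M (\<lambda>w. iexp (t * Y w))" for t
    by (rule integrable_iexp) auto
  have ie'': "integrable M (\<lambda>w. iexp (t * X w))" for t
    by (rule integrable_iexp) auto
  \<comment> \<open>The weight \<open>cos (t * Y w)\<close> averages the frequencies
    \<open>t\<close> and \<open>-t\<close> of \<open>Y\<close>, so the product form of the joint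
    characteristic function lets it factor out.\<close>
  have cosE: "expectation (\<lambda>w. complex_of_real (cos (t * Y w)) * iexp (s * X w)) =
              ?\<phi> s * complex_of_real (expectation (\<lambda>w. cos (t * Y w)))" for s t
  proof -
    have "expectation (\<lambda>w. complex_of_real (cos (t * Y w)) * iexp (s * X w)) =
          expectation (\<lambda>w. (iexp (s * X w + t * Y w) + iexp (s * X w + (-t) * Y w)) / 2)"
      by (intro Bochner_Integration.integral_cong)
         (use of_real_cos_mult_iexp[of "t * Y _" "s * X _"] of_real_cos_mult_iexp[of "t * Y _" 0] in simp_all)
    also have "\<dots> = (?\<phi> s * ?\<psi> t + ?\<phi> s * ?\<psi> (-t)) / 2"
      using ie[of s t] ie[of s "-t"] char[of s t] char[of s "-t"] by simp
    also have "\<dots> = ?\<phi> s * ((?\<psi> t + ?\<psi> (-t)) / 2)" by (simp add: algebra_simps add_divide_distrib)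
    also have "(?\<psi> t + ?\<psi> (-t)) / 2 = expectation (\<lambda>w. (iexp (t * Y w) + iexp ((-t) * Y w)) / 2)"
      unfolding psi using ie'[of t] ie'[of "-t"] by simp
    also have "\<dots> = expectation (\<lambda>w. complex_of_real (cos (t * Y w)))"
      by (intro Bochner_Integration.integral_cong)
         (use of_real_cos_mult_iexp[of "t * Y _" "s * X _"] of_real_cos_mult_iexp[of "t * Y _" 0] in simp_all)
    finally show ?thesis by simp
  qed
  have sinE: "expectation (\<lambda>w. complex_of_real (sin (t * Y w)) * iexp (s * X w)) =
              ?\<phi> s * complex_of_real (expectation (\<lambda>w. sin (t * Y w)))" for s t
  proof -
    have "expectation (\<lambda>w. complex_of_real (sin (t * Y w)) * iexp (s * X w)) =
          expectation (\<lambda>w. (iexp (s * X w + t * Y w) - iexp (s * X w + (-t) * Y w)) / (2 * \<i>))"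
      by (intro Bochner_Integration.integral_cong)
         (use of_real_sin_mult_iexp[of "t * Y _" "s * X _"] of_real_sin_mult_iexp[of "t * Y _" 0] in simp_all)
    also have "\<dots> = (?\<phi> s * ?\<psi> t - ?\<phi> s * ?\<psi> (-t)) / (2 * \<i>)"
      using ie[of s t] ie[of s "-t"] char[of s t] char[of s "-t"] by simp
    also have "\<dots> = ?\<phi> s * ((?\<psi> t - ?\<psi> (-t)) / (2 * \<i>))" by (simp add: algebra_simps diff_divide_distrib)
    also have "(?\<psi> t - ?\<psi> (-t)) / (2 * \<i>) = expectation (\<lambda>w. (iexp (t * Y w) - iexp ((-t) * Y w)) / (2 * \<i>))"
      unfolding psi using ie'[of t] ie'[of "-t"] by simp
    also have "\<dots> = expectation (\<lambda>w. complex_of_real (sin (t * Y w)))"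
      by (intro Bochner_Integration.integral_cong)
         (use of_real_sin_mult_iexp[of "t * Y _" "s * X _"] of_real_sin_mult_iexp[of "t * Y _" 0] in simp_all)
    finally show ?thesis by simp
  qed
  have ib: "integrable M f" if "random_variable borel f" "\<And>w. \<bar>f w\<bar> \<le> 1" for f :: "'a \<Rightarrow> real"
    using that by (intro integrable_const_bound[where B=1]) auto
  have icb: "integrable M (\<lambda>w. complex_of_real (f w) * iexp (s * X w))"
    if [measurable]: "random_variable borel f" and "\<And>w. \<bar>f w\<bar> \<le> 1" for f :: "'a \<Rightarrow> real" and s
    using that by (intro integrable_const_bound[where B=1]) (auto simp: norm_mult)
  define p where "p A = prob {w\<in>space M. X w \<in> A}" for A
  \<comment> \<open>The weight lemma needs positivity, while \<open>f\<close> may change sign. As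
    \<open>f\<close> is bounded by 1 in modulus, \<open>2 + f\<close> lies in \<open>[1, 3]\<close>,
    and the contribution of the constant 2 cancels by linearity.\<close>
  have step: "expectation (\<lambda>w. f w * indicator A (X w)) = p A * expectation f"
    if [measurable]: "random_variable borel f" and f: "\<And>w. \<bar>f w\<bar> \<le> 1"
      and E: "\<And>s. expectation (\<lambda>w. complex_of_real (f w) * iexp (s * X w)) = ?\<phi> s * complex_of_real (expectation f)"
      and [measurable]: "A \<in> sets borel" for f :: "'a \<Rightarrow> real" and A
  proof -
    have "expectation (\<lambda>w. (2 + f w) * indicator A (X w)) = prob {w\<in>space M. X w \<in> A} * expectation (\<lambda>w. 2 + f w)"
    proof (rule weighted_distribution_unique)
      show "0 < 2 + f w" for w using f[of w] by linarith
      show "2 + f w \<le> 3" for w using f[of w] by linarith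
      show "expectation (\<lambda>w. complex_of_real (2 + f w) * iexp (s * X w)) =
            ?\<phi> s * complex_of_real (expectation (\<lambda>w. 2 + f w))" for s
      proof -
        have "expectation (\<lambda>w. complex_of_real (2 + f w) * iexp (s * X w)) =
              expectation (\<lambda>w. 2 * iexp (s * X w) + complex_of_real (f w) * iexp (s * X w))"
          by (intro Bochner_Integration.integral_cong refl) (simp only: of_real_add distrib_right of_real_numeral)
        also have "\<dots> = 2 * ?\<phi> s + ?\<phi> s * complex_of_real (expectation f)"
          unfolding phi[of s]
          by (subst Bochner_Integration.integral_add[OF integrable_mult_right[OF ie''] icb[OF that(1) f]])
             (simp only: E phi integral_mult_right_zero)
        also have "\<dots> = ?\<phi> s * complex_of_real (expectation (\<lambda>w. 2 + f w))"
          by (subst Bochner_Integration.integral_add[OF integrable_const ib[OF that(1) f]])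
             (simp add: prob_space algebra_simps)
        finally show ?thesis .
      qed
    qed (use that in auto)
    moreover have "expectation (\<lambda>w. (2 + f w) * indicator A (X w)) =
          2 * p A + expectation (\<lambda>w. f w * indicator A (X w))"
    proof -
      have "integrable M (\<lambda>w. f w * indicator A (X w))"
        by (rule ib) (use f in \<open>auto simp: indicator_def abs_mult\<close>)
      moreover have "integrable M (\<lambda>w. indicator A (X w) :: real)"
        by (rule ib) (auto simp: indicator_def)
      moreover have "expectation (\<lambda>w. indicator A (X w) :: real) = p A"
        by (simp add: p_def expectation_indicator_comp)
      ultimately show ?thesis by (simp add: ring_distribs)
    qed
    moreover have "expectation (\<lambda>w. 2 + f w) = 2 + expectation f"
      by (subst Bochner_Integration.integral_add[OF integrable_const ib[OF that(1) f]]) (simp add: prob_space)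
    ultimately show ?thesis by (simp add: p_def[symmetric] distrib_left)
  qed
  have AB: "prob {w\<in>space M. X w \<in> A \<and> Y w \<in> B} = prob {w\<in>space M. X w \<in> A} * prob {w\<in>space M. Y w \<in> B}"
    if [measurable]: "A \<in> sets borel" "B \<in> sets borel" for A B
  proof -
    let ?W = "\<lambda>w. 1 + indicator A (X w) :: real"
    have iA: "integrable M (\<lambda>w. indicator A (X w) :: real)"
      by (rule ib) (auto simp: indicator_def)
    have EA: "expectation (\<lambda>w. indicator A (X w) :: real) = p A"
      and EB: "expectation (\<lambda>w. indicator B (Y w) :: real) = prob {w\<in>space M. Y w \<in> B}"
      by (simp_all add: p_def expectation_indicator_comp)
    have EAB: "expectation (\<lambda>w. indicator A (X w) * indicator B (Y w) :: real) = prob {w\<in>space M. X w \<in> A \<and> Y w \<in> B}"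
    proof -
      have "expectation (\<lambda>w. indicator A (X w) * indicator B (Y w) :: real) = expectation (indicator {w\<in>space M. X w \<in> A \<and> Y w \<in> B})"
        by (intro Bochner_Integration.integral_cong) (auto simp: indicator_def)
      thus ?thesis by simp
    qed
    have iB: "integrable M (\<lambda>w. indicator B (Y w) :: real)"
      by (rule ib) (auto simp: indicator_def)
    have iAB: "integrable M (\<lambda>w. indicator A (X w) * indicator B (Y w) :: real)"
      by (rule ib) (auto simp: indicator_def)
    have EW: "expectation ?W = 1 + p A"
      by (subst Bochner_Integration.integral_add[OF integrable_const iA]) (simp add: prob_space EA)
    \<comment> \<open>Second pass with the roles exchanged: the weight now depends on
      \<open>X\<close> and the variable is \<open>Y\<close>. The characteristic function that is
      required splits into cosine and sine parts, both settled by \<open>step\<close>.\<close>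
    have "expectation (\<lambda>w. ?W w * indicator B (Y w)) = prob {w\<in>space M. Y w \<in> B} * expectation ?W"
    proof (rule weighted_distribution_unique)
      show "0 < ?W w" "?W w \<le> 2" for w by (auto simp: indicator_def)
      fix s
      have c: "expectation (\<lambda>w. cos (s * Y w) * indicator A (X w)) = p A * expectation (\<lambda>w. cos (s * Y w))"
        by (rule step) (use cosE in auto)
      have d: "expectation (\<lambda>w. sin (s * Y w) * indicator A (X w)) = p A * expectation (\<lambda>w. sin (s * Y w))"
        by (rule step) (use sinE in auto)
      have i1: "integrable M (\<lambda>w. cos (s * Y w) * indicator A (X w))" "integrable M (\<lambda>w. sin (s * Y w) * indicator A (X w))"
        "integrable M (\<lambda>w. cos (s * Y w))" "integrable M (\<lambda>w. sin (s * Y w))"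
        by (auto intro!: ib simp: indicator_def)
      have dec: "iexp u = complex_of_real (cos u) + \<i> * complex_of_real (sin u)" for u
        by (metis cis_conv_exp complex_eq cis.simps)
      have eY: "expectation (\<lambda>w. iexp (s * Y w)) = complex_of_real (expectation (\<lambda>w. cos (s * Y w))) + \<i> * complex_of_real (expectation (\<lambda>w. sin (s * Y w)))"
        unfolding dec using i1(3,4) by simp
      have "expectation (\<lambda>w. complex_of_real (?W w) * iexp (s * Y w)) =
         expectation (\<lambda>w. iexp (s * Y w) + (complex_of_real (cos (s * Y w) * indicator A (X w))
            + \<i> * complex_of_real (sin (s * Y w) * indicator A (X w))))"
        by (intro Bochner_Integration.integral_cong refl) (simp only: dec, simp add: algebra_simps indicator_def)
      also have "\<dots> = ?\<psi> s + (complex_of_real (p A * expectation (\<lambda>w. cos (s * Y w)))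
            + \<i> * complex_of_real (p A * expectation (\<lambda>w. sin (s * Y w))))"
        using i1(1,2) ie'[of s] c d unfolding psi
        by (simp add: Bochner_Integration.integral_add del: of_real_mult)
      also have "\<dots> = ?\<psi> s * complex_of_real (expectation ?W)"
        unfolding EW psi eY by (simp add: algebra_simps)
      finally show "expectation (\<lambda>w. complex_of_real (?W w) * iexp (s * Y w)) = ?\<psi> s * complex_of_real (expectation ?W)" .
    qed auto
    moreover have "expectation (\<lambda>w. ?W w * indicator B (Y w)) =
        prob {w\<in>space M. Y w \<in> B} + prob {w\<in>space M. X w \<in> A \<and> Y w \<in> B}"
      unfolding distrib_right mult_1 by (subst Bochner_Integration.integral_add[OF iB iAB]) (simp only: EB EAB)
    ultimately show ?thesis unfolding EW p_def by (simp add: algebra_simps)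
  qed
  show ?thesis
    unfolding indep_var_distribution_eq
  proof (intro conjI assms pair_measure_eqI)
    fix A B assume "A \<in> sets (distr M borel X)" "B \<in> sets (distr M borel Y)"
    hence [measurable]: "A \<in> sets borel" "B \<in> sets borel" by auto
    have "emeasure (distr M borel X) A * emeasure (distr M borel Y) B = 
        ennreal (prob {w\<in>space M. X w \<in> A} * prob {w\<in>space M. Y w \<in> B})"
      by (simp add: emeasure_distr emeasure_eq_measure ennreal_mult' vimage_def Int_def conj_commute)
    also have "\<dots> = emeasure (distr M (borel \<Otimes>\<^sub>M borel) (\<lambda>x. (X x, Y x))) (A \<times> B)"
      by (subst AB[symmetric]) (auto simp: emeasure_distr emeasure_eq_measure intro!: arg_cong[where f=prob])
    finally show "emeasure (distr M borel X) A * emeasure (distr M borel Y) B = \<dots>" .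
  next
    show "sigma_finite_measure (distr M borel X)" "sigma_finite_measure (distr M borel Y)"
      by (rule dX.sigma_finite_measure_axioms dY.sigma_finite_measure_axioms)+
    show "sets (distr M borel X \<Otimes>\<^sub>M distr M borel Y) = sets (distr M (borel \<Otimes>\<^sub>M borel) (\<lambda>x. (X x, Y x)))"
      by (simp cong: sets_pair_measure_cong)
  qed
qed

section \<open>Complex Gaussians through their characteristic functions\<close>

lemma char_normal_distributed:
  assumes "0 < \<sigma>" and D: "distributed M lborel X (normal_density 0 \<sigma>)"
  shows "expectation (\<lambda>w. iexp (t * X w)) = complex_of_real (exp (- (t\<^sup>2 * \<sigma>\<^sup>2 / 2)))"
proof -
  have D': "distributed M lborel (\<lambda>x. X x / \<sigma>) std_normal_density"
    using normal_standard_normal_convert[OF assms(1), of X 0] D by simp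
  have [measurable]: "random_variable borel X" using distributed_measurable[OF D] by simp
  have "expectation (\<lambda>w. iexp (t * X w)) = expectation (\<lambda>w. iexp ((t * \<sigma>) * (X w / \<sigma>)))"
    using assms(1) by simp
  also have "\<dots> = char (distr M lborel (\<lambda>x. X x / \<sigma>)) (t * \<sigma>)"
    unfolding char_def by (subst integral_distr) auto
  also have "distr M lborel (\<lambda>x. X x / \<sigma>) = std_normal_distribution"
    by (rule distributed_distr_eq_density[OF D', symmetric, THEN sym])
  also have "char \<dots> (t * \<sigma>) = complex_of_real (exp (- (t\<^sup>2 * \<sigma>\<^sup>2 / 2)))"
    by (simp add: char_std_normal_distribution power_mult_distrib)
  finally show ?thesis .
qed

lemma complex_gaussian_measurable:
  assumes "complex_gaussian M v Z" shows "random_variable borel Z"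
  using assms unfolding complex_gaussian_def borel_measurable_complex_iff
  by (auto dest: distributed_measurable)

lemma complex_gaussian_char:
  assumes "0 < v" "complex_gaussian M v Z"
  shows "expectation (\<lambda>w. iexp (s * Re (Z w) + t * Im (Z w))) =
         complex_of_real (exp (- v * (s\<^sup>2 + t\<^sup>2) / 4))"
proof -
  note Z = assms(2)[unfolded complex_gaussian_def]
  have [measurable]: "random_variable borel Z" using complex_gaussian_measurable assms by blast
  have v: "sqrt (v / 2) > 0" "(sqrt (v / 2))\<^sup>2 = v / 2" using assms by auto
  have "expectation (\<lambda>w. iexp (s * Re (Z w) + t * Im (Z w))) =
        expectation (\<lambda>w. iexp (s * Re (Z w)) * iexp (t * Im (Z w)))"
    by (simp add: exp_add ring_distribs)
  also have "\<dots> = expectation (\<lambda>w. iexp (s * Re (Z w))) * expectation (\<lambda>w. iexp (t * Im (Z w)))"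
  proof (rule indep_var_lebesgue_integral)
    have "indep_var borel ((\<lambda>x. iexp (s * x)) \<circ> (\<lambda>w. Re (Z w))) borel ((\<lambda>x. iexp (t * x)) \<circ> (\<lambda>w. Im (Z w)))"
      by (rule indep_var_compose[OF Z[THEN conjunct2, THEN conjunct2]]) simp_all
    thus "indep_var borel (\<lambda>w. iexp (s * Re (Z w))) borel (\<lambda>w. iexp (t * Im (Z w)))"
      by (simp only: comp_def)
  qed (auto intro!: integrable_iexp)
  also have "expectation (\<lambda>w. iexp (s * Re (Z w))) = complex_of_real (exp (- (s\<^sup>2 * (sqrt (v / 2))\<^sup>2 / 2)))"
    by (rule char_normal_distributed) (use Z v in auto)
  also have "expectation (\<lambda>w. iexp (t * Im (Z w))) = complex_of_real (exp (- (t\<^sup>2 * (sqrt (v / 2))\<^sup>2 / 2)))"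
    by (rule char_normal_distributed) (use Z v in auto)
  also have "complex_of_real (exp (- (s\<^sup>2 * (sqrt (v / 2))\<^sup>2 / 2))) * complex_of_real (exp (- (t\<^sup>2 * (sqrt (v / 2))\<^sup>2 / 2))) =
      complex_of_real (exp (- v * (s\<^sup>2 + t\<^sup>2) / 4))"
    unfolding v(2) by (simp add: exp_add[symmetric] algebra_simps add_divide_distrib flip: of_real_mult)
  finally show ?thesis .
qed

text \<open>Putting \<open>t = 0\<close> or \<open>s = 0\<close> identifies the marginals by Levy's
  theorem, and the factorisation of the exponential then yields independence of real and imaginary
  part.\<close>

lemma complex_gaussianI:
  assumes v: "0 < v" and [measurable]: "random_variable borel Z"
    and char: "\<And>s t. expectation (\<lambda>w. iexp (s * Re (Z w) + t * Im (Z w))) =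
                 complex_of_real (exp (- v * (s\<^sup>2 + t\<^sup>2) / 4))"
  shows "complex_gaussian M v Z"
proof -
  have v': "sqrt (v / 2) > 0" "(sqrt (v / 2))\<^sup>2 = v / 2" using assms by auto
  have *: "distributed M lborel X (normal_density 0 (sqrt (v / 2))) \<and>
        (\<forall>t. char (distr M borel X) t = complex_of_real (exp (- v * t\<^sup>2 / 4)))"
    if [measurable]: "random_variable borel X"
      and c: "\<And>t. expectation (\<lambda>w. iexp (t * X w)) = complex_of_real (exp (- v * t\<^sup>2 / 4))" for X
  proof -
    have ch: "char (distr M borel X) t = complex_of_real (exp (- v * t\<^sup>2 / 4))" for t
      unfolding char_def by (subst integral_distr) (use c[of t] in \<open>auto\<close>)
    have "distr M borel (\<lambda>w. X w / sqrt (v / 2)) = std_normal_distribution"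
    proof (rule Levy_uniqueness)
      show "char (distr M borel (\<lambda>w. X w / sqrt (v / 2))) = char std_normal_distribution"
      proof
        fix t
        have "char (distr M borel (\<lambda>w. X w / sqrt (v / 2))) t = expectation (\<lambda>w. iexp (t / sqrt (v / 2) * X w))"
          unfolding char_def by (subst integral_distr) auto
        also have "\<dots> = complex_of_real (exp (- v * (t / sqrt (v / 2))\<^sup>2 / 4))" by (rule c)
        also have "\<dots> = char std_normal_distribution t"
          using v v' by (simp add: char_std_normal_distribution power_divide del: real_sqrt_divide)
        finally show "char (distr M borel (\<lambda>w. X w / sqrt (v / 2))) t = char std_normal_distribution t" .
      qed
    qed (auto intro: real_distribution_distr real_dist_normal_dist)
    hence "distributed M lborel (\<lambda>w. (X w - 0) / sqrt (v / 2)) std_normal_density"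
      unfolding distributed_def by (auto simp: cong: distr_cong)
    thus ?thesis using normal_standard_normal_convert[OF v'(1), of X 0] ch by auto
  qed
  have R: "distributed M lborel (\<lambda>w. Re (Z w)) (normal_density 0 (sqrt (v / 2))) \<and>
        (\<forall>t. char (distr M borel (\<lambda>w. Re (Z w))) t = complex_of_real (exp (- v * t\<^sup>2 / 4)))"
    using char[of _ 0] by (intro *) auto
  have I: "distributed M lborel (\<lambda>w. Im (Z w)) (normal_density 0 (sqrt (v / 2))) \<and>
        (\<forall>t. char (distr M borel (\<lambda>w. Im (Z w))) t = complex_of_real (exp (- v * t\<^sup>2 / 4)))"
    using char[of 0] by (intro *) auto
  have "indep_var borel (\<lambda>w. Re (Z w)) borel (\<lambda>w. Im (Z w))"
  proof (intro indep_var_real_charI)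
    fix s t
    show "expectation (\<lambda>w. iexp (s * Re (Z w) + t * Im (Z w))) =
        char (distr M borel (\<lambda>w. Re (Z w))) s * char (distr M borel (\<lambda>w. Im (Z w))) t"
      unfolding char using R I
      by (simp add: exp_add[symmetric] ring_distribs add_divide_distrib flip: of_real_mult)
  qed simp_all
  thus ?thesis using R I by (simp add: complex_gaussian_def)
qed

text \<open>Circular symmetry: multiplying by \<open>c\<close> acts on the frequency pair
  \<open>(s, t)\<close> as a rotation combined with a dilation by \<open>cmod c\<close>, and the
  characteristic function depends only on \<open>s\<^sup>2 + t\<^sup>2\<close>.\<close>

lemma complex_gaussian_cmult:
  assumes v: "0 < v" and Z: "complex_gaussian M v Z" and c: "c \<noteq> 0"
  shows "complex_gaussian M (v * (cmod c)\<^sup>2) (\<lambda>w. c * Z w)"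
proof (rule complex_gaussianI)
  have [measurable]: "random_variable borel Z" using complex_gaussian_measurable Z by blast
  show "random_variable borel (\<lambda>w. c * Z w)" by simp
  show "0 < v * (cmod c)\<^sup>2" using v c by simp
  fix s t
  have "expectation (\<lambda>w. iexp (s * Re (c * Z w) + t * Im (c * Z w))) =
     expectation (\<lambda>w. iexp ((s * Re c + t * Im c) * Re (Z w) + (t * Re c - s * Im c) * Im (Z w)))"
    by (intro Bochner_Integration.integral_cong refl arg_cong[where f=iexp]) (simp add: algebra_simps)
  also have "\<dots> = complex_of_real (exp (- v * ((s * Re c + t * Im c)\<^sup>2 + (t * Re c - s * Im c)\<^sup>2) / 4))"
    by (rule complex_gaussian_char[OF v Z])
  also have "(s * Re c + t * Im c)\<^sup>2 + (t * Re c - s * Im c)\<^sup>2 = (cmod c)\<^sup>2 * (s\<^sup>2 + t\<^sup>2)"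
    unfolding cmod_power2 by (simp add: power2_eq_square algebra_simps)
  finally show "expectation (\<lambda>w. iexp (s * Re (c * Z w) + t * Im (c * Z w))) =
      complex_of_real (exp (- (v * (cmod c)\<^sup>2) * (s\<^sup>2 + t\<^sup>2) / 4))" by (simp add: mult.assoc)
qed

end

section \<open>Almost sure convergence of independent series\<close>

context prob_space
begin

lemma indep_vars_reindex_inj:
  assumes indep: "indep_vars N X UNIV" and f: "inj f"
  shows "indep_vars (\<lambda>i. N (f i)) (\<lambda>i. X (f i)) UNIV"
  unfolding indep_vars_def2 indep_sets_def
proof (intro conjI ballI allI impI)
  show "random_variable (N (f i)) (X (f i))" for i using indep by (auto simp: indep_vars_def)
  thus "{X (f i) -` A \<inter> space M |A. A \<in> sets (N (f i))} \<subseteq> events" for i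
    by (auto dest: measurable_sets)
  fix J A
  assume J: "J \<noteq> {}" "finite J" and A: "A \<in> (\<Pi> i\<in>J. {X (f i) -` A \<inter> space M |A. A \<in> sets (N (f i))})"
  have g: "the_inv_into UNIV f (f i) = i" for i using f by (rule the_inv_into_f_f) simp
  have "prob (\<Inter>j\<in>f ` J. A (the_inv_into UNIV f j)) = (\<Prod>j\<in>f ` J. prob (A (the_inv_into UNIV f j)))"
  proof -
    have "(\<lambda>j. A (the_inv_into UNIV f j)) \<in> (\<Pi> i\<in>f ` J. {X i -` A \<inter> space M |A. A \<in> sets (N i)})"
      using A by (auto simp: Pi_def g)
    moreover have "f ` J \<noteq> {}" "finite (f ` J)" using J by auto
    ultimately show ?thesis
      using indep[unfolded indep_vars_def2 indep_sets_def, THEN conjunct2, THEN conjunct2, rule_format, OF subset_UNIV]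
      by meson
  qed
  also have "\<dots> = (\<Prod>j\<in>J. prob (A j))"
    by (subst prod.reindex[OF inj_on_subset[OF f subset_UNIV]]) (simp add: g)
  also have "(\<Inter>j\<in>f ` J. A (the_inv_into UNIV f j)) = (\<Inter>j\<in>J. A j)" by (simp add: g)
  finally show "prob (\<Inter>j\<in>J. A j) = (\<Prod>j\<in>J. prob (A j))" .
qed

text \<open>Split by the first index at which the partial sum reaches \<open>e\<close>. What happens
  up to that index is independent of the later increment, which has mean 0; so on each such event
  the second moment of the final sum is at least that of the stopped sum, hence at least
  \<open>e\<^sup>2\<close> times the probability of the event.\<close>

lemma kolmogorov_maximal_inequality:
  fixes X :: "nat \<Rightarrow> 'a \<Rightarrow> real"
  assumes indep: "indep_vars (\<lambda>_. borel) X UNIV"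
    and sq: "\<And>i. integrable M (\<lambda>w. (X i w)\<^sup>2)"
    and mean: "\<And>i. expectation (X i) = 0" and e: "0 < e"
  shows "prob {w\<in>space M. \<exists>k\<le>n. e \<le> \<bar>\<Sum>i<k. X i w\<bar>} \<le> (\<Sum>i<n. expectation (\<lambda>w. (X i w)\<^sup>2)) / e\<^sup>2"
proof -
  have X[measurable]: "random_variable borel (X i)" for i
    using indep by (auto simp: indep_vars_def)
  have Xi: "integrable M (X i)" for i
    by (rule square_integrable_imp_integrable[OF X sq])
  define S where "S k w = (\<Sum>i<k. X i w)" for k w
  have S[measurable]: "random_variable borel (S k)" for k unfolding S_def by simp
  have XX: "integrable M (\<lambda>w. X i w * X j w)" for i j
  proof (rule Bochner_Integration.integrable_bound[where f="\<lambda>w. (X i w)\<^sup>2 + (X j w)\<^sup>2"])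
    show "integrable M (\<lambda>w. (X i w)\<^sup>2 + (X j w)\<^sup>2)" using sq by simp
    show "AE w in M. norm (X i w * X j w) \<le> norm ((X i w)\<^sup>2 + (X j w)\<^sup>2)"
    proof (intro AE_I2)
      fix w
      have "2 * (\<bar>X i w\<bar> * \<bar>X j w\<bar>) \<le> (X i w)\<^sup>2 + (X j w)\<^sup>2"
        using sum_squares_bound[of "\<bar>X i w\<bar>" "\<bar>X j w\<bar>"] by simp
      moreover have "0 \<le> \<bar>X i w\<bar> * \<bar>X j w\<bar>" by simp
      ultimately have "\<bar>X i w\<bar> * \<bar>X j w\<bar> \<le> (X i w)\<^sup>2 + (X j w)\<^sup>2" by linarith
      thus "norm (X i w * X j w) \<le> norm ((X i w)\<^sup>2 + (X j w)\<^sup>2)" by (simp add: abs_mult)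
    qed
  qed simp
  have EXX: "expectation (\<lambda>w. X i w * X j w) = 0" if "i \<noteq> j" for i j
  proof -
    have "expectation (\<lambda>w. \<Prod>k\<in>{i,j}. X k w) = (\<Prod>k\<in>{i,j}. expectation (X k))"
      by (rule indep_vars_lebesgue_integral) (auto intro: indep_vars_subset[OF indep] Xi)
    thus ?thesis using that mean by simp
  qed
  have SS: "integrable M (\<lambda>w. S k w * S l w)" for k l
    unfolding S_def sum_product by (intro Bochner_Integration.integrable_sum XX)
  have ES: "expectation (\<lambda>w. (S k w)\<^sup>2) = (\<Sum>i<k. expectation (\<lambda>w. (X i w)\<^sup>2))" for k
  proof -
    have "expectation (\<lambda>w. (S k w)\<^sup>2) = (\<Sum>i<k. \<Sum>j<k. expectation (\<lambda>w. X i w * X j w))"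
      unfolding S_def sum_product power2_eq_square by (simp add: Bochner_Integration.integral_sum XX)
    also have "\<dots> = (\<Sum>i<k. \<Sum>j<k. if j = i then expectation (\<lambda>w. (X i w)\<^sup>2) else 0)"
      by (intro sum.cong refl) (auto simp: EXX power2_eq_square)
    finally show ?thesis by simp
  qed
  define A where "A k = {w\<in>space M. e \<le> \<bar>S k w\<bar> \<and> (\<forall>j<k. \<bar>S j w\<bar> < e)}" for k
  have A[measurable]: "A k \<in> events" for k unfolding A_def by measurable
  have disj: "disjoint_family_on A {..n}"
    unfolding disjoint_family_on_def
  proof (intro ballI impI)
    have *: "A i \<inter> A j = {}" if "i < j" for i j :: nat using that by (force simp: A_def)
    fix i j :: nat assume "i \<noteq> j"
    thus "A i \<inter> A j = {}" using *[of i j] *[of j i] by (cases "i < j") auto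
  qed
  have un: "{w\<in>space M. \<exists>k\<le>n. e \<le> \<bar>\<Sum>i<k. X i w\<bar>} = (\<Union>k\<le>n. A k)"
  proof (intro equalityI subsetI)
    fix w assume "w \<in> {w\<in>space M. \<exists>k\<le>n. e \<le> \<bar>\<Sum>i<k. X i w\<bar>}"
    then obtain k where k: "k \<le> n" "e \<le> \<bar>S k w\<bar>" "w \<in> space M" unfolding S_def by auto
    define l where "l = (LEAST k. e \<le> \<bar>S k w\<bar>)"
    have "e \<le> \<bar>S l w\<bar>" unfolding l_def by (rule LeastI[of _ k]) (rule k)
    moreover have "l \<le> k" unfolding l_def by (rule Least_le) (rule k)
    moreover have "\<bar>S j w\<bar> < e" if "j < l" for j
      using not_less_Least[of j "\<lambda>k. e \<le> \<bar>S k w\<bar>"] that unfolding l_def not_le by blast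
    ultimately show "w \<in> (\<Union>k\<le>n. A k)" using k by (auto simp: A_def intro!: bexI[of _ l])
  qed (auto simp: A_def S_def)
  have key: "e\<^sup>2 * prob (A k) \<le> expectation (\<lambda>w. (S n w)\<^sup>2 * indicator (A k) w)" if k: "k \<le> n" for k
  proof -
    define D where "D w = (\<Sum>i\<in>{k..<n}. X i w)" for w
    have D: "S n w = S k w + D w" for w
      unfolding S_def D_def using k by (simp add: lessThan_atLeast0 sum.atLeastLessThan_concat)
    hence D': "D w = S n w - S k w" for w by simp
    have [measurable]: "random_variable borel D" unfolding D_def by simp
    have iSA: "integrable M (\<lambda>w. S i w * S j w * indicator (A k) w)" for i j
      by (intro integrable_real_mult_indicator A SS)
    have "expectation (\<lambda>w. (S k w * indicator (A k) w) * D w) = 0"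
    proof -
      \<comment> \<open>The stopped sum together with its event has to be a function of the
        coordinates below \<open>k\<close> alone, because independence of blocks is stated for
        \<open>restrict\<close> of the family.\<close>
      define f where "f x = (\<Sum>i<k. x i) * (if e \<le> \<bar>\<Sum>i<k. x i\<bar> \<and> (\<forall>j<k. \<bar>\<Sum>i<j. x i\<bar> < e) then 1 else 0)" for x :: "nat \<Rightarrow> real"
      define g where "g x = (\<Sum>i\<in>{k..<n}. x i)" for x :: "nat \<Rightarrow> real"
      have [measurable]: "(\<lambda>x. \<Sum>i<j. x i) \<in> borel_measurable (PiM {..<k} (\<lambda>_. borel :: real measure))" if "j \<le> k" for j
        using that by (intro borel_measurable_sum measurable_component_singleton) auto
      have [measurable]: "Measurable.pred (PiM {..<k} (\<lambda>_. borel :: real measure)) (\<lambda>x. \<forall>j<k. \<bar>\<Sum>i<j. x i\<bar> < e)"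
      proof -
        have "Measurable.pred (PiM {..<k} (\<lambda>_. borel :: real measure)) (\<lambda>x. \<forall>j\<in>{..<k}. \<bar>\<Sum>i<j. x i\<bar> < e)"
          by (intro pred_intros_finite) (auto intro!: borel_measurable_pred_less)
        thus ?thesis by (simp add: Ball_def)
      qed
      have mf: "f \<in> borel_measurable (PiM {..<k} (\<lambda>_. borel))" unfolding f_def by measurable
      have mg: "g \<in> borel_measurable (PiM {k..<n} (\<lambda>_. borel))" unfolding g_def by measurable
      have "indep_var borel (f \<circ> (\<lambda>w. restrict (\<lambda>i. X i w) {..<k})) borel (g \<circ> (\<lambda>w. restrict (\<lambda>i. X i w) {k..<n}))"
        by (rule indep_var_compose[OF indep_var_restrict[OF indep] mf mg]) auto
      moreover have "f (restrict (\<lambda>i. X i w) {..<k}) = S k w * indicator (A k) w" if "w \<in> space M" for w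
        using that unfolding f_def S_def A_def by (auto simp: indicator_def intro!: sum.cong)
      moreover have "g (restrict (\<lambda>i. X i w) {k..<n}) = D w" for w
        unfolding g_def D_def by (auto intro!: sum.cong)
      moreover have c: "f (restrict (\<lambda>i. X i w) {..<k}) = S k w * (if e \<le> \<bar>S k w\<bar> \<and> (\<forall>j<k. \<bar>S j w\<bar> < e) then 1 else 0)" for w
        unfolding f_def S_def by (auto intro!: sum.cong)
      ultimately have iv: "indep_var borel (\<lambda>w. S k w * (if e \<le> \<bar>S k w\<bar> \<and> (\<forall>j<k. \<bar>S j w\<bar> < e) then 1 else 0)) borel D"
        by (simp add: comp_def cong: if_cong)
      have "expectation (\<lambda>w. (S k w * indicator (A k) w) * D w) =
          expectation (\<lambda>w. (S k w * (if e \<le> \<bar>S k w\<bar> \<and> (\<forall>j<k. \<bar>S j w\<bar> < e) then 1 else 0)) * D w)"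
        by (intro Bochner_Integration.integral_cong refl) (auto simp: A_def indicator_def)
      also have "\<dots> = expectation (\<lambda>w. S k w * (if e \<le> \<bar>S k w\<bar> \<and> (\<forall>j<k. \<bar>S j w\<bar> < e) then 1 else 0)) * expectation D"
      proof (rule indep_var_lebesgue_integral[OF iv])
        have iS: "integrable M (S k)" unfolding S_def using Xi by simp
        show "integrable M (\<lambda>w. S k w * (if e \<le> \<bar>S k w\<bar> \<and> (\<forall>j<k. \<bar>S j w\<bar> < e) then 1 else 0))"
          by (rule Bochner_Integration.integrable_bound[OF iS]) auto
        show "integrable M D" unfolding D_def using Xi by simp
      qed
      also have "expectation D = 0" unfolding D_def by (simp add: Xi mean)
      finally show ?thesis by simp
    qed
    note zero = this
    have "e\<^sup>2 * prob (A k) = expectation (\<lambda>w. e\<^sup>2 * indicator (A k) w)" by simp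
    also have "\<dots> \<le> expectation (\<lambda>w. (S k w * S k w) * indicator (A k) w)"
    proof (rule integral_mono_AE)
      show "integrable M (\<lambda>w. (S k w * S k w) * indicator (A k) w)" by (rule iSA)
      have "e\<^sup>2 \<le> S k w * S k w" if "e \<le> \<bar>S k w\<bar>" for w
        using power_mono[OF that, of 2] e by (simp add: power2_eq_square)
      thus "AE w in M. e\<^sup>2 * indicator (A k) w \<le> (S k w * S k w) * indicator (A k) w"
        by (intro AE_I2) (auto simp: indicator_def A_def)
    next
      show "integrable M (\<lambda>w. e\<^sup>2 * indicator (A k) w)"
        by (intro integrable_mult_right integrable_real_indicator) (auto simp: emeasure_eq_measure)
    qed
    \<comment> \<open>The vanishing cross term is added on purpose:
      \<open>(S k w)\<^sup>2 + 2 * S k w * D w\<close> is pointwise at most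
      \<open>(S n w)\<^sup>2\<close>, the difference being \<open>(D w)\<^sup>2\<close>.\<close>
    also have "\<dots> = expectation (\<lambda>w. (S k w * S k w) * indicator (A k) w) + 2 * expectation (\<lambda>w. (S k w * indicator (A k) w) * D w)"
      using zero by simp
    also have "\<dots> = expectation (\<lambda>w. (S k w * S k w) * indicator (A k) w + 2 * (S k w * S n w * indicator (A k) w - S k w * S k w * indicator (A k) w))"
    proof -
      have "(\<lambda>w. (S k w * indicator (A k) w) * D w) = (\<lambda>w. S k w * S n w * indicator (A k) w - S k w * S k w * indicator (A k) w)"
        unfolding D' by (auto simp: algebra_simps)
      hence "expectation (\<lambda>w. (S k w * indicator (A k) w) * D w) =
          expectation (\<lambda>w. S k w * S n w * indicator (A k) w - S k w * S k w * indicator (A k) w)" by simp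
      thus ?thesis
        by (subst Bochner_Integration.integral_add[OF iSA integrable_mult_right[OF Bochner_Integration.integrable_diff[OF iSA iSA]]])
           (simp only: integral_mult_right_zero)
    qed
    also have "\<dots> \<le> expectation (\<lambda>w. (S n w * S n w) * indicator (A k) w)"
    proof (rule integral_mono)
      fix w
      have "S k w * S k w + 2 * (S k w * S n w - S k w * S k w) \<le> S n w * S n w"
        using zero_le_square[of "S n w - S k w"] by (simp add: algebra_simps)
      thus "(S k w * S k w) * indicator (A k) w + 2 * (S k w * S n w * indicator (A k) w - S k w * S k w * indicator (A k) w) \<le> (S n w * S n w) * indicator (A k) w"
        by (auto simp: indicator_def)
    qed (intro Bochner_Integration.integrable_add integrable_mult_right Bochner_Integration.integrable_diff iSA)+
    finally show ?thesis by (simp add: power2_eq_square)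
  qed
  have iS2A: "integrable M (\<lambda>w. (S n w)\<^sup>2 * indicator (A k) w)" for k
    unfolding power2_eq_square by (rule integrable_real_mult_indicator[OF A SS])
  have iS2: "integrable M (\<lambda>w. (S n w)\<^sup>2)" unfolding power2_eq_square by (rule SS)
  have "e\<^sup>2 * prob {w\<in>space M. \<exists>k\<le>n. e \<le> \<bar>\<Sum>i<k. X i w\<bar>} = (\<Sum>k\<le>n. e\<^sup>2 * prob (A k))"
    unfolding un using disj by (subst finite_measure_finite_Union) (auto simp: sum_distrib_left)
  also have "\<dots> \<le> (\<Sum>k\<le>n. expectation (\<lambda>w. (S n w)\<^sup>2 * indicator (A k) w))"
    by (intro sum_mono key) auto
  also have "\<dots> = expectation (\<lambda>w. \<Sum>k\<le>n. (S n w)\<^sup>2 * indicator (A k) w)"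
    by (rule Bochner_Integration.integral_sum[symmetric]) (rule iS2A)
  also have "\<dots> \<le> expectation (\<lambda>w. (S n w)\<^sup>2)"
  proof (rule integral_mono)
    fix w
    have "(\<Sum>k\<le>n. indicator (A k) w :: real) = indicator (\<Union>k\<le>n. A k) w"
      using disj by (subst indicator_UN_disjoint) auto
    hence "(\<Sum>k\<le>n. indicator (A k) w :: real) \<le> 1" by (simp add: indicator_def)
    from mult_left_mono[OF this, of "(S n w)\<^sup>2"]
    show "(\<Sum>k\<le>n. (S n w)\<^sup>2 * indicator (A k) w) \<le> (S n w)\<^sup>2" by (simp add: sum_distrib_left)
  qed (intro Bochner_Integration.integrable_sum iS2A iS2)+
  finally show ?thesis using e by (simp add: ES field_simps)
qed

text \<open>The maximal inequality for the series started at \<open>m\<close> bounds the probability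
  of ever moving by \<open>e\<close> by a tail of the variances. Hence, for each \<open>j\<close>,
  the paths that move by \<open>1 / Suc j\<close> after every \<open>m\<close> form a null set, and
  all remaining paths are Cauchy.\<close>

lemma AE_summable_of_summable_variance:
  fixes X :: "nat \<Rightarrow> 'a \<Rightarrow> real"
  assumes indep: "indep_vars (\<lambda>_. borel) X UNIV"
    and sq: "\<And>i. integrable M (\<lambda>w. (X i w)\<^sup>2)"
    and mean: "\<And>i. expectation (X i) = 0"
    and summ: "summable (\<lambda>i. expectation (\<lambda>w. (X i w)\<^sup>2))"
  shows "AE w in M. summable (\<lambda>i. X i w)"
proof -
  have X[measurable]: "random_variable borel (X i)" for i
    using indep by (auto simp: indep_vars_def)
  let ?v = "\<lambda>i. expectation (\<lambda>w. (X i w)\<^sup>2)"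
  have v0: "0 \<le> ?v i" for i by simp
  define B where "B e m = {w\<in>space M. \<exists>k. e \<le> \<bar>\<Sum>i<k. X (i + m) w\<bar>}" for e :: real and m
  have [measurable]: "B e m \<in> events" for e m unfolding B_def by measurable
  have pB: "prob (B e m) \<le> (\<Sum>i. ?v (i + m)) / e\<^sup>2" if e: "e > 0" for e m
  proof -
    define C where "C n = {w\<in>space M. \<exists>k\<le>n. e \<le> \<bar>\<Sum>i<k. X (i + m) w\<bar>}" for n
    have [measurable]: "C n \<in> events" for n unfolding C_def by measurable
    have "(\<lambda>n. prob (C n)) \<longlonglongrightarrow> prob (\<Union>n. C n)"
      by (intro finite_Lim_measure_incseq) (auto simp: incseq_def C_def intro: order_trans)
    moreover have "(\<Union>n. C n) = B e m" unfolding B_def C_def by auto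
    moreover have "prob (C n) \<le> (\<Sum>i. ?v (i + m)) / e\<^sup>2" for n
    proof -
      have "indep_vars (\<lambda>_. borel) (\<lambda>i. X (i + m)) UNIV"
        by (rule indep_vars_reindex_inj[OF indep]) simp
      hence "prob (C n) \<le> (\<Sum>i<n. ?v (i + m)) / e\<^sup>2"
        unfolding C_def using sq mean e by (intro kolmogorov_maximal_inequality) (auto simp: comp_def)
      also have "\<dots> \<le> (\<Sum>i. ?v (i + m)) / e\<^sup>2"
        using e v0 summ by (intro divide_right_mono sum_le_suminf) (auto simp: summable_iff_shift[of ?v])
      finally show ?thesis .
    qed
    ultimately show ?thesis by (metis LIMSEQ_le_const2)
  qed
  have null: "prob (\<Inter>m. B e m) = 0" if e: "e > 0" for e
  proof -
    have "prob (\<Inter>m. B e m) \<le> (\<Sum>i. ?v (i + m)) / e\<^sup>2" for m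
      by (rule order_trans[OF finite_measure_mono pB[OF e]]) auto
    moreover have "(\<lambda>m. (\<Sum>i. ?v (i + m)) / e\<^sup>2) \<longlonglongrightarrow> 0 / e\<^sup>2"
      using e by (intro tendsto_divide suminf_exist_split2 summ tendsto_const) auto
    ultimately have "prob (\<Inter>m. B e m) \<le> 0" using LIMSEQ_le_const by force
    thus ?thesis by (simp add: measure_le_0_iff)
  qed
  have "AE w in M. \<forall>j. w \<notin> (\<Inter>m. B (1 / Suc j) m)"
  proof (subst AE_all_countable, intro allI)
    fix j :: nat
    have "(\<Inter>m. B (1 / Suc j) m) \<in> null_sets M"
      using null[of "1 / Suc j"] by (intro null_setsI) (auto simp: emeasure_eq_measure)
    thus "AE w in M. w \<notin> (\<Inter>m. B (1 / Suc j) m)" by (rule AE_not_in)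
  qed
  with AE_space show ?thesis
  proof eventually_elim
    case (elim w)
    show ?case
    proof -
      have True: "w \<in> space M" by fact
      show ?thesis unfolding summable_Cauchy
      proof (intro allI impI)
        fix e :: real assume "e > 0"
        \<comment> \<open>Half of \<open>e\<close>, because the block from \<open>a\<close> to
          \<open>b\<close> is a difference of two partial sums counted from
          \<open>m\<close>.\<close>
        then obtain j where j: "1 / Suc j < e / 2" using nat_approx_posE[of "e/2"] by auto
        obtain m where "w \<notin> B (1 / Suc j) m" using elim by blast
        hence m: "\<bar>\<Sum>i<k. X (i + m) w\<bar> < e / 2" for k
          using True order.strict_trans[OF _ j] unfolding B_def by (auto simp: not_le)
        have sh: "(\<Sum>i\<in>{m..<b}. X i w) = (\<Sum>i<b - m. X (i + m) w)" if "m \<le> b" for b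
          using sum.shift_bounds_nat_ivl[of "\<lambda>i. X i w" 0 m "b - m"] that by (simp add: lessThan_atLeast0)
        show "\<exists>N. \<forall>a\<ge>N. \<forall>b. norm (sum (\<lambda>i. X i w) {a..<b}) < e"
        proof (intro exI[of _ m] allI impI)
          fix a b assume "m \<le> a"
          show "norm (sum (\<lambda>i. X i w) {a..<b}) < e"
          proof (cases "a \<le> b")
            case True
            have "sum (\<lambda>i. X i w) {m..<a} + sum (\<lambda>i. X i w) {a..<b} = sum (\<lambda>i. X i w) {m..<b}"
              by (rule sum.atLeastLessThan_concat) (use True \<open>m \<le> a\<close> in auto)
            thus ?thesis using m[of "a - m"] m[of "b - m"] sh[of a] sh[of b] True \<open>m \<le> a\<close> by auto
          qed (use \<open>e > 0\<close> in auto)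
        qed
      qed
    qed
  qed
qed


lemma normal_distributed_second_moment:
  assumes s: "0 < \<sigma>" and D: "distributed M lborel X (normal_density 0 \<sigma>)"
  shows "integrable M (\<lambda>w. (X w)\<^sup>2)" "expectation (\<lambda>w. (X w)\<^sup>2) = \<sigma>\<^sup>2"
proof -
  have "integrable lborel (\<lambda>x. normal_density 0 \<sigma> x * x\<^sup>2)"
    using integrable_normal_moment[OF s, of 0 2] by simp
  thus "integrable M (\<lambda>w. (X w)\<^sup>2)"
    by (subst distributed_integrable[OF D, symmetric]) (auto simp: s)
  show "expectation (\<lambda>w. (X w)\<^sup>2) = \<sigma>\<^sup>2"
    using normal_distributed_variance[OF s D] normal_distributed_expectation[OF s D] by simp
qed

lemma complex_gaussian_components:
  assumes v: "0 < v" and Z: "complex_gaussian M v Z"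
  shows "expectation (\<lambda>w. Re (Z w)) = 0" "expectation (\<lambda>w. Im (Z w)) = 0"
    "integrable M (\<lambda>w. (Re (Z w))\<^sup>2)" "integrable M (\<lambda>w. (Im (Z w))\<^sup>2)"
    "expectation (\<lambda>w. (Re (Z w))\<^sup>2) = v / 2" "expectation (\<lambda>w. (Im (Z w))\<^sup>2) = v / 2"
proof -
  have s: "0 < sqrt (v / 2)" "(sqrt (v / 2))\<^sup>2 = v / 2" using v by auto
  note R = Z[unfolded complex_gaussian_def, THEN conjunct1]
  note I = Z[unfolded complex_gaussian_def, THEN conjunct2, THEN conjunct1]
  show "expectation (\<lambda>w. Re (Z w)) = 0" "expectation (\<lambda>w. Im (Z w)) = 0"
    by (rule normal_distributed_expectation[OF s(1) R] normal_distributed_expectation[OF s(1) I])+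
  show "integrable M (\<lambda>w. (Re (Z w))\<^sup>2)" "integrable M (\<lambda>w. (Im (Z w))\<^sup>2)"
    by (rule normal_distributed_second_moment[OF s(1) R] normal_distributed_second_moment[OF s(1) I])+
  show "expectation (\<lambda>w. (Re (Z w))\<^sup>2) = v / 2" "expectation (\<lambda>w. (Im (Z w))\<^sup>2) = v / 2"
    using normal_distributed_second_moment(2)[OF s(1) R] normal_distributed_second_moment(2)[OF s(1) I] s(2) by simp_all
qed

text \<open>Real and imaginary parts are centred independent series with summable variances, which
  gives convergence. The law of the limit follows since the characteristic functions of the partial
  sums are products of Gaussian ones and converge. Convergence need not be absolute: only the
  weighted squares of the coefficients are summable.\<close>

lemma complex_gaussian_suminf:
  fixes Z :: "nat \<Rightarrow> 'a \<Rightarrow> complex"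
  assumes indep: "indep_vars (\<lambda>_. borel) Z UNIV"
    and Z: "\<And>k. complex_gaussian M (v k) (Z k)" and v: "\<And>k. 0 < v k"
    and summ: "summable (\<lambda>k. (cmod (c k))\<^sup>2 * v k)"
    and pos: "0 < (\<Sum>k. (cmod (c k))\<^sup>2 * v k)"
  shows "AE w in M. summable (\<lambda>k. c k * Z k w)"
    and "complex_gaussian M (\<Sum>k. (cmod (c k))\<^sup>2 * v k) (\<lambda>w. \<Sum>k. c k * Z k w)"
proof -
  have [measurable]: "random_variable borel (Z k)" for k
    using complex_gaussian_measurable Z by blast
  define Y where "Y k w = c k * Z k w" for k w
  have [measurable]: "random_variable borel (Y k)" for k unfolding Y_def by simp
  \<comment> \<open>Zero coefficients are kept apart: they produce the constant 0, which has no
    density and thus is not covered by \<open>complex_gaussian\<close>.\<close>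
  have Y: "complex_gaussian M ((cmod (c k))\<^sup>2 * v k) (Y k)" "(cmod (c k))\<^sup>2 * v k > 0" if "c k \<noteq> 0" for k
    using complex_gaussian_cmult[OF v Z that, of k] that v[of k] by (simp_all add: Y_def[abs_def] mult.commute)
  have Y0: "Y k = (\<lambda>w. 0)" if "c k = 0" for k using that by (auto simp: Y_def)
  have E: "expectation (\<lambda>w. Re (Y k w)) = 0" "expectation (\<lambda>w. Im (Y k w)) = 0"
    "integrable M (\<lambda>w. (Re (Y k w))\<^sup>2)" "integrable M (\<lambda>w. (Im (Y k w))\<^sup>2)"
    "expectation (\<lambda>w. (Re (Y k w))\<^sup>2) = (cmod (c k))\<^sup>2 * v k / 2"
    "expectation (\<lambda>w. (Im (Y k w))\<^sup>2) = (cmod (c k))\<^sup>2 * v k / 2" for k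
    by (cases "c k = 0", simp add: Y0, metis complex_gaussian_components[OF Y(2,1)])+
  have indY: "indep_vars (\<lambda>_. borel) Y UNIV"
    unfolding Y_def by (rule indep_vars_compose2[OF indep, where Y="\<lambda>k z. c k * z"]) simp
  have "AE w in M. summable (\<lambda>k. Re (Y k w))"
  proof (rule AE_summable_of_summable_variance)
    show "indep_vars (\<lambda>_. borel) (\<lambda>k w. Re (Y k w)) UNIV"
      by (rule indep_vars_compose2[OF indY, where Y="\<lambda>k. Re"]) simp
    show "summable (\<lambda>k. expectation (\<lambda>w. (Re (Y k w))\<^sup>2))"
      unfolding E(5) by (rule summable_divide[OF summ])
  qed (rule E)+
  moreover have "AE w in M. summable (\<lambda>k. Im (Y k w))"
  proof (rule AE_summable_of_summable_variance)
    show "indep_vars (\<lambda>_. borel) (\<lambda>k w. Im (Y k w)) UNIV"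
      by (rule indep_vars_compose2[OF indY, where Y="\<lambda>k. Im"]) simp
    show "summable (\<lambda>k. expectation (\<lambda>w. (Im (Y k w))\<^sup>2))"
      unfolding E(6) by (rule summable_divide[OF summ])
  qed (rule E)+
  ultimately have AE: "AE w in M. summable (\<lambda>k. Y k w)"
    by eventually_elim (simp add: summable_complex_iff)
  thus "AE w in M. summable (\<lambda>k. c k * Z k w)" by (simp add: Y_def)
  have "complex_gaussian M (\<Sum>k. (cmod (c k))\<^sup>2 * v k) (\<lambda>w. \<Sum>k. Y k w)"
  proof (rule complex_gaussianI[OF pos])
    fix s t
    let ?e = "\<lambda>z. iexp (s * Re z + t * Im z)"
    have ch: "expectation (\<lambda>w. ?e (Y k w)) = complex_of_real (exp (- ((cmod (c k))\<^sup>2 * v k) * (s\<^sup>2 + t\<^sup>2) / 4))" for k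
    proof (cases "c k = 0")
      case False thus ?thesis using complex_gaussian_char[OF Y(2,1), OF False False] by blast
    qed (simp add: Y0 prob_space)
    have "(\<lambda>n. expectation (\<lambda>w. ?e (\<Sum>k<n. Y k w))) \<longlonglongrightarrow> expectation (\<lambda>w. ?e (\<Sum>k. Y k w))"
    proof (rule integral_dominated_convergence[where w="\<lambda>_. 1"])
      show "AE w in M. (\<lambda>n. ?e (\<Sum>k<n. Y k w)) \<longlonglongrightarrow> ?e (\<Sum>k. Y k w)"
        using AE by eventually_elim (intro tendsto_intros summable_LIMSEQ)
    qed auto
    moreover have "expectation (\<lambda>w. ?e (\<Sum>k<n. Y k w)) =
        complex_of_real (exp (- (\<Sum>k<n. (cmod (c k))\<^sup>2 * v k) * (s\<^sup>2 + t\<^sup>2) / 4))" for n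
    proof -
      have "expectation (\<lambda>w. ?e (\<Sum>k<n. Y k w)) = expectation (\<lambda>w. \<Prod>k<n. ?e (Y k w))"
        by (intro Bochner_Integration.integral_cong refl)
           (simp add: exp_sum[symmetric] sum_distrib_left sum.distrib distrib_left)
      also have "\<dots> = (\<Prod>k<n. expectation (\<lambda>w. ?e (Y k w)))"
      proof (rule indep_vars_lebesgue_integral)
        show "indep_vars (\<lambda>_. borel) (\<lambda>k w. ?e (Y k w)) {..<n}"
          by (rule indep_vars_compose2[OF indep_vars_subset[OF indY subset_UNIV]]) simp
      qed (auto intro!: integrable_iexp)
      also have "\<dots> = complex_of_real (\<Prod>k<n. exp (- ((cmod (c k))\<^sup>2 * v k) * (s\<^sup>2 + t\<^sup>2) / 4))"
        unfolding ch by simp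
      also have "(\<Prod>k<n. exp (- ((cmod (c k))\<^sup>2 * v k) * (s\<^sup>2 + t\<^sup>2) / 4)) =
          exp (- (\<Sum>k<n. (cmod (c k))\<^sup>2 * v k) * (s\<^sup>2 + t\<^sup>2) / 4)"
        by (simp add: exp_sum[symmetric] sum_negf sum_distrib_right sum_divide_distrib)
      finally show ?thesis .
    qed
    moreover have "(\<lambda>n. complex_of_real (exp (- (\<Sum>k<n. (cmod (c k))\<^sup>2 * v k) * (s\<^sup>2 + t\<^sup>2) / 4)))
        \<longlonglongrightarrow> complex_of_real (exp (- (\<Sum>k. (cmod (c k))\<^sup>2 * v k) * (s\<^sup>2 + t\<^sup>2) / 4))"
      by (intro tendsto_intros summable_LIMSEQ summ) simp
    ultimately show "expectation (\<lambda>w. ?e (\<Sum>k. Y k w)) =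
        complex_of_real (exp (- (\<Sum>k. (cmod (c k))\<^sup>2 * v k) * (s\<^sup>2 + t\<^sup>2) / 4))"
      using LIMSEQ_unique by (simp only:) blast
  qed simp
  thus "complex_gaussian M (\<Sum>k. (cmod (c k))\<^sup>2 * v k) (\<lambda>w. \<Sum>k. c k * Z k w)"
    by (simp add: Y_def)
qed

end

section \<open>Laplace functional of a Poisson point process\<close>

lemma norm_prod_one_minus_le_1:
  fixes f :: "'i \<Rightarrow> real"
  assumes "\<And>i. 0 \<le> f i" "\<And>i. f i \<le> 1"
  shows "norm (\<Prod>i\<in>I. 1 - f i) \<le> 1"
proof -
  have "0 \<le> (\<Prod>i\<in>I. 1 - f i)" using assms by (intro prod_nonneg) auto
  moreover have "(\<Prod>i\<in>I. 1 - f i) \<le> 1" using assms by (intro prod_le_1) auto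
  ultimately show ?thesis by simp
qed

context prob_space
begin

lemma expectation_power_poisson:
  fixes N :: "'a \<Rightarrow> nat"
  assumes [measurable]: "N \<in> measurable M (count_space UNIV)" and mu: "0 \<le> \<mu>" and q: "0 \<le> q" "q \<le> 1"
    and N: "\<And>k. prob {w\<in>space M. N w = k} = \<mu> ^ k / fact k * exp (- \<mu>)"
  shows "expectation (\<lambda>w. q ^ N w) = exp (- \<mu> * (1 - q))"
proof -
  have "(\<lambda>k. (q * \<mu>) ^ k /\<^sub>R fact k) sums exp (q * \<mu>)" by (rule exp_converges)
  from sums_mult2[OF this, of "exp (- \<mu>)"]
  have s: "(\<lambda>k. q ^ k * (\<mu> ^ k / fact k * exp (- \<mu>))) sums exp (- \<mu> * (1 - q))"
    by (simp add: exp_add[symmetric] power_mult_distrib field_simps)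
  have "(\<integral>\<^sup>+w. ennreal (q ^ N w) \<partial>M) = (\<integral>\<^sup>+w. (\<Sum>k. ennreal (q ^ k) * indicator {w\<in>space M. N w = k} w) \<partial>M)"
  proof (rule nn_integral_cong)
    fix w assume "w \<in> space M"
    have "(\<Sum>k. ennreal (q ^ k) * indicator {w\<in>space M. N w = k} w) =
          (\<Sum>k\<in>{N w}. ennreal (q ^ k) * indicator {w\<in>space M. N w = k} w)"
      by (rule suminf_finite) auto
    thus "ennreal (q ^ N w) = (\<Sum>k. ennreal (q ^ k) * indicator {w\<in>space M. N w = k} w)"
      using \<open>w \<in> space M\<close> by simp
  qed
  also have "\<dots> = (\<Sum>k. ennreal (q ^ k) * emeasure M {w\<in>space M. N w = k})"
    by (subst nn_integral_suminf) (auto simp: nn_integral_cmult_indicator)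
  also have "\<dots> = (\<Sum>k. ennreal (q ^ k * (\<mu> ^ k / fact k * exp (- \<mu>))))"
    by (simp only: emeasure_eq_measure N ennreal_mult'[OF zero_le_power[OF q(1)]])
  also have "\<dots> = ennreal (exp (- \<mu> * (1 - q)))"
    using sums_unique[OF s] q mu sums_summable[OF s] by (subst suminf_ennreal2) auto
  finally have "(\<integral>\<^sup>+w. ennreal (q ^ N w) \<partial>M) = ennreal (exp (- \<mu> * (1 - q)))" .
  thus ?thesis using q by (intro nn_integral_eq_integrable[THEN iffD1, THEN conjunct2]) auto
qed

text \<open>For a step function each point in \<open>A i\<close> contributes the factor
  \<open>1 - a i\<close>, so the full product is the product of the powers
  \<open>(1 - a i) ^ N i w\<close>, whose exponents are independent Poisson variables. Injectivity
  of the enumeration turns the cardinality of a set of points into a number of indices.\<close>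

lemma poisson_point_process_laplace_simple:
  fixes X :: "nat \<Rightarrow> 'a \<Rightarrow> 'b::euclidean_space" and A :: "nat \<Rightarrow> 'b set"
  assumes [measurable]: "\<And>k. random_variable borel (X k)"
    and inj: "AE w in M. inj (\<lambda>k. X k w)"
    and ppp: "poisson_point_process M lam D (\<lambda>w. range (\<lambda>k. X k w))" and lam: "0 \<le> lam"
    and A: "\<And>i. i < m \<Longrightarrow> A i \<in> sets borel" "\<And>i. i < m \<Longrightarrow> A i \<subseteq> D" "\<And>i. i < m \<Longrightarrow> bounded (A i)"
    and disj: "disjoint_family_on A {..<m}"
    and a: "\<And>i. i < m \<Longrightarrow> 0 \<le> a i" "\<And>i. i < m \<Longrightarrow> a i \<le> 1"
    and \<phi>: "\<And>x. \<phi> x = (\<Sum>i<m. a i * indicator (A i) x)"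
  shows "(\<lambda>n. expectation (\<lambda>w. \<Prod>k<n. (1 - \<phi> (X k w)))) \<longlonglongrightarrow> exp (- lam * (\<Sum>i<m. a i * measure lborel (A i)))"
proof -
  have [measurable]: "\<phi> \<in> borel_measurable borel"
  proof -
    have "(\<lambda>x. \<Sum>i<m. a i * indicator (A i) x) \<in> borel_measurable borel" using A(1) by measurable
    thus ?thesis using \<phi> by (simp cong: measurable_cong)
  qed
  have val: "\<phi> x = a i" if "i < m" "x \<in> A i" for i x
  proof -
    have "\<phi> x = (\<Sum>j<m. if j = i then a i else 0)"
      unfolding \<phi> using that disj by (intro sum.cong refl) (auto simp: indicator_def disjoint_family_on_def)
    thus ?thesis using that by simp
  qed
  have val0: "\<phi> x = 0" if "\<And>i. i < m \<Longrightarrow> x \<notin> A i" for x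
    unfolding \<phi> using that by (intro sum.neutral) auto
  have b: "0 \<le> \<phi> x" "\<phi> x \<le> 1" for x
    using a val val0 by (metis le_numeral_extra(1,3) zero_le_one order_refl)+
  define N where "N i w = card (range (\<lambda>k. X k w) \<inter> A i)" for i w
  note P = ppp[unfolded poisson_point_process_def]
  have N: "AE w in M. finite (range (\<lambda>k. X k w) \<inter> A i)" "N i \<in> measurable M (count_space UNIV)"
     "prob {w\<in>space M. N i w = k} = (lam * measure lborel (A i)) ^ k / fact k * exp (- (lam * measure lborel (A i)))"
     if "i < m" for i k
    using P A[OF that] unfolding N_def[abs_def] by blast+
  have indN: "indep_vars (\<lambda>_. count_space UNIV) N {..<m}"
    unfolding N_def[abs_def]
    by (rule P[THEN conjunct2, THEN conjunct2, rule_format, of m A]) (use A disj in auto)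
  have AEfin: "AE w in M. \<forall>i\<in>{..<m}. finite (range (\<lambda>k. X k w) \<inter> A i)"
    using N(1) by (intro AE_finite_allI) auto
  have "(\<lambda>n. expectation (\<lambda>w. \<Prod>k<n. (1 - \<phi> (X k w)))) \<longlonglongrightarrow> expectation (\<lambda>w. \<Prod>i<m. (1 - a i) ^ N i w)"
  proof (rule integral_dominated_convergence[where w="\<lambda>_. 1"])
    show "AE w in M. (\<lambda>n. \<Prod>k<n. (1 - \<phi> (X k w))) \<longlonglongrightarrow> (\<Prod>i<m. (1 - a i) ^ N i w)"
      using inj AEfin
    proof eventually_elim
      case (elim w)
      define K where "K i = {k. X k w \<in> A i}" for i
      have im: "(\<lambda>k. X k w) ` K i = range (\<lambda>k. X k w) \<inter> A i" for i unfolding K_def by auto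
      have ij: "inj_on (\<lambda>k. X k w) (K i)" for i using elim(1) by (rule inj_on_subset) simp
      have fK: "finite (K i)" "card (K i) = N i w" if "i < m" for i
        using elim(2) that finite_image_iff[OF ij, of i] card_image[OF ij, of i] unfolding im N_def by auto
      have dK: "\<forall>i\<in>{..<m}. \<forall>j\<in>{..<m}. i \<noteq> j \<longrightarrow> K i \<inter> K j = {}"
        using disj unfolding K_def disjoint_family_on_def by blast
      define KK where "KK = (\<Union>i<m. K i)"
      have fKK: "finite KK" unfolding KK_def using fK by auto
      then obtain n0 where n0: "KK \<subseteq> {..<n0}" using finite_nat_iff_bounded by blast
      \<comment> \<open>Only finitely many points lie in the bounded cells, so from
        \<open>n0\<close> on every further factor is 1 and the partial product already equals the
        limit.\<close>
      have "(\<Prod>k<n. (1 - \<phi> (X k w))) = (\<Prod>i<m. (1 - a i) ^ N i w)" if "n \<ge> n0" for n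
      proof -
        have "(\<Prod>k<n. (1 - \<phi> (X k w))) = (\<Prod>k\<in>KK. (1 - \<phi> (X k w)))"
          using n0 that by (intro prod.mono_neutral_right) (auto simp: KK_def K_def intro!: val0)
        also have "\<dots> = (\<Prod>i<m. \<Prod>k\<in>K i. (1 - \<phi> (X k w)))"
          unfolding KK_def using fK dK by (intro prod.UNION_disjoint) auto
        also have "\<dots> = (\<Prod>i<m. \<Prod>k\<in>K i. (1 - a i))"
          by (intro prod.cong refl) (auto simp: K_def val)
        finally show ?thesis by (simp add: fK)
      qed
      thus ?case by (intro tendsto_eventually eventually_sequentiallyI)
    qed
    show "AE w in M. norm (\<Prod>k<n. (1 - \<phi> (X k w))) \<le> 1" for n
      by (intro AE_I2 norm_prod_one_minus_le_1 b)
    have "(\<lambda>w. (1 - a i) ^ N i w) \<in> borel_measurable M" if "i < m" for i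
      by (rule measurable_compose[OF N(2)[OF that]]) simp
    thus "(\<lambda>w. \<Prod>i<m. (1 - a i) ^ N i w) \<in> borel_measurable M" by (intro borel_measurable_prod) auto
  qed auto
  also have "expectation (\<lambda>w. \<Prod>i<m. (1 - a i) ^ N i w) = (\<Prod>i<m. expectation (\<lambda>w. (1 - a i) ^ N i w))"
  proof (rule indep_vars_lebesgue_integral)
    show "indep_vars (\<lambda>_. borel) (\<lambda>i w. (1 - a i) ^ N i w) {..<m}"
      by (rule indep_vars_compose2[OF indN, where Y="\<lambda>i k. (1 - a i) ^ k"]) simp
    fix i assume i: "i \<in> {..<m}"
    have [measurable]: "N i \<in> measurable M (count_space UNIV)" using N i by auto
    have "0 \<le> 1 - a i" "1 - a i \<le> 1" using a i by auto
    thus "integrable M (\<lambda>w. (1 - a i) ^ N i w)"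
      by (intro integrable_const_bound[where B=1]) (auto simp: power_le_one)
  qed simp
  also have "\<dots> = (\<Prod>i<m. exp (- (lam * measure lborel (A i)) * (1 - (1 - a i))))"
    using a lam N by (intro prod.cong refl expectation_power_poisson) auto
  also have "\<dots> = exp (- lam * (\<Sum>i<m. a i * measure lborel (A i)))"
    by (simp add: exp_sum[symmetric] sum_negf sum_distrib_left mult_ac)
  finally show ?thesis .
qed

text \<open>The function is approximated from below by step functions. The finite products decrease
  in the number of factors and also in the function; these two monotonicities replace an exchange of
  limits.\<close>

theorem poisson_point_process_laplace:
  fixes X :: "nat \<Rightarrow> 'a \<Rightarrow> 'b::euclidean_space"
  assumes [measurable]: "\<And>k. random_variable borel (X k)"
    and inj: "AE w in M. inj (\<lambda>k. X k w)"
    and ppp: "poisson_point_process M lam D (\<lambda>w. range (\<lambda>k. X k w))" and lam: "0 \<le> lam"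
    and D[measurable]: "D \<in> sets borel"
    and \<phi>[measurable]: "\<phi> \<in> borel_measurable borel" and b: "\<And>x. 0 \<le> \<phi> x" "\<And>x. \<phi> x \<le> 1"
    and int: "set_integrable lborel D \<phi>"
  shows "(\<lambda>n. expectation (\<lambda>w. \<Prod>k<n. (1 - \<phi> (X k w)))) \<longlonglongrightarrow> exp (- lam * (LBINT x:D. \<phi> x))"
proof -
  \<comment> \<open>Points lie in \<open>D\<close> almost surely, so cutting \<open>\<phi>\<close>
    off outside \<open>D\<close> does not change the expectations, and it forces the level sets of
    nonzero values below into \<open>D\<close>.\<close>
  define \<psi> where "\<psi> x = indicator D x * \<phi> x" for x
  have [measurable]: "\<psi> \<in> borel_measurable borel" unfolding \<psi>_def by measurable
  have \<psi>: "0 \<le> \<psi> x" "\<psi> x \<le> 1" for x using b by (auto simp: \<psi>_def indicator_def)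
  have int\<psi>: "integrable lborel \<psi>" using int by (simp add: set_integrable_def \<psi>_def[abs_def])
  obtain F where F: "incseq F" "\<And>i. simple_function borel (F i)" "\<And>x. bdd_above (range (\<lambda>i. F i x))"
      "\<And>i x. 0 \<le> F i x" "\<psi> = (SUP i. F i)"
    using borel_measurable_implies_simple_function_sequence_real[of \<psi> borel] \<psi> by auto
  have SUP: "\<psi> x = (SUP i. F i x)" for x
    by (simp add: F(5) Sup_apply image_image)
  have Fle: "F i x \<le> \<psi> x" for i x unfolding SUP by (intro cSUP_upper F(3)) simp
  have Flim: "(\<lambda>i. F i x) \<longlonglongrightarrow> \<psi> x" for x
    unfolding SUP using F(1,3) by (intro LIMSEQ_incseq_SUP) (auto simp: incseq_def le_fun_def)
  have [measurable]: "F i \<in> borel_measurable borel" for i using F(2) by (rule borel_measurable_simple_function)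
  \<comment> \<open>Counts are prescribed only for bounded sets, hence the truncation to growing
    balls.\<close>
  define G where "G i x = F i x * indicator (cball 0 (real i)) x" for i x
  have [measurable]: "cball (0 :: 'b) r \<in> sets borel" for r by (rule borel_closed) simp
  have [measurable]: "G i \<in> borel_measurable borel" for i unfolding G_def[abs_def] by measurable
  have Glim: "(\<lambda>i. G i x) \<longlonglongrightarrow> \<psi> x" for x
  proof -
    have "eventually (\<lambda>i. F i x = G i x) sequentially"
    proof (rule eventually_sequentiallyI)
      fix i assume "nat \<lceil>norm x\<rceil> \<le> i"
      hence "norm x \<le> real i" by linarith
      thus "F i x = G i x" by (simp add: G_def)
    qed
    thus ?thesis using Flim tendsto_cong by force
  qed
  have G: "0 \<le> G i x" "G i x \<le> \<psi> x" "G i x \<le> 1" for i x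
    using F(4)[of i x] Fle[of i x] \<psi>[of x] by (auto simp: G_def indicator_def)
  have intG: "(\<lambda>i. LBINT x. G i x) \<longlonglongrightarrow> (LBINT x. \<psi> x)"
    by (rule integral_dominated_convergence[where w=\<psi>]) (auto simp: int\<psi> Glim G)
  define L where "L f n = expectation (\<lambda>w. \<Prod>k<n. (1 - f (X k w)))" for f :: "'b \<Rightarrow> real" and n
  have Lint: "integrable M (\<lambda>w. \<Prod>k<n. (1 - f (X k w)))"
    if [measurable]: "f \<in> borel_measurable borel" and f: "\<And>x. 0 \<le> f x" "\<And>x. f x \<le> 1" for f :: "'b \<Rightarrow> real" and n
  proof (rule integrable_const_bound[where B=1])
    show "AE w in M. norm (\<Prod>k<n. (1 - f (X k w))) \<le> 1"
      by (intro AE_I2 norm_prod_one_minus_le_1 f)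
  qed simp
  have LG: "L (G i) \<longlonglongrightarrow> exp (- lam * (LBINT x. G i x))" for i
  proof -
    \<comment> \<open>The value 0 is left out, since its level set need not be contained in
      \<open>D\<close>.\<close>
    define V where "V = range (F i) - {0}"
    have "finite V" using F(2)[of i] unfolding V_def simple_function_def by simp
    then obtain v where v: "bij_betw v {..<card V} V" using ex_bij_betw_nat_finite[of V] by (auto simp: lessThan_atLeast0)
    define m where "m = card V"
    define A where "A j = {x. F i x = v j} \<inter> cball 0 (real i)" for j
    have vV: "v j \<in> V" if "j < m" for j using v that by (auto simp: m_def bij_betw_def)
    have Ab[measurable]: "A j \<in> sets borel" for j unfolding A_def by measurable
    have vp: "0 \<le> v j" "v j \<le> 1" if "j < m" for j
      using vV[OF that] F(4) order_trans[OF Fle \<psi>(2)] unfolding V_def by auto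
    have AD: "A j \<subseteq> D" if "j < m" for j
    proof
      fix x assume "x \<in> A j"
      hence "F i x \<noteq> 0" using vV[OF that] by (auto simp: A_def V_def)
      hence "\<psi> x > 0" using F(4)[of i x] Fle[of i x] by linarith
      thus "x \<in> D" by (cases "x \<in> D") (auto simp: \<psi>_def)
    qed
    have bd: "bounded (A j)" for j unfolding A_def by (rule bounded_subset[OF bounded_cball]) blast
    have dj: "disjoint_family_on A {..<m}"
      using v unfolding disjoint_family_on_def A_def bij_betw_def m_def inj_on_def by auto
    have Gs: "G i x = (\<Sum>j<m. v j * indicator (A j) x)" for x
    proof (cases "F i x = 0 \<or> x \<notin> cball 0 (real i)")
      case True
      hence "x \<notin> A j" if "j < m" for j using vV[OF that] by (auto simp: A_def V_def)
      hence "(\<Sum>j<m. v j * indicator (A j) x) = 0" by (intro sum.neutral) auto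
      thus ?thesis using True by (auto simp: G_def)
    next
      case False
      hence "F i x \<in> V" by (auto simp: V_def)
      hence "F i x \<in> v ` {..<m}" using v by (simp add: bij_betw_def m_def)
      then obtain j where j: "j < m" "v j = F i x" by (metis imageE lessThan_iff)
      have "(\<Sum>j<m. v j * indicator (A j) x) = (\<Sum>l<m. if l = j then v j else 0)"
      proof (intro sum.cong refl)
        fix l assume l: "l \<in> {..<m}"
        have "inj_on v {..<m}" using v by (simp add: bij_betw_def m_def)
        hence "v l = v j \<longleftrightarrow> l = j" using l j(1) by (auto dest: inj_onD)
        thus "v l * indicator (A l) x = (if l = j then v j else 0)"
          using j False by (auto simp: indicator_def A_def)
      qed
      thus ?thesis using j False by (simp add: G_def)
    qed
    have fin: "emeasure lborel (A j) < \<infinity>" for j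
      using emeasure_bounded_finite[OF bd] by (simp add: less_top)
    have "(LBINT x. G i x) = (\<Sum>j<m. v j * measure lborel (A j))"
      unfolding Gs using fin by (subst Bochner_Integration.integral_sum) (auto intro!: integrable_mult_right integrable_real_indicator)
    thus ?thesis
      unfolding L_def
      using poisson_point_process_laplace_simple[OF assms(1) inj ppp lam, of m A v "G i"] Ab AD bd dj vp Gs by auto
  qed
  have mono: "L f n \<le> L g n" if "f \<in> borel_measurable borel" "g \<in> borel_measurable borel"
     "\<And>x. 0 \<le> g x" "\<And>x. g x \<le> f x" "\<And>x. f x \<le> 1" for f g n
    unfolding L_def using that by (intro integral_mono Lint prod_mono) (auto intro: order_trans)
  have anti: "decseq (L (G i))" for i
  proof (rule decseq_SucI)
    fix n
    have *: "integrable M (\<lambda>w. \<Prod>k<Suc n. 1 - G i (X k w))" "integrable M (\<lambda>w. \<Prod>k<n. 1 - G i (X k w))"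
      by (rule Lint; use G in simp)+
    show "L (G i) (Suc n) \<le> L (G i) n"
      unfolding L_def
    proof (rule integral_mono[OF *])
      fix w
      show "(\<Prod>k<Suc n. 1 - G i (X k w)) \<le> (\<Prod>k<n. 1 - G i (X k w))"
        using G by (auto intro!: mult_left_le_one_le prod_nonneg simp: lessThan_Suc)
    qed
  qed
  \<comment> \<open>A decreasing sequence dominates its limit. This bound holds for every
    \<open>n\<close>, so it survives the limit in \<open>i\<close> and gives the lower half of the
    claim; the upper half is \<open>L \<psi> n \<le> L (G i) n\<close> for one suitable
    \<open>i\<close>.\<close>
  have LGge: "exp (- lam * (LBINT x. G i x)) \<le> L (G i) n" for i n
    using decseq_ge[OF anti LG] .
  have Llim: "(\<lambda>i. L (G i) n) \<longlonglongrightarrow> L \<psi> n" for n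
    unfolding L_def
  proof (rule integral_dominated_convergence[where w="\<lambda>_. 1"])
    show "AE w in M. (\<lambda>i. \<Prod>k<n. 1 - G i (X k w)) \<longlonglongrightarrow> (\<Prod>k<n. 1 - \<psi> (X k w))"
      by (intro AE_I2 tendsto_intros Glim)
    show "AE w in M. norm (\<Prod>k<n. 1 - G i (X k w)) \<le> 1" for i
    proof (intro AE_I2)
      fix w
      have "0 \<le> (\<Prod>k<n. (1 - G i (X k w)))" using G by (intro prod_nonneg) auto
      moreover have "(\<Prod>k<n. (1 - G i (X k w))) \<le> 1" using G by (intro prod_le_1) auto
      ultimately show "norm (\<Prod>k<n. (1 - G i (X k w))) \<le> 1" by simp
    qed
  qed auto
  have explim: "(\<lambda>i. exp (- lam * (LBINT x. G i x))) \<longlonglongrightarrow> exp (- lam * (LBINT x. \<psi> x))"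
    by (intro tendsto_intros intG)
  have lower: "exp (- lam * (LBINT x. \<psi> x)) \<le> L \<psi> n" for n
    by (intro LIMSEQ_le[OF explim Llim] exI allI impI LGge)
  have "L \<psi> \<longlonglongrightarrow> exp (- lam * (LBINT x. \<psi> x))"
  proof (rule order_tendstoI)
    fix a assume a: "a < exp (- lam * (LBINT x. \<psi> x))"
    show "eventually (\<lambda>n. a < L \<psi> n) sequentially"
      by (intro always_eventually allI less_le_trans[OF a lower])
  next
    fix a assume "exp (- lam * (LBINT x. \<psi> x)) < a"
    then obtain i where i: "exp (- lam * (LBINT x. G i x)) < a"
      using eventually_happens[OF order_tendstoD(2)[OF explim]] by auto
    show "eventually (\<lambda>n. L \<psi> n < a) sequentially"
      using order_tendstoD(2)[OF LG i]
    proof eventually_elim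
      case (elim n)
      have "L \<psi> n \<le> L (G i) n" by (rule mono) (use G \<psi> in auto)
      thus ?case using elim by simp
    qed
  qed
  moreover have "L \<psi> = (\<lambda>n. expectation (\<lambda>w. \<Prod>k<n. (1 - \<phi> (X k w))))"
    unfolding L_def
  proof (intro ext integral_cong_AE)
    fix n
    have "AE w in M. range (\<lambda>k. X k w) \<subseteq> D" using ppp by (simp add: poisson_point_process_def)
    thus "AE w in M. (\<Prod>k<n. 1 - \<psi> (X k w)) = (\<Prod>k<n. 1 - \<phi> (X k w))"
    proof eventually_elim
      case (elim w)
      hence "\<psi> (X k w) = \<phi> (X k w)" for k by (auto simp: \<psi>_def indicator_def)
      thus ?case by simp
    qed
  qed auto
  moreover have "(LBINT x. \<psi> x) = (LBINT x:D. \<phi> x)"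
    by (simp add: set_lebesgue_integral_def \<psi>_def)
  ultimately show ?thesis by simp
qed

end

section \<open>Radial integrals and the error function\<close>

text \<open>The squared norm pushes planar Lebesgue measure forward to \<open>pi\<close> times
  Lebesgue measure on the half line, because a disc of squared radius \<open>r\<close> has area
  \<open>pi * r\<close>. Comparing the two measures on the sets \<open>{..r}\<close> avoids polar
  coordinates.\<close>

lemma nn_integral_norm_square_2:
  fixes f :: "real \<Rightarrow> ennreal"
  assumes dim: "DIM('a::euclidean_space) = 2" and [measurable]: "f \<in> borel_measurable borel"
  shows "(\<integral>\<^sup>+x. f ((norm (x :: 'a))\<^sup>2) \<partial>lborel) = (\<integral>\<^sup>+u. ennreal pi * indicator {0..} u * f u \<partial>lborel)"
proof -
  let ?D = "distr lborel borel (\<lambda>x :: 'a. (norm x)\<^sup>2)"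
  let ?E = "density lborel (\<lambda>u :: real. ennreal pi * indicator {0..} u)"
  have E: "emeasure ?D {..r} = ennreal (pi * max 0 r)" "emeasure ?E {..r} = ennreal (pi * max 0 r)" for r
  proof -
    have "emeasure ?D {..r} = emeasure lborel {x :: 'a. (norm x)\<^sup>2 \<le> r}"
      by (subst emeasure_distr) (auto simp: vimage_def)
    also have "\<dots> = ennreal (pi * max 0 r)"
    proof (cases "0 \<le> r")
      case True
      have "{x :: 'a. (norm x)\<^sup>2 \<le> r} = cball 0 (sqrt r)"
        by (auto simp: real_le_rsqrt) (metis True norm_ge_zero power_mono real_sqrt_pow2)
      thus ?thesis using True by (simp add: emeasure_cball dim unit_ball_vol_2)
    next
      case False
      hence "{x :: 'a. (norm x)\<^sup>2 \<le> r} = {}" by (auto simp: not_le) (meson less_le_trans zero_le_power2)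
      thus ?thesis using False by simp
    qed
    finally show "emeasure ?D {..r} = ennreal (pi * max 0 r)" .
    have "emeasure ?E {..r} = (\<integral>\<^sup>+u. ennreal pi * indicator {0..r} u \<partial>lborel)"
      by (subst emeasure_density) (auto intro!: nn_integral_cong simp: indicator_def)
    also have "\<dots> = ennreal (pi * max 0 r)"
      by (subst nn_integral_cmult_indicator) (auto simp: ennreal_mult' max_def not_le emeasure_lborel_Icc_eq)
    finally show "emeasure ?E {..r} = ennreal (pi * max 0 r)" .
  qed
  have eq: "?D = ?E"
  proof (rule measure_eqI_generator_eq[where \<Omega>=UNIV and A="\<lambda>n :: nat. {.. real n}"])
    show "Int_stable (range atMost :: real set set)" by (auto simp: Int_stable_def)
    show "sets ?D = sigma_sets UNIV (range atMost)" "sets ?E = sigma_sets UNIV (range atMost)"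
      by (simp_all, (subst borel_eq_atMost, simp)+)
    show "(\<Union>i. {..real i}) = UNIV" by (auto intro: real_arch_simple)
  qed (auto simp: E)
  have "(\<integral>\<^sup>+x. f ((norm (x :: 'a))\<^sup>2) \<partial>lborel) = (\<integral>\<^sup>+u. f u \<partial>?D)"
    by (subst nn_integral_distr) auto
  also have "\<dots> = (\<integral>\<^sup>+u. ennreal pi * indicator {0..} u * f u \<partial>lborel)"
    unfolding eq by (subst nn_integral_density) auto
  finally show ?thesis .
qed

text \<open>The joint density \<open>exp (- (norm p)\<^sup>2) / pi\<close> depends on the squared
  norm alone, so the radial formula turns it into the exponential density, its factor
  \<open>pi\<close> cancelling the normalisation.\<close>

lemma (in prob_space) complex_gaussian_cmod_ge:
  assumes h: "complex_gaussian M 1 h" and z: "0 \<le> z"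
  shows "prob {w\<in>space M. z \<le> (cmod (h w))\<^sup>2} = exp (- z)"
proof -
  let ?n = "normal_density 0 (sqrt (1 / 2))"
  have "distributed M (lborel \<Otimes>\<^sub>M lborel) (\<lambda>w. (Re (h w), Im (h w))) (\<lambda>(x, y). ennreal (?n x) * ennreal (?n y))"
    using h unfolding complex_gaussian_def
    by (intro distributed_joint_indep) (auto simp: lborel.sigma_finite_measure_axioms indep_var_eq)
  hence D: "distributed M lborel (\<lambda>w. (Re (h w), Im (h w))) (\<lambda>(x, y). ennreal (?n x) * ennreal (?n y))"
    by (simp add: lborel_prod)
  let ?A = "{p :: real \<times> real. z \<le> (norm p)\<^sup>2}"
  have nn: "ennreal (?n x) * ennreal (?n y) = ennreal (1 / pi * exp (- (norm (x, y))\<^sup>2))" for x y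
    by (simp add: normal_density_def ennreal_mult'[symmetric] exp_add[symmetric] norm_Pair)
  have "emeasure M ((\<lambda>w. (Re (h w), Im (h w))) -` ?A \<inter> space M) =
        (\<integral>\<^sup>+p. (case p of (x, y) \<Rightarrow> ennreal (?n x) * ennreal (?n y)) * indicator ?A p \<partial>lborel)"
    by (rule distributed_emeasure[OF D]) measurable
  also have "\<dots> = (\<integral>\<^sup>+p. ennreal (1 / pi * exp (- (norm (p :: real \<times> real))\<^sup>2)) * indicator {z..} ((norm p)\<^sup>2) \<partial>lborel)"
    by (intro nn_integral_cong) (auto simp: nn indicator_def)
  also have "\<dots> = (\<integral>\<^sup>+u. ennreal pi * indicator {0..} u * (ennreal (1 / pi * exp (- u)) * indicator {z..} u) \<partial>lborel)"
    by (rule nn_integral_norm_square_2) auto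
  also have "\<dots> = (\<integral>\<^sup>+u. ennreal (exp (- u)) * indicator {z..} u \<partial>lborel)"
    using z by (intro nn_integral_cong) (auto simp: indicator_def ennreal_mult'[symmetric])
  also have "\<dots> = ennreal (0 - (- exp (- z)))"
  proof (rule nn_integral_FTC_atLeast)
    show "((\<lambda>u :: real. - exp (- u)) \<longlongrightarrow> 0) at_top"
      using tendsto_minus[OF filterlim_compose[OF exp_at_bot filterlim_uminus_at_bot_at_top]] by simp
  qed (auto intro!: derivative_eq_intros)
  also have "(\<lambda>w. (Re (h w), Im (h w))) -` ?A \<inter> space M = {w\<in>space M. z \<le> (cmod (h w))\<^sup>2}"
    by (auto simp: norm_Pair cmod_def)
  finally show ?thesis by (simp add: emeasure_eq_measure)
qed

section \<open>The complementary error function\<close>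

lemma gaussian_integrable: "integrable lborel (\<lambda>t :: real. exp (- t\<^sup>2))"
proof -
  have "(\<lambda>t :: real. exp (- t\<^sup>2)) = (\<lambda>t. sqrt pi * normal_density 0 (sqrt (1 / 2)) t)"
    by (auto simp: normal_density_def)
  thus ?thesis by simp
qed

lemma gaussian_set_integrable:
  assumes "A \<in> sets borel" shows "set_integrable lborel A (\<lambda>t :: real. exp (- t\<^sup>2))"
  using gaussian_integrable assms unfolding set_integrable_def by (intro integrable_mult_indicator) auto

lemma erfc_nonneg: "0 \<le> erfc x"
  unfolding erfc_def set_lebesgue_integral_def by (intro mult_nonneg_nonneg integral_nonneg_AE) auto

lemma erfc_0: "erfc 0 = 1"
proof -
  have "(LBINT t:{0..}. exp (- (t\<^sup>2))) = sqrt pi / 2"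
    using gaussian_moment_0 unfolding set_lebesgue_integral_def by (simp add: has_bochner_integral_iff)
  thus ?thesis by (simp add: erfc_def)
qed

lemma erfc_diff:
  assumes "a \<le> b"
  shows "erfc a - erfc b = 2 / sqrt pi * integral {a..b} (\<lambda>t. exp (- t\<^sup>2))"
proof -
  have "(LBINT t:{a..}. exp (- (t\<^sup>2))) = (LBINT t:{a..<b} \<union> {b..}. exp (- (t\<^sup>2)))"
    using assms by (simp add: ivl_disj_un)
  also have "\<dots> = (LBINT t:{a..<b}. exp (- (t\<^sup>2))) + (LBINT t:{b..}. exp (- (t\<^sup>2)))"
    by (rule set_integral_Un) (auto intro: gaussian_set_integrable)
  also have "(LBINT t:{a..<b}. exp (- (t\<^sup>2))) = integral {a..<b} (\<lambda>t. exp (- t\<^sup>2))"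
    by (rule set_borel_integral_eq_integral(2)[OF gaussian_set_integrable]) simp
  also have "\<dots> = integral {a..b} (\<lambda>t. exp (- t\<^sup>2))"
    by (rule integral_spike_set) (auto intro: negligible_subset[of "{b}"])
  finally show ?thesis by (simp add: erfc_def algebra_simps)
qed

lemma erfc_antimono: "a \<le> b \<Longrightarrow> erfc b \<le> erfc a"
proof -
  assume "a \<le> b"
  moreover have "0 \<le> integral {a..b} (\<lambda>t :: real. exp (- t\<^sup>2))" 
    by (rule integral_nonneg) (auto intro!: integrable_continuous_interval continuous_intros)
  ultimately show ?thesis using erfc_diff[of a b] by (smt (verit) divide_nonneg_nonneg mult_nonneg_nonneg pi_ge_zero real_sqrt_ge_zero)
qed

lemma DERIV_erfc: "(erfc has_field_derivative (- 2 / sqrt pi * exp (- x\<^sup>2))) (at x)"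
proof -
  \<comment> \<open>Any base point left of \<open>x\<close> serves; distance 1 makes
    \<open>x\<close> interior to the interval on which the derivative is known.\<close>
  let ?I = "\<lambda>u. integral {x - 1..u} (\<lambda>t. exp (- t\<^sup>2))"
  have "(?I has_real_derivative exp (- x\<^sup>2)) (at x within {x - 1..x + 1})"
    by (rule integral_has_real_derivative) (auto intro!: continuous_intros)
  hence "(?I has_real_derivative exp (- x\<^sup>2)) (at x)"
    by (subst (asm) at_within_interior) auto
  hence "((\<lambda>u. erfc (x - 1) - 2 / sqrt pi * ?I u) has_real_derivative (0 - 2 / sqrt pi * exp (- x\<^sup>2))) (at x)"
    by (intro DERIV_diff DERIV_cmult DERIV_const)
  moreover have "eventually (\<lambda>u. erfc (x - 1) - 2 / sqrt pi * ?I u = erfc u) (nhds x)"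
  proof -
    have "eventually (\<lambda>u. u \<in> {x - 1<..}) (nhds x)" by (rule eventually_nhds_in_open) auto
    thus ?thesis
    proof eventually_elim
      case (elim u)
      thus ?case using erfc_diff[of "x - 1" u] by simp
    qed
  qed
  ultimately show ?thesis
    using DERIV_cong_ev[OF refl, of _ _ x] by force
qed

lemma continuous_on_erfc [continuous_intros]:
  "continuous_on A f \<Longrightarrow> continuous_on A (\<lambda>x. erfc (f x))"
  using DERIV_isCont[OF DERIV_erfc] by (intro continuous_on_compose2[of UNIV erfc A f] continuous_at_imp_continuous_on) auto

lemma borel_measurable_erfc [measurable]: "erfc \<in> borel_measurable borel"
  by (intro borel_measurable_continuous_onI continuous_on_erfc continuous_on_id)

text \<open>Up to sign, \<open>erfc (sqrt z) ^ c\<close> is an antiderivative. Differentiation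
  leaves the factor \<open>erfc (sqrt z) ^ (c - 1)\<close>, and this is what the indicator in the
  final formula encodes: for \<open>c = 1\<close> the argument becomes 0, and
  \<open>erfc 0 = 1\<close>.\<close>

lemma one_minus_erfc_power:
  assumes c: "c = 1 \<or> c = 2" and y: "0 \<le> y"
  shows "(\<integral>\<^sup>+z. ennreal (real c / sqrt pi * (erfc (sqrt z * (if c = 2 then 1 else 0)) / sqrt z * exp (- z))) *
           indicator {0<..y\<^sup>2} z \<partial>lborel) = ennreal (1 - erfc y ^ c)"
proof -
  let ?k = "\<lambda>z. real c / sqrt pi * (erfc (sqrt z * (if c = 2 then 1 else 0)) / sqrt z * exp (- z))"
  have k: "?k z = real c / sqrt pi * (erfc (sqrt z) ^ (c - 1) / sqrt z * exp (- z))" for z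
    using c by (auto simp: erfc_0)
  have d: "((\<lambda>z. - (erfc (sqrt z) ^ c)) has_real_derivative ?k z) (at z)" if "z > 0" for z
  proof -
    have "((\<lambda>z. erfc (sqrt z)) has_real_derivative (- 2 / sqrt pi * exp (- (sqrt z)\<^sup>2)) * (inverse (sqrt z) / 2)) (at z)"
      by (rule DERIV_chain2[OF DERIV_erfc DERIV_real_sqrt[OF that]])
    from DERIV_minus[OF DERIV_power[OF this, of c]] show ?thesis
      unfolding k using that by (simp add: field_simps)
  qed
  \<comment> \<open>The integrand is unbounded near 0, but its antiderivative is continuous there,
    so the version of the fundamental theorem that asks for a derivative only in the interior
    applies.\<close>
  have "(?k has_integral - (erfc (sqrt (y\<^sup>2)) ^ c) - (- (erfc (sqrt 0) ^ c))) {0..y\<^sup>2}"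
    using d by (intro fundamental_theorem_of_calculus_interior)
      (auto intro!: continuous_intros simp flip: has_real_derivative_iff_has_vector_derivative)
  hence "(?k has_integral 1 - erfc y ^ c) {0..y\<^sup>2}" using y by (simp add: erfc_0)
  hence "(\<integral>\<^sup>+z. ennreal (?k z) * indicator {0..y\<^sup>2} z \<partial>lborel) = ennreal (1 - erfc y ^ c)"
    by (intro nn_integral_has_integral_lebesgue') (auto simp: erfc_nonneg)
  also have "(\<integral>\<^sup>+z. ennreal (?k z) * indicator {0..y\<^sup>2} z \<partial>lborel) = (\<integral>\<^sup>+z. ennreal (?k z) * indicator {0<..y\<^sup>2} z \<partial>lborel)"
    by (intro nn_integral_cong) (auto simp: indicator_def)
  finally show ?thesis .
qed

section \<open>The exponent of the Laplace functional as a Kummer function\<close>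

lemma has_bochner_integral_powr_atLeast:
  fixes s :: real assumes s: "1 < s"
  shows "has_bochner_integral lborel (\<lambda>w. indicator {1..} w * w powr (- s)) (1 / (s - 1))"
proof (rule has_bochner_integral_nn_integral)
  have "(\<integral>\<^sup>+w. ennreal (w powr (- s)) * indicator {1..} w \<partial>lborel) = ennreal (0 - - (1 powr (1 - s) / (s - 1)))"
  proof (rule nn_integral_FTC_atLeast[where F="\<lambda>w. - (w powr (1 - s) / (s - 1))"])
    fix w :: real assume "1 \<le> w"
    thus "((\<lambda>w. - (w powr (1 - s) / (s - 1))) has_real_derivative w powr (- s)) (at w)"
    proof -
      have "((\<lambda>w. w powr (1 - s)) has_real_derivative (1 - s) * w powr (1 - s - 1)) (at w)"
        using \<open>1 \<le> w\<close> by (intro has_real_derivative_powr) auto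
      from DERIV_minus[OF DERIV_cdivide[OF this, of "s - 1"]] show ?thesis
        by (rule DERIV_cong) (use s in \<open>simp add: divide_simps, simp add: algebra_simps\<close>)
    qed
  next
    have "((\<lambda>w. w powr (1 - s)) \<longlongrightarrow> 0) at_top"
      by (rule tendsto_neg_powr) (use s in \<open>auto intro: filterlim_ident\<close>)
    thus "((\<lambda>w. - (w powr (1 - s) / (s - 1))) \<longlongrightarrow> 0) at_top"
      using tendsto_minus[OF tendsto_divide[OF _ tendsto_const[of "s - 1"]]] s by force
  qed auto
  thus "(\<integral>\<^sup>+w. ennreal (indicator {1..} w * w powr (- s)) \<partial>lborel) = ennreal (1 / (s - 1))"
    by (simp add: ennreal_mult' ennreal_indicator mult.commute)
qed (use s in auto)

text \<open>The two products share all factors except the first of the numerator and the last of the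
  denominator. The Kummer parameters of the theorem differ by one, so its coefficients have this
  form.\<close>

lemma pochhammer_ratio_Suc:
  fixes a :: real assumes "\<And>k. a + real k \<noteq> 0"
  shows "pochhammer a n / pochhammer (a + 1) n = a / (a + real n)"
proof -
  have "a * pochhammer (a + 1) n = pochhammer a n * (a + real n)"
    by (metis pochhammer_rec pochhammer_rec' mult.commute)
  moreover have "pochhammer (a + 1) n \<noteq> 0"
    using assms by (auto simp: pochhammer_eq_0_iff) (metis add.assoc add_eq_0_iff minus_add_cancel of_nat_Suc add.commute)
  ultimately show ?thesis using assms[of n] by (simp add: field_simps)
qed

text \<open>Expanding \<open>1 - exp\<close> gives powers \<open>w powr (- s n)\<close> with
  \<open>s n > 1\<close>, each integrable because \<open>\<eta> > 2\<close>, and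
  \<open>1 / (s n - 1)\<close> is minus the Pochhammer ratio of index \<open>Suc n\<close>. The 1
  subtracted on the right is the Kummer term of index 0, which the expansion of
  \<open>1 - exp\<close> lacks.\<close>

lemma kummer_integral:
  fixes \<eta> B :: real assumes eta: "2 < \<eta>" and B: "0 \<le> B"
  shows "has_bochner_integral lborel (\<lambda>w. indicator {1..} w * (1 - exp (- (B * w powr (- \<eta> / 2)))))
     (kummer_1F1 (- 2 / \<eta>) (1 - 2 / \<eta>) (- B) - 1)"
proof -
  define f where "f n w = indicator {1..} w * (- ((- B * w powr (- \<eta> / 2)) ^ Suc n / fact (Suc n)))" for n :: nat and w :: real
  define s where "s n = real (Suc n) * \<eta> / 2" for n
  have s: "1 < s n" for n
  proof -
    have "1 * 2 < real (Suc n) * \<eta>" using eta by (intro mult_le_less_imp_less) auto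
    thus ?thesis by (simp add: s_def)
  qed
  have feq: "f n = (\<lambda>w. - ((- B) ^ Suc n / fact (Suc n)) * (indicator {1..} w * w powr (- s n)))" for n
  proof
    fix w :: real
    show "f n w = - ((- B) ^ Suc n / fact (Suc n)) * (indicator {1..} w * w powr (- s n))"
    proof (cases "1 \<le> w")
      case True
      have "(w powr (- \<eta> / 2)) ^ Suc n = w powr (- s n)"
        using True by (subst powr_power) (auto simp: s_def field_simps)
      thus ?thesis using True unfolding f_def power_mult_distrib by simp
    qed (simp add: f_def)
  qed
  have hb: "has_bochner_integral lborel (f n) (- ((- B) ^ Suc n / fact (Suc n)) * (1 / (s n - 1)))" for n
    unfolding feq by (intro has_bochner_integral_mult_right has_bochner_integral_powr_atLeast s)
  have hbn: "has_bochner_integral lborel (\<lambda>w. norm (f n w)) (B ^ Suc n / fact (Suc n) * (1 / (s n - 1)))" for n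
  proof -
    have "(\<lambda>w. norm (f n w)) = (\<lambda>w. (B ^ Suc n / fact (Suc n)) * (indicator {1..} w * w powr (- s n)))"
      unfolding feq using B by (intro ext) (simp add: abs_mult power_abs indicator_def)
    thus ?thesis by (simp only:) (intro has_bochner_integral_mult_right has_bochner_integral_powr_atLeast s)
  qed
  have expsum: "(\<lambda>n. x ^ Suc n / fact (Suc n)) sums (exp x - 1)" for x :: real
    using exp_converges[of x] by (subst sums_Suc_iff) (simp add: divide_inverse mult.commute)
  have fs: "(\<lambda>n. f n w) sums (indicator {1..} w * (1 - exp (- (B * w powr (- \<eta> / 2)))))" for w
    using sums_mult[OF sums_minus[OF expsum[of "- B * w powr (- \<eta> / 2)"]], of "indicator {1..} w"]
    unfolding f_def by simp
  have int: "integrable lborel (f n)" for n using hb by (simp add: has_bochner_integral_iff)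
  have sm: "AE w in lborel. summable (\<lambda>n. norm (f n w))"
  proof (intro AE_I2)
    fix w
    have "(\<lambda>n. norm (f n w)) = (\<lambda>n. indicator {1..} w * ((B * w powr (- \<eta> / 2)) ^ Suc n / fact (Suc n)))"
      unfolding f_def using B by (intro ext) (simp add: abs_mult power_abs indicator_def)
    thus "summable (\<lambda>n. norm (f n w))"
      using summable_mult[OF sums_summable[OF expsum]] by (simp only:)
  qed
  \<comment> \<open>The exponents increase, so \<open>1 / (s n - 1)\<close> is bounded by its value
    at 0 and an exponential series dominates.\<close>
  have s0: "s 0 \<le> s n" for n using eta by (simp add: s_def mult_right_mono)
  have sn: "summable (\<lambda>n. LBINT w. norm (f n w))"
  proof -
    have "(LBINT w. norm (f n w)) = B ^ Suc n / fact (Suc n) * (1 / (s n - 1))" for n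
      using hbn by (simp add: has_bochner_integral_iff)
    moreover have "summable (\<lambda>n. B ^ Suc n / fact (Suc n) * (1 / (s n - 1)))"
    proof (rule summable_comparison_test')
      show "summable (\<lambda>n. B ^ Suc n / fact (Suc n) * (1 / (s 0 - 1)))"
        by (intro summable_mult2 sums_summable[OF expsum])
      show "norm (B ^ Suc n / fact (Suc n) * (1 / (s n - 1))) \<le> B ^ Suc n / fact (Suc n) * (1 / (s 0 - 1))" for n
      proof -
        have "1 / (s n - 1) \<le> 1 / (s 0 - 1)" using s0[of n] s[of 0] by (intro divide_left_mono) auto
        moreover have p: "0 \<le> B ^ Suc n / fact (Suc n)" using B by simp
        moreover have "0 < 1 / (s n - 1)" using s[of n] by simp
        ultimately have "0 \<le> B ^ Suc n / fact (Suc n) * (1 / (s n - 1))"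
          "B ^ Suc n / fact (Suc n) * (1 / (s n - 1)) \<le> B ^ Suc n / fact (Suc n) * (1 / (s 0 - 1))"
          by (blast intro: mult_nonneg_nonneg less_imp_le, blast intro: mult_left_mono)
        thus ?thesis by (simp only: real_norm_def abs_of_nonneg)
      qed
    qed
    ultimately show ?thesis by simp
  qed
  have I: "integrable lborel (\<lambda>w. \<Sum>n. f n w)" "(\<lambda>n. LBINT w. f n w) sums (LBINT w. \<Sum>n. f n w)"
    using integrable_suminf[OF int sm sn] sums_integral[OF int sm sn] by auto
  \<comment> \<open>The parameter \<open>- 2 / \<eta>\<close> lies strictly between -1 and 0, so no
    denominator of the Kummer series vanishes.\<close>
  have d: "- 2 / \<eta> + real k \<noteq> 0" for k
  proof
    assume "- 2 / \<eta> + real k = 0"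
    hence "real k = 2 / \<eta>" by simp
    moreover have "0 < 2 / \<eta>" "2 / \<eta> < 1" using eta by (simp_all add: field_simps)
    ultimately have "0 < k" "k < 1" by linarith+
    thus False by simp
  qed
  have kt: "pochhammer (- 2 / \<eta>) n / pochhammer (1 - 2 / \<eta>) n = (- 2 / \<eta>) / (- 2 / \<eta> + real n)" for n
    using pochhammer_ratio_Suc[of "- 2 / \<eta>" n] d by (simp add: add.commute)
  have "(\<lambda>n. - ((- B) ^ Suc n / fact (Suc n)) * (1 / (s n - 1))) sums (LBINT w. \<Sum>n. f n w)"
    using I(2) hb by (simp add: has_bochner_integral_iff)
  moreover have "- ((- B) ^ Suc n / fact (Suc n)) * (1 / (s n - 1)) =
      pochhammer (- 2 / \<eta>) (Suc n) / pochhammer (1 - 2 / \<eta>) (Suc n) * ((- B) ^ Suc n / fact (Suc n))" for n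
  proof -
    have "(- 2 / \<eta>) / (- 2 / \<eta> + real (Suc n)) = - (1 / (s n - 1))"
      using eta s[of n] d[of "Suc n"] unfolding s_def by (simp add: field_simps)
    thus ?thesis unfolding kt by simp
  qed
  ultimately have "(\<lambda>n. pochhammer (- 2 / \<eta>) (Suc n) / pochhammer (1 - 2 / \<eta>) (Suc n) * ((- B) ^ Suc n / fact (Suc n))) sums (LBINT w. \<Sum>n. f n w)"
    by simp
  hence "(\<lambda>n. pochhammer (- 2 / \<eta>) n / pochhammer (1 - 2 / \<eta>) n * ((- B) ^ n / fact n)) sums ((LBINT w. \<Sum>n. f n w) + 1)"
    by (subst (asm) sums_Suc_iff) simp
  hence "kummer_1F1 (- 2 / \<eta>) (1 - 2 / \<eta>) (- B) - 1 = (LBINT w. \<Sum>n. f n w)"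
    unfolding kummer_1F1_def by (simp add: sums_iff)
  thus ?thesis using I(1) sums_unique[OF fs] by (simp add: has_bochner_integral_iff)
qed

text \<open>Two substitutions: \<open>u = (norm x)\<^sup>2\<close> gives the factor
  \<open>pi\<close>; \<open>u = r0\<^sup>2 * w\<close> gives the factor \<open>r0\<^sup>2\<close>,
  moves the boundary to 1 and turns \<open>B\<close> into
  \<open>B * r0 powr (- \<eta>)\<close>.\<close>

lemma kummer_integral_plane:
  fixes \<eta> B r0 :: real
  assumes dim: "DIM('a::euclidean_space) = 2" and eta: "2 < \<eta>" and B: "0 \<le> B" and r0: "0 < r0"
  shows "set_integrable lborel {x :: 'a. r0 < norm x} (\<lambda>x. 1 - exp (- (B * norm x powr (- \<eta>))))"
    and "(LBINT x:{x :: 'a. r0 < norm x}. 1 - exp (- (B * norm x powr (- \<eta>)))) =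
         pi * r0\<^sup>2 * (kummer_1F1 (- 2 / \<eta>) (1 - 2 / \<eta>) (- (B * r0 powr (- \<eta>))) - 1)"
proof -
  let ?D = "{x :: 'a. r0 < norm x}" and ?g = "\<lambda>x :: 'a. 1 - exp (- (B * norm x powr (- \<eta>)))"
  let ?f = "\<lambda>u :: real. ennreal (1 - exp (- (B * u powr (- \<eta> / 2)))) * indicator {r0\<^sup>2<..} u"
  define C where "C = B * r0 powr (- \<eta>)"
  define K where "K = kummer_1F1 (- 2 / \<eta>) (1 - 2 / \<eta>) (- C) - 1"
  have C: "0 \<le> C" using B by (simp add: C_def)
  have hK: "has_bochner_integral lborel (\<lambda>w. indicator {1..} w * (1 - exp (- (C * w powr (- \<eta> / 2))))) K"
    unfolding K_def by (rule kummer_integral[OF eta C])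
  have K: "0 \<le> K" using hK C unfolding has_bochner_integral_iff
    by (auto intro!: integral_nonneg_AE simp: indicator_def)
  have nK: "(\<integral>\<^sup>+w. ennreal (indicator {1..} w * (1 - exp (- (C * w powr (- \<eta> / 2))))) \<partial>lborel) = ennreal K"
    using hK C unfolding has_bochner_integral_iff by (subst nn_integral_eq_integral) (auto simp: indicator_def)
  have p: "norm x powr (- \<eta>) = (norm x)\<^sup>2 powr (- \<eta> / 2)" for x :: 'a
    by (cases "x = 0") (simp_all add: powr_powr flip: powr_numeral)
  have g0: "0 \<le> ?g x" for x using B by simp
  have "(\<integral>\<^sup>+x. ennreal (indicator ?D x * ?g x) \<partial>lborel) = (\<integral>\<^sup>+x. ?f ((norm (x :: 'a))\<^sup>2) \<partial>lborel)"
  proof (intro nn_integral_cong)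
    fix x :: 'a
    have "r0\<^sup>2 < (norm x)\<^sup>2 \<longleftrightarrow> r0 < norm x" using r0 by (metis norm_ge_zero power2_less_imp_less power_strict_mono pos2 less_eq_real_def)
    thus "ennreal (indicator ?D x * ?g x) = ?f ((norm (x :: 'a))\<^sup>2)" by (simp add: p indicator_def)
  qed
  also have "\<dots> = (\<integral>\<^sup>+u. ennreal pi * indicator {0..} u * ?f u \<partial>lborel)"
    by (rule nn_integral_norm_square_2[OF dim]) simp
  also have "\<dots> = (\<integral>\<^sup>+u. ennreal pi * ?f u \<partial>lborel)"
    by (intro nn_integral_cong) (auto simp: indicator_def intro: order_trans[OF zero_le_power2] dest: less_imp_le)
  also have "\<dots> = ennreal pi * (\<integral>\<^sup>+u. ?f u \<partial>lborel)"
    by (rule nn_integral_cmult) simp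
  also have "(\<integral>\<^sup>+u. ?f u \<partial>lborel) = ennreal \<bar>r0\<^sup>2\<bar> * (\<integral>\<^sup>+w. ?f (0 + r0\<^sup>2 * w) \<partial>lborel)"
    using r0 by (intro nn_integral_real_affine) auto
  also have "(\<integral>\<^sup>+w. ?f (0 + r0\<^sup>2 * w) \<partial>lborel) = (\<integral>\<^sup>+w. ennreal (indicator {1..} w * (1 - exp (- (C * w powr (- \<eta> / 2))))) \<partial>lborel)"
  \<comment> \<open>The region outside the disc is open, whereas the Kummer integral starts at a
    closed endpoint; the single point \<open>w = 1\<close> is discarded.\<close>
  proof (rule nn_integral_cong_AE, use AE_lborel_singleton[of "1 :: real"] in eventually_elim)
    fix w :: real assume w: "w \<noteq> 1"
    have "r0\<^sup>2 < r0\<^sup>2 * w \<longleftrightarrow> 1 < w" using r0 by simp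
    moreover have "B * (r0\<^sup>2 * w) powr (- \<eta> / 2) = C * w powr (- \<eta> / 2)" if "1 < w"
      using r0 that by (simp add: powr_mult C_def powr_powr flip: powr_numeral)
    ultimately show "?f (0 + r0\<^sup>2 * w) = ennreal (indicator {1..} w * (1 - exp (- (C * w powr (- \<eta> / 2)))))"
      using w by (auto simp: indicator_def)
  qed
  finally have nn: "(\<integral>\<^sup>+x. ennreal (indicator ?D x * ?g x) \<partial>lborel) = ennreal (pi * r0\<^sup>2 * K)"
    unfolding nK using K by (simp add: ennreal_mult' mult.assoc)
  have "has_bochner_integral lborel (\<lambda>x. indicator ?D x * ?g x) (pi * r0\<^sup>2 * K)"
    by (rule has_bochner_integral_nn_integral) (use g0 K nn in \<open>auto simp: indicator_def\<close>)
  thus "set_integrable lborel ?D ?g" "(LBINT x:?D. ?g x) = pi * r0\<^sup>2 * (kummer_1F1 (- 2 / \<eta>) (1 - 2 / \<eta>) (- (B * r0 powr (- \<eta>))) - 1)"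
    by (simp_all add: has_bochner_integral_iff set_integrable_def set_lebesgue_integral_def K_def C_def)
qed

section \<open>Independence and Gaussian mixtures\<close>

lemma measurable_summable [measurable]:
  fixes f :: "nat \<Rightarrow> 'a \<Rightarrow> 'b::{banach, second_countable_topology}"
  assumes [measurable]: "\<And>i. f i \<in> borel_measurable M"
  shows "Measurable.pred M (\<lambda>x. summable (\<lambda>i. f i x))"
proof -
  have "(\<lambda>x. summable (\<lambda>i. f i x)) = (\<lambda>x. Cauchy (\<lambda>n. \<Sum>i<n. f i x))"
    by (simp add: summable_iff_convergent Cauchy_convergent_iff)
  thus ?thesis using sets_Collect_Cauchy[of "\<lambda>n x. \<Sum>i<n. f i x" M] by (simp add: pred_def)
qed

context prob_space
begin

text \<open>Components of different types are handled through generators: disjoint blocks of an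
  independent family of intersection-stable systems generate independent sigma-algebras, and
  \<open>f j\<close> only has to be measurable with respect to its own block.\<close>

lemma indep_vars_grouped:
  assumes E: "indep_sets E UNIV" and stable: "\<And>i. Int_stable (E i)"
    and disj: "disjoint_family_on I J"
    and f: "\<And>j. j \<in> J \<Longrightarrow> f j \<in> measurable (sigma (space M) (\<Union>i\<in>I j. E i)) (N j)"
  shows "indep_vars N f J"
proof -
  have ev: "E i \<subseteq> events" for i using E by (auto simp: indep_sets_def)
  have sub: "(\<Union>i\<in>I j. E i) \<subseteq> Pow (space M)" for j
    using ev sets.space_closed by blast
  have sig: "sigma_sets (space M) (\<Union>i\<in>I j. E i) \<subseteq> events" for j
    using ev by (intro sets.sigma_sets_subset) auto
  have sets: "f j -` A \<inter> space M \<in> sigma_sets (space M) (\<Union>i\<in>I j. E i)" if "j \<in> J" "A \<in> sets (N j)" for j A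
    using measurable_sets[OF f[OF that(1)] that(2)] sub by (simp add: space_measure_of)
  have "indep_sets (\<lambda>j. sigma_sets (space M) (\<Union>i\<in>I j. E i)) J"
    using E stable disj by (intro indep_sets_collect_sigma) (auto intro: indep_sets_mono_index)
  hence "indep_sets (\<lambda>j. {f j -` A \<inter> space M |A. A \<in> sets (N j)}) J"
    by (rule indep_sets_mono_sets) (use sets in auto)
  moreover have "random_variable (N j) (f j)" if "j \<in> J" for j
    using sets[OF that] sig measurable_space[OF f[OF that]] by (intro measurableI) (auto simp: space_measure_of_conv)
  ultimately show ?thesis unfolding indep_vars_def2 by blast
qed

lemma indep_var_grouped:
  assumes E: "indep_sets E UNIV" and stable: "\<And>i. Int_stable (E i)" and disj: "I \<inter> J = {}"
    and f: "f \<in> measurable (sigma (space M) (\<Union>i\<in>I. E i)) S"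
    and g: "g \<in> measurable (sigma (space M) (\<Union>i\<in>J. E i)) T"
  shows "indep_var S f T g"
  unfolding indep_var_def
proof (rule indep_vars_grouped[OF E stable])
  show "disjoint_family_on (case_bool I J) UNIV"
    using disj by (auto simp: disjoint_family_on_def split: bool.split)
  fix b show "case_bool f g b \<in> measurable (sigma (space M) (\<Union>i\<in>case_bool I J b. E i)) (case_bool S T b)"
    using f g by (cases b) auto
qed

text \<open>The substitute for conditioning on \<open>A\<close>: the joint law is the product of the
  marginals, so \<open>A\<close> can be frozen at an outer sample \<open>w'\<close> while
  \<open>B\<close> is averaged.\<close>

lemma indep_var_nn_integral:
  assumes indep: "indep_var S A T B" and [measurable]: "f \<in> borel_measurable (S \<Otimes>\<^sub>M T)"
  shows "(\<integral>\<^sup>+w. f (A w, B w) \<partial>M) = (\<integral>\<^sup>+w'. (\<integral>\<^sup>+w. f (A w', B w) \<partial>M) \<partial>M)"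
proof -
  have [measurable]: "random_variable S A" "random_variable T B"
    using indep by (auto dest: indep_var_rv1 indep_var_rv2)
  interpret T: prob_space "distr M T B" by (rule prob_space_distr) simp
  have "(\<integral>\<^sup>+w. f (A w, B w) \<partial>M) = (\<integral>\<^sup>+p. f p \<partial>distr M (S \<Otimes>\<^sub>M T) (\<lambda>w. (A w, B w)))"
    by (subst nn_integral_distr) auto
  also have "\<dots> = (\<integral>\<^sup>+p. f p \<partial>(distr M S A \<Otimes>\<^sub>M distr M T B))"
    using indep by (simp add: indep_var_distribution_eq)
  also have "\<dots> = (\<integral>\<^sup>+a. (\<integral>\<^sup>+b. f (a, b) \<partial>distr M T B) \<partial>distr M S A)"
    by (subst T.nn_integral_fst[symmetric]) (auto cong: measurable_cong_sets sets_pair_measure_cong)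
  also have "\<dots> = (\<integral>\<^sup>+a. (\<integral>\<^sup>+w. f (a, B w) \<partial>M) \<partial>distr M S A)"
    by (intro nn_integral_cong) (simp add: nn_integral_distr)
  also have "\<dots> = (\<integral>\<^sup>+w'. (\<integral>\<^sup>+w. f (A w', B w) \<partial>M) \<partial>M)"
    by (rule nn_integral_distr) auto
  finally show ?thesis .
qed

text \<open>For almost every frozen coefficient sequence the series is Gaussian, with the weighted
  sum of squares as its variance. \<open>G\<close> depends on the variance alone, so averaging over
  the coefficients gives the mixture; the same freezing applied to divergence shows that it has
  probability 0.\<close>

lemma gaussian_series_mixture:
  fixes U H :: "nat \<Rightarrow> 'a \<Rightarrow> complex"
  assumes indep: "indep_var (\<Pi>\<^sub>M k\<in>UNIV. borel) (\<lambda>w k. U k w) (\<Pi>\<^sub>M k\<in>UNIV. borel) (\<lambda>w k. H k w)"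
    and H: "indep_vars (\<lambda>_. borel) H UNIV" "\<And>k. complex_gaussian M (v k) (H k)" "\<And>k. 0 < v k"
    and U: "AE w in M. summable (\<lambda>k. (cmod (U k w))\<^sup>2 * v k) \<and> 0 < (\<Sum>k. (cmod (U k w))\<^sup>2 * v k)"
  shows "AE w in M. summable (\<lambda>k. U k w * H k w)"
    and "R \<in> sets borel \<Longrightarrow> (\<And>\<tau> Z. 0 < \<tau> \<Longrightarrow> complex_gaussian M \<tau> Z \<Longrightarrow> prob {w\<in>space M. Z w \<in> R} = G \<tau>) \<Longrightarrow>
       emeasure M {w\<in>space M. (\<Sum>k. U k w * H k w) \<in> R} = (\<integral>\<^sup>+w. ennreal (G (\<Sum>k. (cmod (U k w))\<^sup>2 * v k)) \<partial>M)"
proof -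
  let ?P = "\<Pi>\<^sub>M k\<in>(UNIV :: nat set). (borel :: complex measure)"
  have UH[measurable]: "random_variable ?P (\<lambda>w k. U k w)" "random_variable ?P (\<lambda>w k. H k w)"
    using indep by (auto dest: indep_var_rv1 indep_var_rv2)
  have [measurable]: "random_variable borel (U k)" "random_variable borel (H k)" for k
    using measurable_compose[OF UH(1) measurable_component_singleton[of k]]
      measurable_compose[OF UH(2) measurable_component_singleton[of k]] by auto
  have c[measurable]: "(\<lambda>p. fst p k * snd p k) \<in> borel_measurable (?P \<Otimes>\<^sub>M ?P)" for k
    by measurable
  have ev: "{w\<in>space M. \<not> summable (\<lambda>k. u k * H k w)} \<in> events"
    "{w\<in>space M. \<not> summable (\<lambda>k. U k w * H k w)} \<in> events" for u
    by measurable
  \<comment> \<open>\<open>Q\<close> is a property of the whole sequence of terms, so that one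
    Fubini argument covers both divergence and membership of the sum in \<open>R\<close>.\<close>
  have step: "emeasure M {w\<in>space M. Q (\<lambda>k. U k w * H k w)} =
       (\<integral>\<^sup>+w'. emeasure M {w\<in>space M. Q (\<lambda>k. U k w' * H k w)} \<partial>M)"
    if Q: "Measurable.pred (?P \<Otimes>\<^sub>M ?P) (\<lambda>p. Q (\<lambda>k. fst p k * snd p k))" for Q
  proof -
    define f where "f p = (indicator {p \<in> space (?P \<Otimes>\<^sub>M ?P). Q (\<lambda>k. fst p k * snd p k)} p :: ennreal)" for p
    have [measurable]: "f \<in> borel_measurable (?P \<Otimes>\<^sub>M ?P)" unfolding f_def using Q by measurable
    have fe: "f (u, z) = indicator {z. Q (\<lambda>k. u k * z k)} z" for u z
      by (auto simp: f_def space_pair_measure space_PiM indicator_def)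
    have fm: "(\<lambda>w. f (u, \<lambda>k. H k w)) \<in> borel_measurable M" for u
    proof -
      have "u \<in> space ?P" by (simp add: space_PiM)
      thus ?thesis by measurable
    qed
    have set1: "{w\<in>space M. Q (\<lambda>k. u k * H k w)} \<in> events" for u
    proof -
      have "{w\<in>space M. Q (\<lambda>k. u k * H k w)} = (\<lambda>w. f (u, \<lambda>k. H k w)) -` {1} \<inter> space M"
        unfolding fe by (auto simp: indicator_def split: if_splits)
      thus ?thesis using measurable_sets[OF fm, of "{1}"] by simp
    qed
    have set2: "{w\<in>space M. Q (\<lambda>k. U k w * H k w)} \<in> events"
    proof -
      have m: "(\<lambda>w. f (\<lambda>k. U k w, \<lambda>k. H k w)) \<in> borel_measurable M" by measurable
      have "{w\<in>space M. Q (\<lambda>k. U k w * H k w)} = (\<lambda>w. f (\<lambda>k. U k w, \<lambda>k. H k w)) -` {1} \<inter> space M"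
        unfolding fe by (auto simp: indicator_def split: if_splits)
      thus ?thesis using measurable_sets[OF m, of "{1}"] by simp
    qed
    have "emeasure M {w\<in>space M. Q (\<lambda>k. U k w * H k w)} = (\<integral>\<^sup>+w. f (\<lambda>k. U k w, \<lambda>k. H k w) \<partial>M)"
    proof -
      have "emeasure M {w\<in>space M. Q (\<lambda>k. U k w * H k w)} = (\<integral>\<^sup>+w. indicator {w\<in>space M. Q (\<lambda>k. U k w * H k w)} w \<partial>M)"
        using set2 by (rule nn_integral_indicator[symmetric])
      thus ?thesis by (simp only:) (intro nn_integral_cong, auto simp: fe indicator_def)
    qed
    also have "\<dots> = (\<integral>\<^sup>+w'. (\<integral>\<^sup>+w. f (\<lambda>k. U k w', \<lambda>k. H k w) \<partial>M) \<partial>M)"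
      by (rule indep_var_nn_integral[OF indep]) simp
    also have "\<dots> = (\<integral>\<^sup>+w'. emeasure M {w\<in>space M. Q (\<lambda>k. U k w' * H k w)} \<partial>M)"
    proof (rule nn_integral_cong)
      fix w'
      have "emeasure M {w\<in>space M. Q (\<lambda>k. U k w' * H k w)} = (\<integral>\<^sup>+w. indicator {w\<in>space M. Q (\<lambda>k. U k w' * H k w)} w \<partial>M)"
        using set1 by (rule nn_integral_indicator[symmetric])
      thus "(\<integral>\<^sup>+w. f (\<lambda>k. U k w', \<lambda>k. H k w) \<partial>M) = emeasure M {w\<in>space M. Q (\<lambda>k. U k w' * H k w)}"
        by (simp only:) (intro nn_integral_cong, auto simp: fe indicator_def)
    qed
    finally show ?thesis .
  qed
  have pc: "Measurable.pred (?P \<Otimes>\<^sub>M ?P) (\<lambda>p. \<not> summable (\<lambda>k. fst p k * snd p k))"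
    using measurable_summable[OF c] by measurable
  have "emeasure M {w\<in>space M. \<not> summable (\<lambda>k. U k w * H k w)} =
      (\<integral>\<^sup>+w'. emeasure M {w\<in>space M. \<not> summable (\<lambda>k. U k w' * H k w)} \<partial>M)"
    by (rule step[OF pc])
  also have "\<dots> = (\<integral>\<^sup>+w'. 0 \<partial>M)"
  proof (rule nn_integral_cong_AE)
    show "AE w' in M. emeasure M {w\<in>space M. \<not> summable (\<lambda>k. U k w' * H k w)} = 0"
      using U
    proof eventually_elim
      case (elim w')
      hence "AE w in M. summable (\<lambda>k. U k w' * H k w)"
        using complex_gaussian_suminf(1)[OF H, of "\<lambda>k. U k w'"] by blast
      thus ?case by (subst (asm) AE_iff_measurable[OF _ refl]) (use ev in auto)
    qed
  qed
  finally show "AE w in M. summable (\<lambda>k. U k w * H k w)"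
    by (subst AE_iff_measurable[OF _ refl]) (use ev in auto)
  assume R[measurable]: "R \<in> sets borel"
    and G: "\<And>\<tau> Z. 0 < \<tau> \<Longrightarrow> complex_gaussian M \<tau> Z \<Longrightarrow> prob {w\<in>space M. Z w \<in> R} = G \<tau>"
  have "emeasure M {w\<in>space M. (\<Sum>k. U k w * H k w) \<in> R} =
     (\<integral>\<^sup>+w'. emeasure M {w\<in>space M. (\<Sum>k. U k w' * H k w) \<in> R} \<partial>M)"
    by (rule step) measurable
  also have "\<dots> = (\<integral>\<^sup>+w. ennreal (G (\<Sum>k. (cmod (U k w))\<^sup>2 * v k)) \<partial>M)"
  proof (rule nn_integral_cong_AE)
    show "AE w' in M. emeasure M {w\<in>space M. (\<Sum>k. U k w' * H k w) \<in> R} = ennreal (G (\<Sum>k. (cmod (U k w'))\<^sup>2 * v k))"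
      using U
    proof eventually_elim
      case (elim w')
      have "complex_gaussian M (\<Sum>k. (cmod (U k w'))\<^sup>2 * v k) (\<lambda>w. \<Sum>k. U k w' * H k w)"
        using complex_gaussian_suminf(2)[OF H, of "\<lambda>k. U k w'"] elim by blast
      from G[OF conjunct2[OF elim] this] show ?case by (simp add: emeasure_eq_measure)
    qed
  qed
  finally show "emeasure M {w\<in>space M. (\<Sum>k. U k w * H k w) \<in> R} = (\<integral>\<^sup>+w. ennreal (G (\<Sum>k. (cmod (U k w))\<^sup>2 * v k)) \<partial>M)" .
qed

section \<open>Gaussian probabilities of decision rectangles\<close>

lemma normal_tail_erfc:
  assumes tau: "0 < \<tau>" and D: "distributed M lborel X (normal_density 0 (sqrt (\<tau> / 2)))"
  shows "prob {w\<in>space M. b \<le> X w} = erfc (b / sqrt \<tau>) / 2"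
    and "prob {w\<in>space M. X w \<le> - b} = erfc (b / sqrt \<tau>) / 2"
    and "prob {w\<in>space M. X w = b} = 0"
proof -
  have s: "0 < sqrt (\<tau> / 2)" using tau by simp
  have main: "prob {w\<in>space M. b \<le> X w} = erfc (b / sqrt \<tau>) / 2"
    if D: "distributed M lborel X (normal_density 0 (sqrt (\<tau> / 2)))" for X
  proof -
    \<comment> \<open>Dividing by \<open>sqrt \<tau>\<close> leaves variance 1/2, for which the
      normal density is \<open>exp (- x\<^sup>2) / sqrt pi\<close>, the integrand of
      \<open>erfc\<close>.\<close>
    have "distributed M lborel (\<lambda>w. 0 + (1 / sqrt \<tau>) * X w) (normal_density (0 + (1 / sqrt \<tau>) * 0) (\<bar>1 / sqrt \<tau>\<bar> * sqrt (\<tau> / 2)))"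
      by (rule normal_density_affine[OF D s]) (use tau in simp)
    hence Y: "distributed M lborel (\<lambda>w. X w / sqrt \<tau>) (normal_density 0 (sqrt (1 / 2)))"
      using tau by (simp add: real_sqrt_divide)
    have "{w\<in>space M. b \<le> X w} = (\<lambda>w. X w / sqrt \<tau>) -` {b / sqrt \<tau>..} \<inter> space M"
      using tau by (auto simp: divide_right_mono field_simps)
    hence "emeasure M {w\<in>space M. b \<le> X w} = (\<integral>\<^sup>+x. ennreal (normal_density 0 (sqrt (1 / 2)) x) * indicator {b / sqrt \<tau>..} x \<partial>lborel)"
      using distributed_emeasure[OF Y, of "{b / sqrt \<tau>..}"] by simp
    also have "\<dots> = (\<integral>\<^sup>+x. ennreal (1 / sqrt pi * (indicator {b / sqrt \<tau>..} x * exp (- x\<^sup>2))) \<partial>lborel)"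
      by (intro nn_integral_cong) (auto simp: normal_density_def indicator_def)
    also have "\<dots> = ennreal (LBINT x. 1 / sqrt pi * (indicator {b / sqrt \<tau>..} x * exp (- x\<^sup>2)))"
      using gaussian_set_integrable[of "{b / sqrt \<tau>..}"] unfolding set_integrable_def
      by (intro nn_integral_eq_integral integrable_mult_right) auto
    also have "(LBINT x. 1 / sqrt pi * (indicator {b / sqrt \<tau>..} x * exp (- x\<^sup>2))) = erfc (b / sqrt \<tau>) / 2"
      by (simp add: erfc_def set_lebesgue_integral_def)
    finally show ?thesis by (simp add: emeasure_eq_measure erfc_nonneg)
  qed
  show "prob {w\<in>space M. b \<le> X w} = erfc (b / sqrt \<tau>) / 2" by (rule main[OF D])
  have "distributed M lborel (\<lambda>w. 0 + (- 1) * X w) (normal_density (0 + (- 1) * 0) (\<bar>- 1\<bar> * sqrt (\<tau> / 2)))"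
    by (rule normal_density_affine[OF D s]) simp
  hence "distributed M lborel (\<lambda>w. - X w) (normal_density 0 (sqrt (\<tau> / 2)))" by simp
  from main[OF this] show "prob {w\<in>space M. X w \<le> - b} = erfc (b / sqrt \<tau>) / 2"
    by (simp add: le_minus_iff)
  have "X -` {b} \<inter> space M = {w\<in>space M. X w = b}" by auto
  hence "emeasure M {w\<in>space M. X w = b} = (\<integral>\<^sup>+x. ennreal (normal_density 0 (sqrt (\<tau> / 2)) x) * indicator {b} x \<partial>lborel)"
    using distributed_emeasure[OF D, of "{b}"] by simp
  also have "\<dots> = 0" by (subst nn_integral_0_iff_AE) (auto intro: AE_mp[OF AE_lborel_singleton[of b]] simp: indicator_def)
  finally show "prob {w\<in>space M. X w = b} = 0" by (simp add: emeasure_eq_measure)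
qed

text \<open>The flags say which sides bound the rectangle, as outer constellation points have
  unbounded cells. Each bounding side removes the mass \<open>erfc (b / sqrt \<tau>) / 2\<close>
  from its coordinate, and opposite half lines are disjoint because \<open>b > 0\<close>. The second
  part disposes of ties on the boundary.\<close>

lemma complex_gaussian_rectangle:
  assumes tau: "0 < \<tau>" and Z: "complex_gaussian M \<tau> Z" and b: "0 < b"
  shows "prob {w\<in>space M. ((l \<longrightarrow> - b < Re (Z w)) \<and> (u \<longrightarrow> Re (Z w) < b)) \<and> ((l' \<longrightarrow> - b < Im (Z w)) \<and> (u' \<longrightarrow> Im (Z w) < b))} =
     (1 - (of_bool l + of_bool u) / 2 * erfc (b / sqrt \<tau>)) * (1 - (of_bool l' + of_bool u') / 2 * erfc (b / sqrt \<tau>))"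
    and "prob {w\<in>space M. Re (Z w) \<in> {b, - b} \<or> Im (Z w) \<in> {b, - b}} = 0"
proof -
  note R = Z[unfolded complex_gaussian_def, THEN conjunct1]
  note I = Z[unfolded complex_gaussian_def, THEN conjunct2, THEN conjunct1]
  have [measurable]: "random_variable borel Z" by (rule complex_gaussian_measurable[OF Z])
  have one: "prob {w\<in>space M. (l \<longrightarrow> - b < X w) \<and> (u \<longrightarrow> X w < b)} = 1 - (of_bool l + of_bool u) / 2 * erfc (b / sqrt \<tau>)"
    if D: "distributed M lborel X (normal_density 0 (sqrt (\<tau> / 2)))" for X l u
  proof -
    have [measurable]: "random_variable borel X" using distributed_measurable[OF D] by simp
    let ?L = "{w\<in>space M. l \<and> X w \<le> - b}" and ?U = "{w\<in>space M. u \<and> b \<le> X w}"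
    have "{w\<in>space M. (l \<longrightarrow> - b < X w) \<and> (u \<longrightarrow> X w < b)} = space M - (?L \<union> ?U)" by auto
    hence "prob {w\<in>space M. (l \<longrightarrow> - b < X w) \<and> (u \<longrightarrow> X w < b)} = 1 - prob (?L \<union> ?U)"
      using prob_compl[of "?L \<union> ?U"] by simp
    also have "prob (?L \<union> ?U) = prob ?L + prob ?U"
      using b by (intro finite_measure_Union) auto
    also have "prob ?L = of_bool l / 2 * erfc (b / sqrt \<tau>)" using normal_tail_erfc(2)[OF tau D, of b] by (cases l) auto
    also have "prob ?U = of_bool u / 2 * erfc (b / sqrt \<tau>)" using normal_tail_erfc(1)[OF tau D, of b] by (cases u) auto
    finally show ?thesis by (simp add: algebra_simps add_divide_distrib)
  qed
  let ?A = "{x. (l \<longrightarrow> - b < x) \<and> (u \<longrightarrow> x < b)}" and ?B = "{x. (l' \<longrightarrow> - b < x) \<and> (u' \<longrightarrow> x < b)}"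
  have AB: "?A \<in> sets borel" "?B \<in> sets borel" by measurable
  have "prob {w\<in>space M. Re (Z w) \<in> ?A \<and> Im (Z w) \<in> ?B} = prob {w\<in>space M. Re (Z w) \<in> ?A} * prob {w\<in>space M. Im (Z w) \<in> ?B}"
  proof -
    have iv: "indep_var borel (\<lambda>w. Re (Z w)) borel (\<lambda>w. Im (Z w))" using Z by (simp add: complex_gaussian_def)
    show ?thesis using indep_varD[OF iv AB] by (simp add: vimage_def Int_def conj_commute)
  qed
  thus "prob {w\<in>space M. ((l \<longrightarrow> - b < Re (Z w)) \<and> (u \<longrightarrow> Re (Z w) < b)) \<and> ((l' \<longrightarrow> - b < Im (Z w)) \<and> (u' \<longrightarrow> Im (Z w) < b))} =
     (1 - (of_bool l + of_bool u) / 2 * erfc (b / sqrt \<tau>)) * (1 - (of_bool l' + of_bool u') / 2 * erfc (b / sqrt \<tau>))"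
    using one[OF R, of l u] one[OF I, of l' u'] by simp
  have "AE w in M. Re (Z w) \<noteq> c" "AE w in M. Im (Z w) \<noteq> c" for c
    using normal_tail_erfc(3)[OF tau R, of c] normal_tail_erfc(3)[OF tau I, of c]
    by (simp_all add: AE_iff_measurable[OF _ refl] emeasure_eq_measure)
  hence "AE w in M. \<not> (Re (Z w) \<in> {b, - b} \<or> Im (Z w) \<in> {b, - b})" by simp
  thus "prob {w\<in>space M. Re (Z w) \<in> {b, - b} \<or> Im (Z w) \<in> {b, - b}} = 0"
    by (subst (asm) AE_iff_measurable[OF _ refl]) (auto simp: emeasure_eq_measure)
qed

section \<open>Interference from the Poisson field\<close>

text \<open>For positive \<open>\<theta>\<close> the Laplace transform of the possibly infinite sum
  ignores the divergent paths, so it is at most the probability of summability. Its Poisson exponent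
  \<open>I \<theta>\<close> tends to 0 with \<open>\<theta>\<close>, which makes this probability
  1.\<close>

lemma poisson_point_process_path_loss_summable:
  fixes X :: "nat \<Rightarrow> 'a \<Rightarrow> 'b::euclidean_space"
  assumes dim: "DIM('b) = 2" and X[measurable]: "\<And>k. random_variable borel (X k)"
    and inj: "AE w in M. inj (\<lambda>k. X k w)"
    and ppp: "poisson_point_process M lam {x. r0 < norm x} (\<lambda>w. range (\<lambda>k. X k w))"
    and lam: "0 \<le> lam" and r0: "0 < r0" and eta: "2 < \<eta>"
  shows "AE w in M. summable (\<lambda>k. norm (X k w) powr (- \<eta>))"
proof -
  let ?D = "{x :: 'b. r0 < norm x}"
  define f where "f x = norm x powr (- \<eta>)" for x :: 'b
  have [measurable]: "f \<in> borel_measurable borel" unfolding f_def by measurable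
  have f0: "0 \<le> f x" for x by (simp add: f_def)
  define S where "S w \<longleftrightarrow> summable (\<lambda>k. f (X k w))" for w
  have [measurable]: "Measurable.pred M S" unfolding S_def by (rule measurable_summable) measurable
  define I where "I \<theta> = (LBINT x:?D. 1 - exp (- (\<theta> * f x)))" for \<theta>
  have int: "set_integrable lborel ?D (\<lambda>x. 1 - exp (- (\<theta> * f x)))" if "0 \<le> \<theta>" for \<theta>
    using kummer_integral_plane(1)[OF dim eta that r0] by (simp add: f_def)
  have bound: "exp (- lam * I \<theta>) \<le> prob {w\<in>space M. S w}" if th: "0 < \<theta>" for \<theta>
  proof -
    have "(\<lambda>n. expectation (\<lambda>w. \<Prod>k<n. (1 - (1 - exp (- (\<theta> * f (X k w))))))) \<longlonglongrightarrow> exp (- lam * I \<theta>)"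
      unfolding I_def by (rule poisson_point_process_laplace[OF X inj ppp lam]) (use th f0 int in auto)
    \<comment> \<open>Along a divergent path the partial sums tend to infinity and the exponential
      to 0, which explains the value 0 in the limit.\<close>
    moreover have "(\<lambda>n. expectation (\<lambda>w. \<Prod>k<n. (1 - (1 - exp (- (\<theta> * f (X k w))))))) \<longlonglongrightarrow>
       expectation (\<lambda>w. if S w then exp (- (\<theta> * (\<Sum>k. f (X k w)))) else 0)"
    proof (rule integral_dominated_convergence[where w="\<lambda>_. 1"])
      have e: "(\<Prod>k<n. (1 - (1 - exp (- (\<theta> * f (X k w)))))) = exp (- (\<theta> * (\<Sum>k<n. f (X k w))))" for n w
        by (simp add: exp_sum[symmetric] sum_negf sum_distrib_left)
      show "AE w in M. (\<lambda>n. \<Prod>k<n. (1 - (1 - exp (- (\<theta> * f (X k w)))))) \<longlonglongrightarrow>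
          (if S w then exp (- (\<theta> * (\<Sum>k. f (X k w)))) else 0)"
        unfolding e
      proof (intro AE_I2)
        fix w
        show "(\<lambda>n. exp (- (\<theta> * (\<Sum>k<n. f (X k w))))) \<longlonglongrightarrow> (if S w then exp (- (\<theta> * (\<Sum>k. f (X k w)))) else 0)"
        proof (cases "S w")
          case True
          thus ?thesis unfolding S_def by (auto intro!: tendsto_intros summable_LIMSEQ)
        next
          case False
          have "filterlim (\<lambda>n. \<Sum>k<n. f (X k w)) at_top sequentially"
            unfolding filterlim_at_top
          proof
            fix C
            obtain n where n: "C \<le> (\<Sum>k<n. f (X k w))"
            proof (rule ccontr)
              assume "\<not> thesis"
              hence "(\<Sum>k<n. f (X k w)) \<le> C" for n using that by (meson linear)
              hence "summable (\<lambda>k. f (X k w))" using f0 by (intro summableI_nonneg_bounded) auto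
              thus False using False by (simp add: S_def)
            qed
            show "eventually (\<lambda>n. C \<le> (\<Sum>k<n. f (X k w))) sequentially"
            proof (rule eventually_sequentiallyI)
              fix m assume "n \<le> m"
              hence "(\<Sum>k<n. f (X k w)) \<le> (\<Sum>k<m. f (X k w))" using f0 by (intro sum_mono2) auto
              thus "C \<le> (\<Sum>k<m. f (X k w))" using n by simp
            qed
          qed
          hence "filterlim (\<lambda>n. \<theta> * (\<Sum>k<n. f (X k w))) at_top sequentially"
            using th by (intro filterlim_tendsto_pos_mult_at_top[OF tendsto_const])
          hence "filterlim (\<lambda>n. - (\<theta> * (\<Sum>k<n. f (X k w)))) at_bot sequentially"
            by (simp add: filterlim_uminus_at_bot)
          thus ?thesis using False filterlim_compose[OF exp_at_bot] by auto
        qed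
      qed
      show "AE w in M. norm (\<Prod>k<n. (1 - (1 - exp (- (\<theta> * f (X k w)))))) \<le> 1" for n
        unfolding e using th f0 by (intro AE_I2) (auto intro!: mult_nonneg_nonneg sum_nonneg)
    qed auto
    ultimately have "exp (- lam * I \<theta>) = expectation (\<lambda>w. if S w then exp (- (\<theta> * (\<Sum>k. f (X k w)))) else 0)"
      by (rule LIMSEQ_unique)
    also have "\<dots> \<le> expectation (indicator {w\<in>space M. S w})"
    proof (rule integral_mono)
      have b: "exp (- (\<theta> * (\<Sum>k. f (X k w)))) \<le> 1" if "S w" for w
        using that th f0 unfolding S_def by (auto intro!: mult_nonneg_nonneg suminf_nonneg)
      show "integrable M (\<lambda>w. if S w then exp (- (\<theta> * (\<Sum>k. f (X k w)))) else 0)"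
        using b by (intro integrable_const_bound[where B=1]) auto
      show "(if S w then exp (- (\<theta> * (\<Sum>k. f (X k w)))) else 0) \<le> indicator {w\<in>space M. S w} w" if "w \<in> space M" for w
        using b that by auto
    qed (auto simp: emeasure_eq_measure)
    finally show ?thesis by simp
  qed
  have "(\<lambda>j. I (1 / Suc j)) \<longlonglongrightarrow> (LBINT x:?D. 0)"
    unfolding I_def set_lebesgue_integral_def
  \<comment> \<open>The integrand increases with \<open>\<theta>\<close>, so its value at
    \<open>\<theta> = 1\<close> dominates those at all \<open>1 / Suc j\<close>.\<close>
  proof (rule integral_dominated_convergence[where w="\<lambda>x. indicator ?D x *\<^sub>R (1 - exp (- (1 * f x)))"])
    show "integrable lborel (\<lambda>x. indicator ?D x *\<^sub>R (1 - exp (- (1 * f x))))"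
      using int[of 1] by (simp add: set_integrable_def)
    show "AE x in lborel. (\<lambda>j. indicator ?D x *\<^sub>R (1 - exp (- (1 / real (Suc j) * f x)))) \<longlonglongrightarrow> indicator ?D x *\<^sub>R 0"
    proof (intro AE_I2)
      fix x
      have "(\<lambda>j. 1 / real (Suc j)) \<longlonglongrightarrow> 0" using LIMSEQ_inverse_real_of_nat by (simp add: inverse_eq_divide)
      hence "(\<lambda>j. indicator ?D x *\<^sub>R (1 - exp (- (1 / real (Suc j) * f x)))) \<longlonglongrightarrow> indicator ?D x *\<^sub>R (1 - exp (- (0 * f x)))"
        by (intro tendsto_intros)
      thus "(\<lambda>j. indicator ?D x *\<^sub>R (1 - exp (- (1 / real (Suc j) * f x)))) \<longlonglongrightarrow> indicator ?D x *\<^sub>R 0" by simp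
    qed
    show "AE x in lborel. norm (indicator ?D x *\<^sub>R (1 - exp (- (1 / real (Suc j) * f x)))) \<le> indicator ?D x *\<^sub>R (1 - exp (- (1 * f x)))" for j
    proof (intro AE_I2)
      fix x
      have "1 / real (Suc j) * f x \<le> 1 * f x" using f0[of x] by (intro mult_right_mono) auto
      moreover have "0 \<le> 1 / real (Suc j) * f x" using f0[of x] by simp
      ultimately show "norm (indicator ?D x *\<^sub>R (1 - exp (- (1 / real (Suc j) * f x)))) \<le> indicator ?D x *\<^sub>R (1 - exp (- (1 * f x)))"
        by (auto simp: indicator_def)
    qed
  qed auto
  hence "(\<lambda>j. exp (- lam * I (1 / Suc j))) \<longlonglongrightarrow> exp (- lam * 0)"
    by (intro tendsto_intros) (simp add: set_lebesgue_integral_def)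
  hence "exp (- lam * 0) \<le> prob {w\<in>space M. S w}"
    by (rule LIMSEQ_le_const2) (intro exI allI impI bound, simp)
  hence "prob {w\<in>space M. S w} = 1" by (simp add: antisym)
  hence "AE w in M. S w" by (subst (asm) prob_Collect_eq_1) auto
  thus ?thesis by (simp add: S_def f_def)
qed


lemma uniform_rv_in:
  assumes "uniform_rv M S Y" "w \<in> space M" shows "Y w \<in> S"
  using assms measurable_space[of Y M "count_space S" w] by (simp add: uniform_rv_def)

lemma uniform_rv_borel_measurable:
  fixes Y :: "'a \<Rightarrow> 'b::topological_space"
  assumes "uniform_rv M S Y" shows "random_variable borel Y"
proof -
  have "Y \<in> measurable M (count_space S)" using assms by (simp add: uniform_rv_def)
  moreover have "id \<in> measurable (count_space S) borel" by simp
  ultimately have "id \<circ> Y \<in> measurable M borel" by (rule measurable_comp)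
  thus ?thesis by simp
qed

lemma uniform_rv_expectation:
  fixes f :: "'b \<Rightarrow> real"
  assumes "uniform_rv M S Y" "finite S" "S \<noteq> {}"
  shows "expectation (\<lambda>w. f (Y w)) = (\<Sum>s\<in>S. f s) / real (card S)"
proof -
  have "expectation (\<lambda>w. f (Y w)) = (\<integral>x. f x \<partial>distr M (count_space S) Y)"
    using assms(1) by (subst integral_distr) (auto simp: uniform_rv_def)
  thus ?thesis using assms by (simp add: uniform_rv_def integral_uniform_count_measure)
qed

text \<open>The constraint \<open>z <= (cmod (h w))\<^sup>2 / T w\<close> is cleared of its
  quotient. After exchanging the integrals and freezing \<open>T\<close>, only the exponential tail
  of the squared modulus at level \<open>z * T w\<close> remains, which is
  \<open>exp (- (z * T w))\<close>.\<close>

lemma fading_mixture: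
  assumes h: "complex_gaussian M 1 h"
    and indep: "indep_var borel T borel (\<lambda>w. (cmod (h w))\<^sup>2)" and T: "AE w in M. 0 < T w"
    and c: "c = 1 \<or> c = 2"
  shows "(\<integral>\<^sup>+w. ennreal (1 - erfc (sqrt ((cmod (h w))\<^sup>2 / T w)) ^ c) \<partial>M) =
     (\<integral>\<^sup>+z. ennreal (real c / sqrt pi * (erfc (sqrt z * (if c = 2 then 1 else 0)) / sqrt z * exp (- z))) * indicator {0<..} z *
        (\<integral>\<^sup>+w. ennreal (exp (- (z * T w))) \<partial>M) \<partial>lborel)"
proof -
  let ?k = "\<lambda>z. ennreal (real c / sqrt pi * (erfc (sqrt z * (if c = 2 then 1 else 0)) / sqrt z * exp (- z)))"
  have [measurable]: "random_variable borel T" "random_variable borel h"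
    using indep complex_gaussian_measurable[OF h] by (auto dest: indep_var_rv1)
  interpret P: pair_sigma_finite M lborel
    by (intro pair_sigma_finite.intro sigma_finite_measure_axioms lborel.sigma_finite_measure_axioms)
  have "(\<integral>\<^sup>+w. ennreal (1 - erfc (sqrt ((cmod (h w))\<^sup>2 / T w)) ^ c) \<partial>M) =
        (\<integral>\<^sup>+w. (\<integral>\<^sup>+z. ?k z * indicator {0<..} z * indicator {z. z * T w \<le> (cmod (h w))\<^sup>2} z \<partial>lborel) \<partial>M)"
  proof (rule nn_integral_cong_AE, use T in eventually_elim)
    fix w assume pos: "0 < T w"
    hence g: "0 \<le> (cmod (h w))\<^sup>2 / T w" by simp
    have "ennreal (1 - erfc (sqrt ((cmod (h w))\<^sup>2 / T w)) ^ c) =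
       (\<integral>\<^sup>+z. ?k z * indicator {0<..(sqrt ((cmod (h w))\<^sup>2 / T w))\<^sup>2} z \<partial>lborel)"
      by (rule one_minus_erfc_power[OF c, symmetric]) (use g in simp)
    also have "\<dots> = (\<integral>\<^sup>+z. ?k z * indicator {0<..} z * indicator {z. z * T w \<le> (cmod (h w))\<^sup>2} z \<partial>lborel)"
      using pos g by (intro nn_integral_cong) (auto simp: indicator_def pos_le_divide_eq)
    finally show "ennreal (1 - erfc (sqrt ((cmod (h w))\<^sup>2 / T w)) ^ c) = \<dots>" .
  qed
  also have "\<dots> = (\<integral>\<^sup>+z. (\<integral>\<^sup>+w. ?k z * indicator {0<..} z * indicator {z. z * T w \<le> (cmod (h w))\<^sup>2} z \<partial>M) \<partial>lborel)"
    by (rule P.Fubini'[symmetric]) (simp add: indicator_def, measurable)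
  also have "\<dots> = (\<integral>\<^sup>+z. ?k z * indicator {0<..} z * (\<integral>\<^sup>+w. ennreal (exp (- (z * T w))) \<partial>M) \<partial>lborel)"
  proof (rule nn_integral_cong)
    fix z :: real
    show "(\<integral>\<^sup>+w. ?k z * indicator {0<..} z * indicator {z. z * T w \<le> (cmod (h w))\<^sup>2} z \<partial>M) =
       ?k z * indicator {0<..} z * (\<integral>\<^sup>+w. ennreal (exp (- (z * T w))) \<partial>M)"
    proof (cases "0 < z")
      case True
      have "(\<integral>\<^sup>+w. indicator {z. z * T w \<le> (cmod (h w))\<^sup>2} z \<partial>M) =
         (\<integral>\<^sup>+w. indicator {p. z * fst p \<le> snd p} (T w, (cmod (h w))\<^sup>2) \<partial>M)"
        by (intro nn_integral_cong) (auto simp: indicator_def)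
      also have "\<dots> = (\<integral>\<^sup>+w'. (\<integral>\<^sup>+w. indicator {p. z * fst p \<le> snd p} (T w', (cmod (h w))\<^sup>2) \<partial>M) \<partial>M)"
        by (rule indep_var_nn_integral[OF indep]) (simp add: indicator_def, measurable)
      also have "\<dots> = (\<integral>\<^sup>+w'. ennreal (exp (- (z * T w'))) \<partial>M)"
      proof (rule nn_integral_cong_AE, use T in eventually_elim)
        fix w' assume "0 < T w'"
        hence "0 \<le> z * T w'" using True by simp
        from complex_gaussian_cmod_ge[OF h this]
        have "emeasure M {w\<in>space M. z * T w' \<le> (cmod (h w))\<^sup>2} = ennreal (exp (- (z * T w')))"
          by (simp add: emeasure_eq_measure)
        moreover have "(\<integral>\<^sup>+w. indicator {p. z * fst p \<le> snd p} (T w', (cmod (h w))\<^sup>2) \<partial>M) =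
           (\<integral>\<^sup>+w. indicator {w\<in>space M. z * T w' \<le> (cmod (h w))\<^sup>2} w \<partial>M)"
          by (intro nn_integral_cong) (auto simp: indicator_def)
        ultimately show "(\<integral>\<^sup>+w. indicator {p. z * fst p \<le> snd p} (T w', (cmod (h w))\<^sup>2) \<partial>M) = ennreal (exp (- (z * T w')))"
          by simp
      qed
      finally have *: "(\<integral>\<^sup>+w. indicator {z. z * T w \<le> (cmod (h w))\<^sup>2} z \<partial>M) = (\<integral>\<^sup>+w'. ennreal (exp (- (z * T w'))) \<partial>M)" .
      have "(\<integral>\<^sup>+w. ?k z * indicator {0<..} z * indicator {z. z * T w \<le> (cmod (h w))\<^sup>2} z \<partial>M) =
         ?k z * indicator {0<..} z * (\<integral>\<^sup>+w. indicator {z. z * T w \<le> (cmod (h w))\<^sup>2} z \<partial>M)"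
        by (rule nn_integral_cmult) (simp add: indicator_def)
      thus ?thesis unfolding * .
    qed simp
  qed
  finally show ?thesis .
qed

text \<open>The symbols act as independent marks of the points. Averaging them for frozen positions
  replaces the factor of a point at \<open>x\<close> by its constellation mean
  \<open>1 - \<phi> x\<close>, and the Poisson functional applies to the resulting product. The
  exponent is linear in \<open>\<phi>\<close>, so it becomes the mean of the Kummer
  functions.\<close>

lemma interference_laplace:
  fixes X :: "nat \<Rightarrow> 'a \<Rightarrow> 'b::euclidean_space" and \<sigma> :: "nat \<Rightarrow> 'a \<Rightarrow> complex"
  assumes dim: "DIM('b) = 2" and X[measurable]: "\<And>k. random_variable borel (X k)"
    and inj: "AE w in M. inj (\<lambda>k. X k w)"
    and ppp: "poisson_point_process M lam {x. r0 < norm x} (\<lambda>w. range (\<lambda>k. X k w))"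
    and lam: "0 \<le> lam" and r0: "0 < r0" and eta: "2 < \<eta>"
    and \<sigma>: "\<And>k. uniform_rv M S (\<sigma> k)" "indep_vars (\<lambda>_. borel) \<sigma> UNIV" and S: "finite S" "S \<noteq> {}"
    and indep: "indep_var (\<Pi>\<^sub>M k\<in>UNIV. borel) (\<lambda>w k. complex_of_real (norm (X k w) powr (- \<eta>)))
                  (\<Pi>\<^sub>M k\<in>UNIV. borel) (\<lambda>w k. \<sigma> k w)"
    and a: "0 \<le> a"
  shows "AE w in M. summable (\<lambda>k. (cmod (\<sigma> k w))\<^sup>2 * norm (X k w) powr (- \<eta>))"
    and "expectation (\<lambda>w. exp (- (a * (\<Sum>k. (cmod (\<sigma> k w))\<^sup>2 * norm (X k w) powr (- \<eta>))))) =
      exp (- pi * lam * r0\<^sup>2 * ((\<Sum>s\<in>S. kummer_1F1 (- 2 / \<eta>) (1 - 2 / \<eta>) (- (a * (cmod s)\<^sup>2 * r0 powr (- \<eta>)))) / real (card S) - 1))"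
proof -
  let ?D = "{x :: 'b. r0 < norm x}"
  let ?P = "\<Pi>\<^sub>M k\<in>(UNIV :: nat set). (borel :: complex measure)"
  define f where "f x = norm x powr (- \<eta>)" for x :: 'b
  have [measurable]: "f \<in> borel_measurable borel" unfolding f_def by measurable
  have f0: "0 \<le> f x" for x by (simp add: f_def)
  have [measurable]: "random_variable borel (\<sigma> k)" for k by (rule uniform_rv_borel_measurable[OF \<sigma>(1)])
  define m where "m = Max ((\<lambda>s. (cmod s)\<^sup>2) ` S)"
  have m: "(cmod s)\<^sup>2 \<le> m" if "s \<in> S" for s unfolding m_def using S that by simp
  \<comment> \<open>The constellation is finite, so the squared moduli are bounded by
    \<open>m\<close> and summability reduces to that of the path losses.\<close>
  have sm: "AE w in M. summable (\<lambda>k. (cmod (\<sigma> k w))\<^sup>2 * f (X k w))"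
    using poisson_point_process_path_loss_summable[OF dim X inj ppp lam r0 eta] AE_space
  proof eventually_elim
    case (elim w)
    show ?case
    proof (rule summable_comparison_test')
      show "summable (\<lambda>k. m * f (X k w))" using elim(1) by (intro summable_mult) (simp add: f_def)
      show "norm ((cmod (\<sigma> k w))\<^sup>2 * f (X k w)) \<le> m * f (X k w)" for k
        using m[OF uniform_rv_in[OF \<sigma>(1)[of k] elim(2)]] f0 by (simp add: abs_mult mult_right_mono)
    qed
  qed
  thus "AE w in M. summable (\<lambda>k. (cmod (\<sigma> k w))\<^sup>2 * norm (X k w) powr (- \<eta>))" by (simp add: f_def)
  define \<phi> where "\<phi> x = (\<Sum>s\<in>S. 1 - exp (- (a * (cmod s)\<^sup>2 * f x))) / real (card S)" for x
  have [measurable]: "\<phi> \<in> borel_measurable borel" unfolding \<phi>_def by measurable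
  have cS: "0 < real (card S)" using S by (simp add: card_gt_0_iff)
  have as: "0 \<le> a * (cmod s)\<^sup>2" for s using a by simp
  have \<phi>0: "0 \<le> \<phi> x" for x
    unfolding \<phi>_def using as f0 by (intro divide_nonneg_nonneg sum_nonneg) (auto intro: mult_nonneg_nonneg)
  have \<phi>1: "\<phi> x \<le> 1" for x
  proof -
    have "(\<Sum>s\<in>S. 1 - exp (- (a * (cmod s)\<^sup>2 * f x))) \<le> (\<Sum>s\<in>S. 1)" by (intro sum_mono) simp
    thus ?thesis unfolding \<phi>_def using cS by simp
  qed
  have int: "set_integrable lborel ?D (\<lambda>x. 1 - exp (- (a * (cmod s)\<^sup>2 * f x)))"
    and LB: "(LBINT x:?D. 1 - exp (- (a * (cmod s)\<^sup>2 * f x))) = pi * r0\<^sup>2 * (kummer_1F1 (- 2 / \<eta>) (1 - 2 / \<eta>) (- (a * (cmod s)\<^sup>2 * r0 powr (- \<eta>))) - 1)" for s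
    using kummer_integral_plane[OF dim eta as r0] by (simp_all add: f_def)
  have ind\<phi>: "indicator ?D x *\<^sub>R \<phi> x = (\<Sum>s\<in>S. indicator ?D x *\<^sub>R (1 - exp (- (a * (cmod s)\<^sup>2 * f x)))) / real (card S)" for x
    unfolding \<phi>_def by (simp add: sum_distrib_left)
  have int\<phi>: "set_integrable lborel ?D \<phi>"
    unfolding set_integrable_def ind\<phi>
    by (intro integrable_divide Bochner_Integration.integrable_sum int[unfolded set_integrable_def])
  have LB\<phi>: "(LBINT x:?D. \<phi> x) = pi * r0\<^sup>2 * ((\<Sum>s\<in>S. kummer_1F1 (- 2 / \<eta>) (1 - 2 / \<eta>) (- (a * (cmod s)\<^sup>2 * r0 powr (- \<eta>)))) / real (card S) - 1)"
  proof -
    have "(LBINT x:?D. \<phi> x) = (\<Sum>s\<in>S. (LBINT x:?D. 1 - exp (- (a * (cmod s)\<^sup>2 * f x)))) / real (card S)"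
      unfolding set_lebesgue_integral_def ind\<phi> integral_divide_zero
      by (subst Bochner_Integration.integral_sum[OF int[unfolded set_integrable_def]]) (rule refl)
    also have "\<dots> = pi * r0\<^sup>2 * ((\<Sum>s\<in>S. kummer_1F1 (- 2 / \<eta>) (1 - 2 / \<eta>) (- (a * (cmod s)\<^sup>2 * r0 powr (- \<eta>)))) / real (card S) - 1)"
      unfolding LB using cS by (simp add: sum_distrib_left[symmetric] sum_subtractf field_simps)
    finally show ?thesis .
  qed
  have lim1: "(\<lambda>n. expectation (\<lambda>w. \<Prod>k<n. (1 - \<phi> (X k w)))) \<longlonglongrightarrow> exp (- lam * (LBINT x:?D. \<phi> x))"
    by (rule poisson_point_process_laplace[OF X inj ppp lam _ _ \<phi>0 \<phi>1 int\<phi>]) auto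
  have lim2: "(\<lambda>n. expectation (\<lambda>w. exp (- (a * (\<Sum>k<n. (cmod (\<sigma> k w))\<^sup>2 * f (X k w)))))) \<longlonglongrightarrow>
      expectation (\<lambda>w. exp (- (a * (\<Sum>k. (cmod (\<sigma> k w))\<^sup>2 * f (X k w)))))"
  proof (rule integral_dominated_convergence[where w="\<lambda>_. 1"])
    show "AE w in M. (\<lambda>n. exp (- (a * (\<Sum>k<n. (cmod (\<sigma> k w))\<^sup>2 * f (X k w))))) \<longlonglongrightarrow>
       exp (- (a * (\<Sum>k. (cmod (\<sigma> k w))\<^sup>2 * f (X k w))))"
      using sm by eventually_elim (intro tendsto_intros summable_LIMSEQ)
    show "AE w in M. norm (exp (- (a * (\<Sum>k<n. (cmod (\<sigma> k w))\<^sup>2 * f (X k w))))) \<le> 1" for n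
      using a f0 by (intro AE_I2) (auto intro!: mult_nonneg_nonneg sum_nonneg)
  qed auto
  have same: "expectation (\<lambda>w. exp (- (a * (\<Sum>k<n. (cmod (\<sigma> k w))\<^sup>2 * f (X k w))))) = expectation (\<lambda>w. \<Prod>k<n. (1 - \<phi> (X k w)))" for n
  proof -
    \<comment> \<open>The path losses enter as complex numbers and are read back by
      \<open>Re\<close>, so that positions and symbols live on the same sequence space.\<close>
    define F where "F p = exp (- (a * (\<Sum>k<n. (cmod (snd p k))\<^sup>2 * Re (fst p k))))" for p :: "(nat \<Rightarrow> complex) \<times> (nat \<Rightarrow> complex)"
    have [measurable]: "F \<in> borel_measurable (?P \<Otimes>\<^sub>M ?P)" unfolding F_def by measurable
    have sec: "(\<integral>\<^sup>+w. ennreal (F (\<lambda>k. complex_of_real (f (X k w')), \<lambda>k. \<sigma> k w)) \<partial>M) = ennreal (\<Prod>k<n. (1 - \<phi> (X k w')))" for w'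
    proof -
      let ?g = "\<lambda>k w. exp (- (a * (cmod (\<sigma> k w))\<^sup>2 * f (X k w')))"
      have gi: "integrable M (?g k)" for k
        using as f0 by (intro integrable_const_bound[where B=1]) (auto intro: mult_nonneg_nonneg)
      have Fe: "F (\<lambda>k. complex_of_real (f (X k w')), \<lambda>k. \<sigma> k w) = (\<Prod>k<n. ?g k w)" for w
        by (simp add: F_def exp_sum[symmetric] sum_negf sum_distrib_left mult.assoc)
      have iv: "indep_vars (\<lambda>_. borel) ?g {..<n}"
        by (rule indep_vars_compose2[OF indep_vars_subset[OF \<sigma>(2) subset_UNIV], where Y="\<lambda>k s. exp (- (a * (cmod s)\<^sup>2 * f (X k w')))"]) simp
      have "(\<integral>\<^sup>+w. ennreal (F (\<lambda>k. complex_of_real (f (X k w')), \<lambda>k. \<sigma> k w)) \<partial>M) = ennreal (expectation (\<lambda>w. \<Prod>k<n. ?g k w))"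
        unfolding Fe by (intro nn_integral_eq_integral indep_vars_integrable iv gi) (auto intro!: prod_nonneg)
      also have "expectation (\<lambda>w. \<Prod>k<n. ?g k w) = (\<Prod>k<n. expectation (?g k))"
        by (intro indep_vars_lebesgue_integral iv gi) auto
      also have "\<dots> = (\<Prod>k<n. (1 - \<phi> (X k w')))"
      proof (intro prod.cong refl)
        fix k
        have "expectation (?g k) = (\<Sum>s\<in>S. exp (- (a * (cmod s)\<^sup>2 * f (X k w')))) / real (card S)"
          by (rule uniform_rv_expectation[OF \<sigma>(1) S, where f="\<lambda>s. exp (- (a * (cmod s)\<^sup>2 * f (X k w')))"])
        also have "\<dots> = 1 - \<phi> (X k w')" unfolding \<phi>_def using cS by (simp add: sum_subtractf field_simps)
        finally show "expectation (?g k) = 1 - \<phi> (X k w')" .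
      qed
      finally show ?thesis .
    qed
    have "ennreal (expectation (\<lambda>w. exp (- (a * (\<Sum>k<n. (cmod (\<sigma> k w))\<^sup>2 * f (X k w)))))) =
       (\<integral>\<^sup>+w. ennreal (F (\<lambda>k. complex_of_real (f (X k w)), \<lambda>k. \<sigma> k w)) \<partial>M)"
      unfolding F_def using a f0
      by (subst nn_integral_eq_integral) (auto intro!: integrable_const_bound[where B=1] AE_I2 mult_nonneg_nonneg sum_nonneg)
    also have "\<dots> = (\<integral>\<^sup>+w'. (\<integral>\<^sup>+w. ennreal (F (\<lambda>k. complex_of_real (f (X k w')), \<lambda>k. \<sigma> k w)) \<partial>M) \<partial>M)"
      using indep_var_nn_integral[OF indep, of "\<lambda>p. ennreal (F p)"] by (simp add: f_def)
    also have "\<dots> = ennreal (expectation (\<lambda>w. \<Prod>k<n. (1 - \<phi> (X k w))))"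
      unfolding sec
    proof (rule nn_integral_eq_integral)
      have b: "0 \<le> (\<Prod>k<n. (1 - \<phi> (X k w)))" "(\<Prod>k<n. (1 - \<phi> (X k w))) \<le> 1" for w
        using \<phi>0 \<phi>1 by (auto intro!: prod_nonneg prod_le_1)
      show "integrable M (\<lambda>w. \<Prod>k<n. (1 - \<phi> (X k w)))"
        using b by (intro integrable_const_bound[where B=1]) auto
      show "AE w in M. 0 \<le> (\<Prod>k<n. (1 - \<phi> (X k w)))" using b by auto
    qed
    finally show ?thesis
      using \<phi>0 \<phi>1 by (subst (asm) ennreal_inj) (auto intro!: integral_nonneg_AE prod_nonneg)
  qed
  have "expectation (\<lambda>w. exp (- (a * (\<Sum>k. (cmod (\<sigma> k w))\<^sup>2 * f (X k w))))) = exp (- lam * (LBINT x:?D. \<phi> x))"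
    using lim2 lim1 unfolding same by (rule LIMSEQ_unique)
  thus "expectation (\<lambda>w. exp (- (a * (\<Sum>k. (cmod (\<sigma> k w))\<^sup>2 * norm (X k w) powr (- \<eta>))))) =
      exp (- pi * lam * r0\<^sup>2 * ((\<Sum>s\<in>S. kummer_1F1 (- 2 / \<eta>) (1 - 2 / \<eta>) (- (a * (cmod s)\<^sup>2 * r0 powr (- \<eta>)))) / real (card S) - 1))"
    unfolding LB\<phi> f_def by (simp add: mult_ac)
qed

end

section \<open>Square QAM constellations\<close>

text \<open>\<open>d\<close> is half the distance between neighbouring points; for the unit-power
  constellation \<open>d\<^sup>2\<close> is the constant \<open>3 / (2 * (M - 1))\<close> of the
  error formula.\<close>

definition qam_point :: "real \<Rightarrow> nat \<Rightarrow> nat \<Rightarrow> nat \<Rightarrow> complex" where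
  "qam_point d q a b = of_real d * Complex (2 * real a - real q - 1) (2 * real b - real q - 1)"

lemma qam_eq_image:
  "qam (q\<^sup>2) = (\<lambda>(a, b). qam_point (sqrt (3 / (2 * (real (q\<^sup>2) - 1)))) q a b) ` ({1..q} \<times> {1..q})"
proof -
  have [simp]: "sqrt (real (q\<^sup>2)) = real q" by simp
  show ?thesis unfolding qam_def qam_point_def by (auto simp: image_iff) blast+
qed

lemma inj_on_qam_point:
  assumes "d \<noteq> 0" shows "inj_on (\<lambda>(a, b). qam_point d q a b) A"
  using assms by (auto simp: inj_on_def qam_point_def complex_eq_iff)

lemma sum_qam:
  assumes q: "2 \<le> q"
  shows "(\<Sum>s\<in>qam (q\<^sup>2). f s) = (\<Sum>a=1..q. \<Sum>b=1..q. f (qam_point (sqrt (3 / (2 * (real (q\<^sup>2) - 1)))) q a b))"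
proof -
  have "(2::nat)\<^sup>2 \<le> q\<^sup>2" using q by (rule power_mono) simp
  hence "1 < q\<^sup>2" by simp
  hence "1 < real (q\<^sup>2)" by linarith
  hence "sqrt (3 / (2 * (real (q\<^sup>2) - 1))) \<noteq> 0" by simp
  from inj_on_qam_point[OF this] show ?thesis
    unfolding qam_eq_image by (subst sum.reindex) (auto simp: sum.cartesian_product case_prod_unfold)
qed

lemma finite_qam: "finite (qam (q\<^sup>2))"
  unfolding qam_eq_image by simp

lemma card_qam: "2 \<le> q \<Longrightarrow> card (qam (q\<^sup>2)) = q\<^sup>2"
  using sum_qam[of q "\<lambda>_. 1 :: nat"] by (simp add: power2_eq_square)

text \<open>The elements are error vectors relative to \<open>qam_point d q a b\<close>, not received points.\<close>

definition decision_region :: "real \<Rightarrow> nat \<Rightarrow> nat \<Rightarrow> nat \<Rightarrow> complex set" where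
  "decision_region d q a b = {t. ((1 < a \<longrightarrow> - d < Re t) \<and> (a < q \<longrightarrow> Re t < d)) \<and>
                                 ((1 < b \<longrightarrow> - d < Im t) \<and> (b < q \<longrightarrow> Im t < d))}"

text \<open>The difference of the squares is \<open>4 * d * i * (x + d * i)\<close>. As
  \<open>i\<close> is a nonzero integer, \<open>d * i\<close> has modulus at least \<open>d\<close>,
  so a one-sided bound on \<open>x\<close> suffices: a lower one for positive \<open>i\<close>, an
  upper one for negative \<open>i\<close>.\<close>

lemma shift_square_less:
  fixes x d :: real and i :: int
  assumes d: "0 < d" and i: "0 < i \<Longrightarrow> - d < x" "i < 0 \<Longrightarrow> x < d" "i \<noteq> 0"
  shows "x\<^sup>2 < (x + 2 * d * i)\<^sup>2"
proof -
  have "0 < i * (x + d * i)"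
  proof (cases "0 < i")
    case True
    hence "d * 1 \<le> d * of_int i" using d by (intro mult_left_mono) auto
    thus ?thesis using True i(1) by (intro mult_pos_pos) auto
  next
    case False
    hence "i < 0" using i(3) by simp
    hence "d * of_int i \<le> d * (- 1)" using d by (intro mult_left_mono) auto
    thus ?thesis using \<open>i < 0\<close> i(2) by (intro mult_neg_neg) auto
  qed
  hence "0 < 4 * d * (i * (x + d * i))" using d by simp
  thus ?thesis by (simp add: power2_eq_square algebra_simps)
qed

text \<open>The squared distance splits into the two coordinates; neither part can decrease when
  moving to another grid point, and at least one strictly increases.\<close>

lemma decision_region_nearest:
  assumes d: "0 < d" and ab: "a \<in> {1..q}" "b \<in> {1..q}" "a' \<in> {1..q}" "b' \<in> {1..q}"
    and t: "t \<in> decision_region d q a b" and ne: "qam_point d q a' b' \<noteq> qam_point d q a b"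
  shows "cmod t < cmod (qam_point d q a b + t - qam_point d q a' b')"
proof -
  let ?z = "qam_point d q a b + t - qam_point d q a' b'"
  define i j where "i = int a - int a'" and "j = int b - int b'"
  have z: "Re ?z = Re t + 2 * d * i" "Im ?z = Im t + 2 * d * j"
    by (simp_all add: qam_point_def i_def j_def algebra_simps)
  have R: "(Re t)\<^sup>2 < (Re ?z)\<^sup>2" if "i \<noteq> 0"
    unfolding z by (rule shift_square_less[OF d _ _ that]) (use t ab in \<open>auto simp: decision_region_def i_def\<close>)
  have I: "(Im t)\<^sup>2 < (Im ?z)\<^sup>2" if "j \<noteq> 0"
    unfolding z by (rule shift_square_less[OF d _ _ that]) (use t ab in \<open>auto simp: decision_region_def j_def\<close>)
  have ij: "i \<noteq> 0 \<or> j \<noteq> 0" using ne unfolding i_def j_def by auto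
  have "(cmod t)\<^sup>2 < (cmod ?z)\<^sup>2"
    unfolding cmod_power2
    using R I ij z by (cases "i = 0"; cases "j = 0") (auto intro: add_strict_mono)
  thus ?thesis by (rule power2_less_imp_less) simp
qed

text \<open>Comparing with the at most four horizontal and vertical neighbours already yields the
  region, up to weak inequalities; \<open>nb\<close> makes them strict.\<close>

lemma nearest_decision_region:
  assumes d: "0 < d" and ab: "a \<in> {1..q}" "b \<in> {1..q}"
    and near: "\<And>a' b'. a' \<in> {1..q} \<Longrightarrow> b' \<in> {1..q} \<Longrightarrow> cmod t \<le> cmod (qam_point d q a b + t - qam_point d q a' b')"
    and nb: "Re t \<notin> {d, - d}" "Im t \<notin> {d, - d}"
  shows "t \<in> decision_region d q a b"
proof -
  have sq: "(Re t)\<^sup>2 + (Im t)\<^sup>2 \<le> (Re t + 2 * d * (real a - real a'))\<^sup>2 + (Im t + 2 * d * (real b - real b'))\<^sup>2"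
    if "a' \<in> {1..q}" "b' \<in> {1..q}" for a' b'
  proof -
    have "(cmod t)\<^sup>2 \<le> (cmod (qam_point d q a b + t - qam_point d q a' b'))\<^sup>2"
      by (rule power_mono[OF near[OF that]]) simp
    thus ?thesis unfolding cmod_power2 by (simp add: qam_point_def algebra_simps)
  qed
  have down: "- d \<le> x" if "x\<^sup>2 \<le> (x + 2 * d)\<^sup>2" for x
  proof -
    have "0 \<le> 4 * d * (x + d)" using that by (simp add: power2_eq_square algebra_simps)
    thus ?thesis using d by (simp add: zero_le_mult_iff)
  qed
  have up: "x \<le> d" if "x\<^sup>2 \<le> (x - 2 * d)\<^sup>2" for x
    using down[of "- x"] that by (simp add: power2_eq_square algebra_simps)
  have "- d \<le> Re t" if "1 < a"
  proof -
    have "a - 1 \<in> {1..q}" using ab that by auto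
    from sq[OF this ab(2)] show ?thesis using that by (intro down) (simp add: of_nat_diff)
  qed
  moreover have "Re t \<le> d" if "a < q"
    using sq[of "a + 1" b] ab that by (intro up) simp
  moreover have "- d \<le> Im t" if "1 < b"
  proof -
    have "b - 1 \<in> {1..q}" using ab that by auto
    from sq[OF ab(1) this] show ?thesis using that by (intro down) (simp add: of_nat_diff)
  qed
  moreover have "Im t \<le> d" if "b < q"
    using sq[of a "b + 1"] ab that by (intro up) simp
  ultimately show ?thesis using nb unfolding decision_region_def by force
qed

text \<open>Of the \<open>q\<close> positions along one axis, \<open>q - 1\<close> have a lower and
  \<open>q - 1\<close> an upper neighbour, and only a side with a neighbour costs
  \<open>e / 2\<close>.\<close>

lemma sum_boundary_sides:
  assumes q: "2 \<le> q"
  shows "(\<Sum>a=1..q. 1 - (of_bool (1 < a) + of_bool (a < q)) / 2 * e) = real q - (real q - 1) * e"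
proof -
  have "(\<Sum>a=1..q. of_bool (1 < a) :: real) = real q - 1"
  proof -
    have "(\<Sum>a=1..q. of_bool (1 < a) :: real) = (\<Sum>a\<in>{2..q}. 1)"
      by (rule sum.mono_neutral_cong_right) auto
    thus ?thesis using q by (simp add: of_nat_diff)
  qed
  moreover have "(\<Sum>a=1..q. of_bool (a < q) :: real) = real q - 1"
  proof -
    have "(\<Sum>a=1..q. of_bool (a < q) :: real) = (\<Sum>a\<in>{1..<q}. 1)"
      by (rule sum.mono_neutral_cong_right) auto
    thus ?thesis using q by (simp add: of_nat_diff)
  qed
  moreover have "(\<Sum>a=1..q. 1 - (of_bool (1 < a) + of_bool (a < q)) / 2 * e) =
     real q - ((\<Sum>a=1..q. of_bool (1 < a) :: real) + (\<Sum>a=1..q. of_bool (a < q) :: real)) / 2 * e"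
    by (simp add: sum_subtractf sum.distrib sum_divide_distrib[symmetric] sum_distrib_right[symmetric])
  ultimately show ?thesis by simp
qed

section \<open>The downlink model\<close>

locale qam_downlink = prob_space M for M :: "'a measure" +
  fixes lam P N0 r0 \<eta> :: real and q :: nat
    and s0 h0 n :: "'a \<Rightarrow> complex" and \<sigma> h :: "nat \<Rightarrow> 'a \<Rightarrow> complex"
    and X :: "nat \<Rightarrow> 'a \<Rightarrow> real ^ 2"
  assumes lam: "0 < lam" and P: "0 < P" and N0: "0 < N0" and r0: "0 < r0" and eta: "2 < \<eta>" and q: "2 \<le> q"
    and s0: "uniform_rv M (qam (q\<^sup>2)) s0" and \<sigma>: "\<And>k. uniform_rv M (qam (q\<^sup>2)) (\<sigma> k)"
    and h0: "complex_gaussian M 1 h0" and h: "\<And>k. complex_gaussian M 1 (h k)" and n: "complex_gaussian M N0 n"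
    and X: "\<And>k. random_variable borel (X k)" and inj: "AE w in M. inj (\<lambda>k. X k w)"
    and ppp: "poisson_point_process M lam {x. norm x > r0} (\<lambda>w. range (\<lambda>k. X k w))"
    and indep: "mutually_independent M s0 \<sigma> h0 h n X"
begin

definition comp_events :: "component \<Rightarrow> 'a set set" where
  "comp_events c = (case c of
          Useful_Symbol \<Rightarrow> sets (vimage_algebra (space M) s0 borel)
        | Symbol k \<Rightarrow> sets (vimage_algebra (space M) (\<sigma> k) borel)
        | Useful_Fading \<Rightarrow> sets (vimage_algebra (space M) h0 borel)
        | Fading k \<Rightarrow> sets (vimage_algebra (space M) (h k) borel)
        | Noise \<Rightarrow> sets (vimage_algebra (space M) n borel)
        | Points \<Rightarrow> sets (vimage_algebra (space M) (\<lambda>w k. X k w) (\<Pi>\<^sub>M k\<in>UNIV. borel)))"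

definition comp_sigma :: "component set \<Rightarrow> 'a measure" where
  "comp_sigma I = sigma (space M) (\<Union>c\<in>I. comp_events c)"

lemma indep_comp_events: "indep_sets comp_events UNIV"
  using indep by (simp add: mutually_independent_def comp_events_def[abs_def])

lemma Int_stable_comp_events: "Int_stable (comp_events c)"
  by (auto simp: comp_events_def Int_stable_def split: component.split)

lemma space_comp_sigma [simp]: "space (comp_sigma I) = space M"
  by (simp add: comp_sigma_def space_measure_of_conv)

lemma comp_sigmaI:
  assumes "A \<in> comp_events c" "c \<in> I" shows "A \<in> sets (comp_sigma I)"
proof -
  have "comp_events c \<subseteq> Pow (space M)" for c
    using indep_comp_events sets.space_closed by (auto simp: indep_sets_def)
  thus ?thesis unfolding comp_sigma_def using assms by (subst sets_measure_of) auto
qed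

lemma measurable_comp_sigma:
  assumes "sets (vimage_algebra (space M) Y N) = comp_events c" "c \<in> I" "Y \<in> space M \<rightarrow> space N"
  shows "Y \<in> measurable (comp_sigma I) N"
proof (rule measurableI)
  fix A assume "A \<in> sets N"
  hence "Y -` A \<inter> space M \<in> comp_events c" unfolding assms(1)[symmetric] by (rule in_vimage_algebra)
  thus "Y -` A \<inter> space (comp_sigma I) \<in> sets (comp_sigma I)" using comp_sigmaI assms(2) by simp
qed (use assms(3) in auto)

lemma comp_measurable:
  "Useful_Symbol \<in> I \<Longrightarrow> s0 \<in> measurable (comp_sigma I) borel"
  "Symbol k \<in> I \<Longrightarrow> \<sigma> k \<in> measurable (comp_sigma I) borel"
  "Useful_Fading \<in> I \<Longrightarrow> h0 \<in> measurable (comp_sigma I) borel"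
  "Fading k \<in> I \<Longrightarrow> h k \<in> measurable (comp_sigma I) borel"
  "Noise \<in> I \<Longrightarrow> n \<in> measurable (comp_sigma I) borel"
  by (rule measurable_comp_sigma; auto simp: comp_events_def)+

lemma comp_measurable_points:
  assumes "Points \<in> I" shows "X k \<in> measurable (comp_sigma I) borel"
proof -
  have "(\<lambda>w k. X k w) \<in> measurable (comp_sigma I) (\<Pi>\<^sub>M k\<in>UNIV. borel)"
    by (rule measurable_comp_sigma[OF _ assms]) (auto simp: comp_events_def space_PiM)
  from measurable_compose[OF this measurable_component_singleton[of k]] show ?thesis by simp
qed

lemma indep_var_comp:
  assumes "I \<inter> J = {}" "f \<in> measurable (comp_sigma I) S" "g \<in> measurable (comp_sigma J) T"
  shows "indep_var S f T g"
  using indep_var_grouped[OF indep_comp_events Int_stable_comp_events assms(1)] assms(2,3)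
  by (simp add: comp_sigma_def)

lemma indep_vars_comp:
  assumes "disjoint_family_on I J" "\<And>j. j \<in> J \<Longrightarrow> f j \<in> measurable (comp_sigma (I j)) (N j)"
  shows "indep_vars N f J"
  using assms by (intro indep_vars_grouped[OF indep_comp_events Int_stable_comp_events assms(1)]) (simp add: comp_sigma_def)

lemma measurable_sequence:
  assumes "\<And>k :: nat. Y k \<in> measurable N borel" shows "(\<lambda>w k. Y k w) \<in> measurable N (\<Pi>\<^sub>M k\<in>UNIV. borel)"
  using assms by (intro measurable_PiM_single') auto

lemma random_variables [measurable]:
  "random_variable borel s0" "random_variable borel (\<sigma> k)" "random_variable borel h0"
  "random_variable borel (h k)" "random_variable borel n" "random_variable borel (X k)"
  using uniform_rv_borel_measurable[OF s0] uniform_rv_borel_measurable[OF \<sigma>] X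
    complex_gaussian_measurable[OF h0] complex_gaussian_measurable[OF h] complex_gaussian_measurable[OF n] by auto

definition beta :: real where "beta = 3 / (2 * (real (q\<^sup>2) - 1))"
definition \<rho> :: real where "\<rho> = sqrt P * r0 powr (- \<eta> / 2)"

text \<open>\<open>interference\<close> is the conditional variance of the interference divided by \<open>P\<close>,
  \<open>T = |h0|\<^sup>2 / (beta * SINR)\<close>, and \<open>t\<close> is the equalised error \<open>y0 / (\<rho> * h0) - s0\<close>
  written as a single series.\<close>

definition interference :: "'a \<Rightarrow> real" where
  "interference w = (\<Sum>k. (cmod (\<sigma> k w))\<^sup>2 * norm (X k w) powr (- \<eta>))"
definition T :: "'a \<Rightarrow> real" where
  "T w = (N0 + P * interference w) / (beta * \<rho>\<^sup>2)"
definition U :: "nat \<Rightarrow> 'a \<Rightarrow> complex" where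
  "U k w = (case k of 0 \<Rightarrow> 1 | Suc k \<Rightarrow> of_real (sqrt P) * \<sigma> k w * of_real (norm (X k w) powr (- \<eta> / 2))) / (of_real \<rho> * h0 w)"
definition H :: "nat \<Rightarrow> 'a \<Rightarrow> complex" where
  "H k w = (case k of 0 \<Rightarrow> n w | Suc k \<Rightarrow> h k w)"
definition t :: "'a \<Rightarrow> complex" where
  "t w = (\<Sum>k. U k w * H k w)"
text \<open>This is \<open>erfc\<close> of the square root of \<open>beta * SINR\<close>. Almost
  surely, given everything except the Gaussians \<open>H\<close>, each bounding side of a decision
  cell is crossed with probability \<open>e / 2\<close>.\<close>

definition e :: "'a \<Rightarrow> real" where
  "e w = erfc (sqrt ((cmod (h0 w))\<^sup>2 / T w))"

lemma q2: "1 < real (q\<^sup>2)"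
proof -
  have "(2::nat)\<^sup>2 \<le> q\<^sup>2" using q by (rule power_mono) simp
  hence "1 < q\<^sup>2" by simp
  thus ?thesis by linarith
qed

lemma beta_pos: "0 < beta"
  unfolding beta_def using q2 by (intro divide_pos_pos) auto

lemma rho_pos: "0 < \<rho>"
  using P r0 by (simp add: \<rho>_def)

lemma rho_square: "\<rho>\<^sup>2 = P * r0 powr (- \<eta>)"
  using P r0 by (simp add: \<rho>_def power_mult_distrib powr_power)

lemma measurable_U_H_T [measurable]:
  "random_variable borel (U k)" "random_variable borel (H k)" "random_variable borel interference"
  "random_variable borel T" "random_variable borel t" "random_variable borel e"
proof -
  show U: "random_variable borel (U k)" for k unfolding U_def by (cases k) simp_all
  show H: "random_variable borel (H k)" for k unfolding H_def by (cases k) simp_all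
  show i[measurable]: "random_variable borel interference" unfolding interference_def by measurable
  show [measurable]: "random_variable borel T" unfolding T_def by measurable
  show "random_variable borel t" unfolding t_def using U H by measurable
  show "random_variable borel e" unfolding e_def by measurable
qed

lemma h0_nonzero: "AE w in M. h0 w \<noteq> 0"
proof -
  have "prob {w\<in>space M. Re (h0 w) = 0} = 0"
    using normal_tail_erfc(3)[of 1 "\<lambda>w. Re (h0 w)" 0] h0 by (simp add: complex_gaussian_def)
  hence "AE w in M. Re (h0 w) \<noteq> 0"
    by (simp add: AE_iff_measurable[OF _ refl] emeasure_eq_measure)
  thus ?thesis by eventually_elim auto
qed

lemma indep_\<sigma>: "indep_vars (\<lambda>_. borel) \<sigma> UNIV"
  by (rule indep_vars_comp[where I="\<lambda>k. {Symbol k}"]) (auto simp: disjoint_family_on_def comp_measurable)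

lemma indep_points_\<sigma>:
  "indep_var (\<Pi>\<^sub>M k\<in>UNIV. borel) (\<lambda>w k. complex_of_real (norm (X k w) powr (- \<eta>))) (\<Pi>\<^sub>M k\<in>UNIV. borel) (\<lambda>w k. \<sigma> k w)"
proof (rule indep_var_comp[where I="{Points}" and J="range Symbol"])
  have [measurable]: "X k \<in> measurable (comp_sigma {Points}) borel" for k by (rule comp_measurable_points) simp
  show "(\<lambda>w k. complex_of_real (norm (X k w) powr (- \<eta>))) \<in> measurable (comp_sigma {Points}) (\<Pi>\<^sub>M k\<in>UNIV. borel)"
    by (rule measurable_sequence) measurable
  show "(\<lambda>w k. \<sigma> k w) \<in> measurable (comp_sigma (range Symbol)) (\<Pi>\<^sub>M k\<in>UNIV. borel)"
    by (rule measurable_sequence) (simp add: comp_measurable)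
qed auto

lemmas laplace = interference_laplace[OF _ X inj ppp less_imp_le[OF lam] r0 eta \<sigma> indep_\<sigma> finite_qam _ indep_points_\<sigma>]

lemma qam_nonempty: "qam (q\<^sup>2) \<noteq> {}"
  using card_qam[OF q] q by auto

lemma interference_summable: "AE w in M. summable (\<lambda>k. (cmod (\<sigma> k w))\<^sup>2 * norm (X k w) powr (- \<eta>))"
  by (rule laplace(1)[OF _ qam_nonempty order_refl]) simp

lemma interference_nonneg:
  "summable (\<lambda>k. (cmod (\<sigma> k w))\<^sup>2 * norm (X k w) powr (- \<eta>)) \<Longrightarrow> 0 \<le> interference w"
  unfolding interference_def by (rule suminf_nonneg) auto

lemma T_pos: "AE w in M. 0 < T w"
  using interference_summable
proof eventually_elim
  case (elim w)
  have "0 < N0 + P * interference w" using N0 P interference_nonneg[OF elim] by (intro add_pos_nonneg mult_nonneg_nonneg) auto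
  thus ?case unfolding T_def using beta_pos rho_pos by simp
qed

section \<open>Averages over fading, interfering symbols and positions\<close>

lemma expectation_exp_T:
  assumes z: "0 < z"
  shows "exp (- z) * expectation (\<lambda>w. exp (- (z * T w))) =
    exp (- z * (1 + N0 * r0 powr \<eta> / (P * beta)) - pi * lam * r0\<^sup>2 *
      (1 / real (q\<^sup>2) * (\<Sum>s\<in>qam (q\<^sup>2). kummer_1F1 (- 2 / \<eta>) (1 - 2 / \<eta>) (- (z * (cmod s)\<^sup>2 / beta))) - 1))"
proof -
  \<comment> \<open>Chosen so that \<open>z * T w\<close> is a constant noise part plus
    \<open>a * interference w\<close>. The power \<open>P\<close> cancels here, and in the Kummer
    argument \<open>r0 powr \<eta>\<close> cancels \<open>r0 powr (- \<eta>)\<close>.\<close>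
  define a where "a = z * r0 powr \<eta> / beta"
  have a: "0 \<le> a" using z beta_pos by (simp add: a_def)
  have rr: "r0 powr \<eta> * r0 powr (- \<eta>) = 1" using r0 by (simp add: powr_minus)
  have as: "a * (cmod s)\<^sup>2 * r0 powr (- \<eta>) = z * (cmod s)\<^sup>2 / beta" for s
    using rr by (simp add: a_def field_simps)
  have zT: "z * T w = z * N0 * r0 powr \<eta> / (P * beta) + a * interference w" for w
  proof -
    have "T w = (N0 + P * interference w) / (beta * (P * r0 powr (- \<eta>)))" by (simp add: T_def rho_square)
    also have "r0 powr (- \<eta>) = 1 / r0 powr \<eta>" by (simp add: powr_minus divide_inverse)
    finally show ?thesis using P beta_pos by (simp add: a_def field_simps)
  qed
  have "expectation (\<lambda>w. exp (- (z * T w))) = expectation (\<lambda>w. exp (- (z * N0 * r0 powr \<eta> / (P * beta))) * exp (- (a * interference w)))"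
    unfolding zT by (simp add: exp_add[symmetric])
  also have "\<dots> = exp (- (z * N0 * r0 powr \<eta> / (P * beta))) * expectation (\<lambda>w. exp (- (a * interference w)))"
    by simp
  also have "expectation (\<lambda>w. exp (- (a * interference w))) =
      exp (- pi * lam * r0\<^sup>2 * ((\<Sum>s\<in>qam (q\<^sup>2). kummer_1F1 (- 2 / \<eta>) (1 - 2 / \<eta>) (- (a * (cmod s)\<^sup>2 * r0 powr (- \<eta>)))) / real (card (qam (q\<^sup>2))) - 1))"
    unfolding interference_def by (rule laplace(2)[OF _ qam_nonempty a]) simp
  finally show ?thesis
    unfolding as card_qam[OF q] by (simp add: exp_add[symmetric] algebra_simps)
qed

text \<open>\<open>T\<close> is built from positions and interfering symbols only, the useful gain
  having been factored out of the SINR.\<close>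

lemma indep_T_h0: "indep_var borel T borel (\<lambda>w. (cmod (h0 w))\<^sup>2)"
proof (rule indep_var_comp[where I="insert Points (range Symbol)" and J="{Useful_Fading}"])
  have [measurable]: "X k \<in> measurable (comp_sigma (insert Points (range Symbol))) borel"
    "\<sigma> k \<in> measurable (comp_sigma (insert Points (range Symbol))) borel" for k
    by (auto intro: comp_measurable comp_measurable_points)
  show "T \<in> measurable (comp_sigma (insert Points (range Symbol))) borel"
    unfolding T_def interference_def by measurable
  have [measurable]: "h0 \<in> measurable (comp_sigma {Useful_Fading}) borel" by (rule comp_measurable) simp
  show "(\<lambda>w. (cmod (h0 w))\<^sup>2) \<in> measurable (comp_sigma {Useful_Fading}) borel" by measurable
qed auto

lemma e_bounds: "0 \<le> e w" "AE w in M. e w \<le> 1"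
proof -
  show "0 \<le> e w" by (simp add: e_def erfc_nonneg)
  show "AE w in M. e w \<le> 1"
    using T_pos by eventually_elim (auto simp: e_def erfc_0[symmetric] intro!: erfc_antimono)
qed

lemma integrable_e_power: "integrable M (\<lambda>w. e w ^ k)"
proof (rule integrable_const_bound[where B=1])
  show "AE w in M. norm (e w ^ k) \<le> 1"
    using e_bounds(2) by eventually_elim (use e_bounds(1) in \<open>simp add: power_le_one\<close>)
qed simp

text \<open>The computation runs in nonnegative integrals, where the order of integration is free.
  Since the expectation on the left is finite, the result can be read as a Bochner integral, whose
  integrability is thereby obtained rather than checked by estimates.\<close>

lemma expectation_e_power:
  assumes c: "c = 1 \<or> c = 2"
  shows "expectation (\<lambda>w. e w ^ c) = 1 - real c / sqrt pi *
      (LBINT z:{0<..}. erfc (sqrt z * (if c = 2 then 1 else 0)) / sqrt z *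
         exp (- z * (1 + N0 * r0 powr \<eta> / (P * beta)) - pi * lam * r0\<^sup>2 *
      (1 / real (q\<^sup>2) * (\<Sum>s\<in>qam (q\<^sup>2). kummer_1F1 (- 2 / \<eta>) (1 - 2 / \<eta>) (- (z * (cmod s)\<^sup>2 / beta))) - 1)))"
proof -
  define k where "k z = erfc (sqrt z * (if c = 2 then 1 else 0)) / sqrt z" for z
  define L where "L z = expectation (\<lambda>w. exp (- (z * T w)))" for z
  define F where "F z = exp (- z * (1 + N0 * r0 powr \<eta> / (P * beta)) - pi * lam * r0\<^sup>2 *
      (1 / real (q\<^sup>2) * (\<Sum>s\<in>qam (q\<^sup>2). kummer_1F1 (- 2 / \<eta>) (1 - 2 / \<eta>) (- (z * (cmod s)\<^sup>2 / beta))) - 1))" for z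
  have F: "F z = exp (- z) * L z" if "0 < z" for z
    using expectation_exp_T[OF that] by (simp add: F_def L_def)
  have [measurable]: "k \<in> borel_measurable borel" unfolding k_def by measurable
  have [measurable]: "L \<in> borel_measurable borel" unfolding L_def by measurable
  have L: "(\<integral>\<^sup>+w. ennreal (exp (- (z * T w))) \<partial>M) = ennreal (L z)" "0 \<le> L z" if "0 < z" for z
  proof -
    have "AE w in M. norm (exp (- (z * T w))) \<le> 1" using T_pos by eventually_elim (use that in simp)
    hence "integrable M (\<lambda>w. exp (- (z * T w)))" by (intro integrable_const_bound[where B=1]) auto
    thus "(\<integral>\<^sup>+w. ennreal (exp (- (z * T w))) \<partial>M) = ennreal (L z)"
      unfolding L_def by (rule nn_integral_eq_integral) simp
    show "0 \<le> L z" unfolding L_def by simp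
  qed
  have k0: "0 \<le> k z" if "0 < z" for z using that by (simp add: k_def erfc_nonneg)
  have e1: "AE w in M. 0 \<le> 1 - e w ^ c"
    using e_bounds(2) by eventually_elim (use e_bounds(1) in \<open>simp add: power_le_one\<close>)
  have int1: "integrable M (\<lambda>w. 1 - e w ^ c)" using integrable_e_power by simp
  have "ennreal (expectation (\<lambda>w. 1 - e w ^ c)) = (\<integral>\<^sup>+w. ennreal (1 - e w ^ c) \<partial>M)"
    by (rule nn_integral_eq_integral[OF int1 e1, symmetric])
  also have "\<dots> = (\<integral>\<^sup>+z. ennreal (real c / sqrt pi * (k z * exp (- z))) * indicator {0<..} z * (\<integral>\<^sup>+w. ennreal (exp (- (z * T w))) \<partial>M) \<partial>lborel)"
    unfolding e_def k_def by (rule fading_mixture[OF h0 indep_T_h0 T_pos c])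
  also have "\<dots> = (\<integral>\<^sup>+z. ennreal (indicator {0<..} z * (real c / sqrt pi * (k z * (exp (- z) * L z)))) \<partial>lborel)"
    using L k0 by (intro nn_integral_cong) (auto simp: indicator_def ennreal_mult'[symmetric] mult_ac)
  finally have nn: "(\<integral>\<^sup>+z. ennreal (indicator {0<..} z * (real c / sqrt pi * (k z * (exp (- z) * L z)))) \<partial>lborel) =
     ennreal (expectation (\<lambda>w. 1 - e w ^ c))" by simp
  have pos: "0 \<le> expectation (\<lambda>w. 1 - e w ^ c)"
    by (rule integral_nonneg_AE[OF e1])
  have "has_bochner_integral lborel (\<lambda>z. indicator {0<..} z * (real c / sqrt pi * (k z * (exp (- z) * L z)))) (expectation (\<lambda>w. 1 - e w ^ c))"
  proof (rule has_bochner_integral_nn_integral[OF _ _ pos nn])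
    show "AE z in lborel. 0 \<le> indicator {0<..} z * (real c / sqrt pi * (k z * (exp (- z) * L z)))"
      using L(2) k0 by (intro AE_I2) (auto simp: indicator_def)
  qed measurable
  hence "expectation (\<lambda>w. 1 - e w ^ c) = (LBINT z. indicator {0<..} z * (real c / sqrt pi * (k z * (exp (- z) * L z))))"
    by (simp add: has_bochner_integral_iff)
  also have "\<dots> = (LBINT z. real c / sqrt pi * (indicator {0<..} z *\<^sub>R (k z * F z)))"
    by (intro Bochner_Integration.integral_cong refl) (auto simp: indicator_def F)
  also have "\<dots> = real c / sqrt pi * (LBINT z:{0<..}. k z * F z)"
    unfolding set_lebesgue_integral_def by (rule integral_mult_right_zero)
  finally have "expectation (\<lambda>w. 1 - e w ^ c) = real c / sqrt pi * (LBINT z:{0<..}. k z * F z)" .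
  moreover have "expectation (\<lambda>w. 1 - e w ^ c) = 1 - expectation (\<lambda>w. e w ^ c)"
    using integrable_e_power by (simp add: prob_space)
  ultimately show ?thesis unfolding k_def F_def by simp
qed


section \<open>The equalised error as a Gaussian series\<close>

definition H_var :: "nat \<Rightarrow> real" where "H_var k = (if k = 0 then N0 else 1)"

lemma H_var_pos: "0 < H_var k"
  using N0 by (simp add: H_var_def)

lemma H_gaussian: "complex_gaussian M (H_var k) (H k)"
  using n h by (cases k) (simp_all add: H_var_def H_def[abs_def])

lemma indep_H: "indep_vars (\<lambda>_. borel) H UNIV"
proof (rule indep_vars_comp[where I="\<lambda>k. {case k of 0 \<Rightarrow> Noise | Suc k \<Rightarrow> Fading k}"])
  show "disjoint_family_on (\<lambda>k. {case k of 0 \<Rightarrow> Noise | Suc k \<Rightarrow> Fading k}) UNIV"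
    by (auto simp: disjoint_family_on_def split: nat.splits)
  show "H k \<in> measurable (comp_sigma {case k of 0 \<Rightarrow> Noise | Suc k \<Rightarrow> Fading k}) borel" for k
    by (cases k) (auto simp: H_def[abs_def] intro: comp_measurable)
qed

lemma U_comp_measurable:
  assumes "insert Points (insert Useful_Fading (range Symbol)) \<subseteq> I"
  shows "U k \<in> measurable (comp_sigma I) borel"
proof (cases k)
  case [measurable]: 0
  have [measurable]: "h0 \<in> measurable (comp_sigma I) borel" using assms by (intro comp_measurable) auto
  show ?thesis unfolding U_def 0 by simp
next
  case (Suc j)
  have [measurable]: "h0 \<in> measurable (comp_sigma I) borel" "X j \<in> measurable (comp_sigma I) borel"
    "\<sigma> j \<in> measurable (comp_sigma I) borel"
    using assms by (auto intro!: comp_measurable comp_measurable_points)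
  show ?thesis unfolding U_def Suc by simp
qed

lemma H_comp_measurable:
  assumes "insert Noise (range Fading) \<subseteq> I"
  shows "H k \<in> measurable (comp_sigma I) borel"
  using assms by (cases k) (auto simp: H_def[abs_def] intro!: comp_measurable)

lemma indep_U_H:
  "indep_var (\<Pi>\<^sub>M k\<in>UNIV. borel) (\<lambda>w k. U k w) (\<Pi>\<^sub>M k\<in>UNIV. borel) (\<lambda>w k. H k w)"
proof (rule indep_var_comp)
  show "insert Points (insert Useful_Fading (range Symbol)) \<inter> insert Noise (range Fading) = {}" by auto
qed (intro measurable_sequence U_comp_measurable H_comp_measurable order_refl)+

text \<open>Term 0 contributes the noise and the later terms the interference, all divided by the
  squared modulus of the useful channel. The factor \<open>beta\<close> in the total is there to
  cancel against the squared half spacing in the argument of \<open>erfc\<close>.\<close>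

lemma H_variance:
  assumes h: "h0 w \<noteq> 0" and s: "summable (\<lambda>k. (cmod (\<sigma> k w))\<^sup>2 * norm (X k w) powr (- \<eta>))" and T: "0 < T w"
  shows "summable (\<lambda>k. (cmod (U k w))\<^sup>2 * H_var k)"
    and "(\<Sum>k. (cmod (U k w))\<^sup>2 * H_var k) = beta * T w / (cmod (h0 w))\<^sup>2"
proof -
  define D where "D = \<rho>\<^sup>2 * (cmod (h0 w))\<^sup>2"
  have D: "0 < D" using rho_pos h by (simp add: D_def)
  have c0: "(cmod (U 0 w))\<^sup>2 * H_var 0 = N0 / D"
    by (simp add: U_def H_var_def D_def norm_divide norm_mult power_divide power_mult_distrib)
  have cS: "(cmod (U (Suc k) w))\<^sup>2 * H_var (Suc k) = P / D * ((cmod (\<sigma> k w))\<^sup>2 * norm (X k w) powr (- \<eta>))" for k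
  proof -
    have "(norm (X k w) powr (- \<eta> / 2))\<^sup>2 = norm (X k w) powr (- \<eta>)"
      by (cases "X k w = 0") (simp, subst powr_power, simp_all)
    thus ?thesis using P
      by (simp add: U_def H_var_def D_def norm_divide norm_mult power_divide power_mult_distrib)
  qed
  have sS: "(\<lambda>k. (cmod (U (Suc k) w))\<^sup>2 * H_var (Suc k)) sums (P / D * interference w)"
    unfolding cS interference_def by (intro sums_mult summable_sums s)
  hence "(\<lambda>k. (cmod (U k w))\<^sup>2 * H_var k) sums (P / D * interference w + N0 / D)"
    unfolding c0[symmetric] by (subst (asm) sums_Suc_iff) simp
  moreover have "P / D * interference w + N0 / D = beta * T w / (cmod (h0 w))\<^sup>2"
    using beta_pos rho_pos h by (simp add: T_def D_def field_simps)
  ultimately show "summable (\<lambda>k. (cmod (U k w))\<^sup>2 * H_var k)"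
     "(\<Sum>k. (cmod (U k w))\<^sup>2 * H_var k) = beta * T w / (cmod (h0 w))\<^sup>2"
    by (simp_all add: sums_iff)
qed

lemma H_variance_AE:
  "AE w in M. summable (\<lambda>k. (cmod (U k w))\<^sup>2 * H_var k) \<and> 0 < (\<Sum>k. (cmod (U k w))\<^sup>2 * H_var k)"
  using h0_nonzero interference_summable T_pos
  by eventually_elim (use H_variance beta_pos in simp)

lemmas mixture = gaussian_series_mixture[OF indep_U_H indep_H H_gaussian H_var_pos H_variance_AE]

lemma erfc_H_variance:
  "AE w in M. erfc (sqrt beta / sqrt (\<Sum>k. (cmod (U k w))\<^sup>2 * H_var k)) = e w"
  using h0_nonzero interference_summable T_pos
proof eventually_elim
  case (elim w)
  have "sqrt beta / sqrt (beta * T w / (cmod (h0 w))\<^sup>2) = sqrt (beta / (beta * T w / (cmod (h0 w))\<^sup>2))"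
    by (rule real_sqrt_divide[symmetric])
  also have "beta / (beta * T w / (cmod (h0 w))\<^sup>2) = (cmod (h0 w))\<^sup>2 / T w"
    using beta_pos elim by (simp add: field_simps)
  finally show ?case unfolding H_variance(2)[OF elim] e_def by (rule arg_cong)
qed

text \<open>On the boundary of a cell the detector may break ties either way, so correctness could
  not be read off \<open>t\<close>; the mixture formula with \<open>G\<close> constantly 0 excludes
  this case.\<close>

lemma t_boundary: "AE w in M. Re (t w) \<notin> {sqrt beta, - sqrt beta} \<and> Im (t w) \<notin> {sqrt beta, - sqrt beta}"
proof -
  let ?R = "{z. Re z \<in> {sqrt beta, - sqrt beta} \<or> Im z \<in> {sqrt beta, - sqrt beta}}"
  have R: "?R \<in> sets borel" by measurable
  have "emeasure M {w\<in>space M. t w \<in> ?R} = (\<integral>\<^sup>+w. ennreal 0 \<partial>M)"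
    unfolding t_def by (rule mixture(2)[OF R]) (use complex_gaussian_rectangle(2)[of _ _ "sqrt beta"] beta_pos in simp)
  thus ?thesis by (subst AE_iff_measurable[OF _ refl]) auto
qed

lemma decision_region_measurable [measurable]: "decision_region d q a b \<in> sets borel"
  unfolding decision_region_def by measurable

lemma prob_decision_region:
  "prob {w\<in>space M. t w \<in> decision_region (sqrt beta) q a b} =
     expectation (\<lambda>w. (1 - (of_bool (1 < a) + of_bool (a < q)) / 2 * e w) * (1 - (of_bool (1 < b) + of_bool (b < q)) / 2 * e w))"
proof -
  let ?g = "\<lambda>x. (1 - (of_bool (1 < a) + of_bool (a < q)) / 2 * x) * (1 - (of_bool (1 < b) + of_bool (b < q)) / 2 * x) :: real"
  have "emeasure M {w\<in>space M. t w \<in> decision_region (sqrt beta) q a b} =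
      (\<integral>\<^sup>+w. ennreal (?g (erfc (sqrt beta / sqrt (\<Sum>k. (cmod (U k w))\<^sup>2 * H_var k)))) \<partial>M)"
    unfolding t_def
  proof (rule mixture(2)[OF decision_region_measurable])
    fix \<tau> Z assume "0 < \<tau>" "complex_gaussian M \<tau> Z"
    from complex_gaussian_rectangle(1)[OF this, of "sqrt beta" "1 < a" "a < q" "1 < b" "b < q"] beta_pos
    show "prob {w\<in>space M. Z w \<in> decision_region (sqrt beta) q a b} = ?g (erfc (sqrt beta / sqrt \<tau>))"
      by (simp add: decision_region_def)
  qed
  also have "\<dots> = (\<integral>\<^sup>+w. ennreal (?g (e w)) \<partial>M)"
    by (rule nn_integral_cong_AE) (use erfc_H_variance in eventually_elim, simp)
  also have "\<dots> = ennreal (expectation (\<lambda>w. ?g (e w)))"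
  proof (rule nn_integral_eq_integral)
    have b: "AE w in M. 0 \<le> ?g (e w) \<and> ?g (e w) \<le> 1"
      using e_bounds(2)
    proof eventually_elim
      case (elim w)
      have "0 \<le> 1 - (of_bool A + of_bool B) / 2 * e w \<and> 1 - (of_bool A + of_bool B) / 2 * e w \<le> 1" for A B
        using elim e_bounds(1)[of w] by (cases A; cases B) auto
      thus ?case by (meson mult_nonneg_nonneg mult_le_one)
    qed
    show "AE w in M. 0 \<le> ?g (e w)" using b by eventually_elim simp
    have "AE w in M. norm (?g (e w)) \<le> 1" using b by eventually_elim (simp only: real_norm_def abs_of_nonneg)
    thus "integrable M (\<lambda>w. ?g (e w))" by (rule integrable_const_bound) measurable
  qed
  finally have *: "ennreal (prob {w\<in>space M. t w \<in> decision_region (sqrt beta) q a b}) = ennreal (expectation (\<lambda>w. ?g (e w)))"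
    by (simp add: emeasure_eq_measure)
  have "0 \<le> expectation (\<lambda>w. ?g (e w))"
  proof (rule integral_nonneg_AE)
    show "AE w in M. 0 \<le> ?g (e w)"
      using e_bounds(2)
    proof eventually_elim
      case (elim w)
      have "0 \<le> 1 - (of_bool A + of_bool B) / 2 * e w" for A B
        using elim e_bounds(1)[of w] by (cases A; cases B) auto
      thus ?case by (intro mult_nonneg_nonneg)
    qed
  qed
  with * show ?thesis by (subst (asm) ennreal_inj) auto
qed

section \<open>The error event of the detector\<close>

lemma indep_s0_t: "indep_var borel s0 borel t"
proof (rule indep_var_comp[where I="{Useful_Symbol}" and J="UNIV - {Useful_Symbol}"])
  show "s0 \<in> measurable (comp_sigma {Useful_Symbol}) borel" by (rule comp_measurable) simp
  have [measurable]: "U k \<in> measurable (comp_sigma (UNIV - {Useful_Symbol})) borel"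
    "H k \<in> measurable (comp_sigma (UNIV - {Useful_Symbol})) borel" for k
    by (auto intro!: U_comp_measurable H_comp_measurable)
  show "t \<in> measurable (comp_sigma (UNIV - {Useful_Symbol})) borel" unfolding t_def by measurable
qed auto

lemma prob_s0:
  assumes "s \<in> qam (q\<^sup>2)" shows "prob {w\<in>space M. s0 w = s} = 1 / real (q\<^sup>2)"
proof -
  have "expectation (\<lambda>w. indicator {s} (s0 w)) = (\<Sum>s'\<in>qam (q\<^sup>2). indicator {s} s' :: real) / real (card (qam (q\<^sup>2)))"
    by (rule uniform_rv_expectation[OF s0 finite_qam qam_nonempty])
  also have "(\<Sum>s'\<in>qam (q\<^sup>2). indicator {s} s' :: real) = 1"
    using assms finite_qam by (subst sum.remove[of _ s]) auto
  finally show ?thesis using card_qam[OF q] by (simp add: expectation_indicator_comp)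
qed

text \<open>Scaling a \<open>suminf\<close> and splitting off its head require summability, hence
  the hypothesis \<open>s\<close>, which holds almost surely. The head \<open>U 0 w * H 0 w\<close>
  is the equalised noise.\<close>

lemma received_signal_eq:
  assumes h: "h0 w \<noteq> 0" and s: "summable (\<lambda>k. U k w * H k w)"
  shows "received_signal P \<eta> r0 (s0 w) (\<lambda>k. \<sigma> k w) (h0 w) (\<lambda>k. h k w) (n w) (\<lambda>k. X k w) =
     of_real \<rho> * h0 w * (s0 w + t w)"
proof -
  let ?c = "of_real \<rho> * h0 w"
  have c: "?c \<noteq> 0" using h rho_pos by simp
  have s': "summable (\<lambda>k. U (Suc k) w * H (Suc k) w)" using s by (subst summable_Suc_iff)
  have "(\<Sum>k. of_real (sqrt P) * \<sigma> k w * h k w * of_real (norm (X k w) powr (- \<eta> / 2))) =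
      (\<Sum>k. ?c * (U (Suc k) w * H (Suc k) w))"
    using c by (intro arg_cong[where f=suminf] ext) (simp add: U_def H_def)
  also have "\<dots> = ?c * (\<Sum>k. U (Suc k) w * H (Suc k) w)" by (rule suminf_mult[OF s'])
  also have "(\<Sum>k. U (Suc k) w * H (Suc k) w) = t w - U 0 w * H 0 w"
    unfolding t_def by (rule suminf_split_head[OF s])
  finally show ?thesis
    using c unfolding received_signal_def by (simp add: U_def H_def \<rho>_def field_simps)
qed

theorem symbol_error_probability:
  fixes s_hat :: "'a \<Rightarrow> complex"
  assumes [measurable]: "random_variable borel s_hat"
    and ml: "\<And>w. w \<in> space M \<Longrightarrow>
           is_arg_min
             (\<lambda>s. cmod (received_signal P \<eta> r0 (s0 w) (\<lambda>k. \<sigma> k w) (h0 w) (\<lambda>k. h k w) (n w) (\<lambda>k. X k w)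
                        - of_real (sqrt P) * h0 w * of_real (r0 powr (- \<eta> / 2)) * s))
             (\<lambda>s. s \<in> qam (q\<^sup>2)) (s_hat w)"
  shows "prob {w\<in>space M. s_hat w \<noteq> s0 w} =
     2 * ((real q - 1) / real q) * expectation (\<lambda>w. e w ^ 1) - ((real q - 1) / real q)\<^sup>2 * expectation (\<lambda>w. e w ^ 2)"
proof -
  let ?d = "sqrt beta"
  let ?pt = "qam_point ?d q" and ?R = "decision_region ?d q"
  have d: "0 < ?d" using beta_pos by simp
  have im: "qam (q\<^sup>2) = (\<lambda>(a, b). ?pt a b) ` ({1..q} \<times> {1..q})"
    unfolding beta_def by (rule qam_eq_image)
  have pt: "?pt a b \<in> qam (q\<^sup>2)" if "a \<in> {1..q}" "b \<in> {1..q}" for a b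
    unfolding im using that by auto
  have inj: "?pt a b = ?pt a' b' \<longleftrightarrow> a = a' \<and> b = b'" for a b a' b'
    using inj_on_qam_point[of ?d q UNIV] d by (auto simp: inj_on_def)
  \<comment> \<open>The equivalence is only almost sure: it needs a nonzero channel, a convergent
    series and the absence of ties.\<close>
  have correct: "AE w in M. \<forall>a\<in>{1..q}. \<forall>b\<in>{1..q}. s0 w = ?pt a b \<longrightarrow> (s_hat w = s0 w \<longleftrightarrow> t w \<in> ?R a b)"
    using h0_nonzero mixture(1) t_boundary AE_space
  proof eventually_elim
    case (elim w)
    have c: "0 < cmod (of_real \<rho> * h0 w)" using elim(1) rho_pos by simp
    \<comment> \<open>All candidate distances carry the same positive factor, the modulus of the
      channel, so the decision depends only on the equalised signal
      \<open>s0 w + t w\<close>.\<close>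
    have dist: "cmod (received_signal P \<eta> r0 (s0 w) (\<lambda>k. \<sigma> k w) (h0 w) (\<lambda>k. h k w) (n w) (\<lambda>k. X k w)
                        - of_real (sqrt P) * h0 w * of_real (r0 powr (- \<eta> / 2)) * s) =
         cmod (of_real \<rho> * h0 w) * cmod (s0 w + t w - s)" for s
      unfolding received_signal_eq[OF elim(1,2)] norm_mult[symmetric]
      by (rule arg_cong[where f=cmod]) (simp add: \<rho>_def algebra_simps)
    have hat: "s_hat w \<in> qam (q\<^sup>2)"
      and near: "cmod (s0 w + t w - s_hat w) \<le> cmod (s0 w + t w - s)" if "s \<in> qam (q\<^sup>2)" for s
      using ml[OF elim(4)] that c unfolding dist is_arg_min_def by (auto simp: not_less)
    show ?case
    proof (intro ballI impI)
      fix a b assume ab: "a \<in> {1..q}" "b \<in> {1..q}" and s: "s0 w = ?pt a b"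
      show "s_hat w = s0 w \<longleftrightarrow> t w \<in> ?R a b"
      proof
        assume eq: "s_hat w = s0 w"
        show "t w \<in> ?R a b"
        proof (rule nearest_decision_region[OF d ab])
          show "cmod (t w) \<le> cmod (?pt a b + t w - ?pt a' b')" if "a' \<in> {1..q}" "b' \<in> {1..q}" for a' b'
            using near[OF pt[OF that]] eq s by simp
        qed (use elim(3) in auto)
      next
        assume R: "t w \<in> ?R a b"
        show "s_hat w = s0 w"
        proof (rule ccontr)
          assume ne: "s_hat w \<noteq> s0 w"
          have "s_hat w \<in> qam (q\<^sup>2)" using hat[OF pt[OF ab]] .
          then obtain a' b' where ab': "a' \<in> {1..q}" "b' \<in> {1..q}" "s_hat w = ?pt a' b'"
            unfolding im by auto
          have "cmod (t w) < cmod (?pt a b + t w - ?pt a' b')"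
            by (rule decision_region_nearest[OF d ab ab'(1,2) R]) (use ne s ab' in auto)
          thus False using near[OF pt[OF ab]] s ab' by simp
        qed
      qed
    qed
  qed
  let ?E = "\<lambda>(a, b). {w\<in>space M. s0 w = ?pt a b \<and> t w \<in> ?R a b}"
  have Eev: "?E p \<in> events" for p by (cases p) (simp, measurable)
  have "prob {w\<in>space M. s_hat w = s0 w} = prob (\<Union>p\<in>{1..q} \<times> {1..q}. ?E p)"
  proof (rule finite_measure_eq_AE)
    show "AE w in M. w \<in> {w\<in>space M. s_hat w = s0 w} \<longleftrightarrow> w \<in> (\<Union>p\<in>{1..q} \<times> {1..q}. ?E p)"
      using correct AE_space
    proof eventually_elim
      case (elim w)
      obtain a b where ab: "a \<in> {1..q}" "b \<in> {1..q}" "s0 w = ?pt a b"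
        using uniform_rv_in[OF s0 elim(2)] unfolding im by auto
      have "s_hat w = s0 w \<longleftrightarrow> t w \<in> ?R a b" using elim(1) ab by blast
      thus ?case using ab elim(2) by (auto simp: inj)
    qed
  qed (use Eev in auto)
  also have "\<dots> = (\<Sum>p\<in>{1..q} \<times> {1..q}. prob (?E p))"
    by (rule finite_measure_finite_Union) (use Eev in \<open>auto simp: disjoint_family_on_def inj\<close>)
  also have "\<dots> = (\<Sum>a=1..q. \<Sum>b=1..q. prob {w\<in>space M. s0 w = ?pt a b \<and> t w \<in> ?R a b})"
    by (simp add: sum.cartesian_product case_prod_unfold)
  also have "\<dots> = (\<Sum>a=1..q. \<Sum>b=1..q. 1 / real (q\<^sup>2) *
     expectation (\<lambda>w. (1 - (of_bool (1 < a) + of_bool (a < q)) / 2 * e w) * (1 - (of_bool (1 < b) + of_bool (b < q)) / 2 * e w)))"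
  proof (intro sum.cong refl)
    fix a b assume ab: "a \<in> {1..q}" "b \<in> {1..q}"
    have "prob {w\<in>space M. s0 w = ?pt a b \<and> t w \<in> ?R a b} = prob {w\<in>space M. s0 w = ?pt a b} * prob {w\<in>space M. t w \<in> ?R a b}"
      using indep_varD[OF indep_s0_t, of "{?pt a b}" "?R a b"] by (simp add: vimage_def Int_def conj_commute)
    thus "prob {w\<in>space M. s0 w = ?pt a b \<and> t w \<in> ?R a b} = 1 / real (q\<^sup>2) *
       expectation (\<lambda>w. (1 - (of_bool (1 < a) + of_bool (a < q)) / 2 * e w) * (1 - (of_bool (1 < b) + of_bool (b < q)) / 2 * e w))"
      unfolding prob_decision_region prob_s0[OF pt[OF ab]] .
  qed
  also have "\<dots> = expectation (\<lambda>w. (1 - (real q - 1) / real q * e w)\<^sup>2)"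
  proof -
    have i: "integrable M (\<lambda>w. (1 - x * e w) * (1 - y * e w))" for x y
    proof -
      have "(\<lambda>w. (1 - x * e w) * (1 - y * e w)) = (\<lambda>w. 1 - (x + y) * e w ^ 1 + (x * y) * e w ^ 2)"
        by (auto simp: algebra_simps power2_eq_square)
      thus ?thesis
        by (simp only:) (intro Bochner_Integration.integrable_add Bochner_Integration.integrable_diff integrable_mult_right integrable_e_power integrable_const)
    qed
    \<comment> \<open>The sum over the grid factorises into two equal sums along the axes, each
      \<open>q - (q - 1) * x\<close>; the prior \<open>1 / q\<^sup>2\<close> supplies one divisor
      \<open>q\<close> for each.\<close>
    have p: "(\<Sum>a=1..q. \<Sum>b=1..q. 1 / real (q\<^sup>2) * ((1 - (of_bool (1 < a) + of_bool (a < q)) / 2 * x) * (1 - (of_bool (1 < b) + of_bool (b < q)) / 2 * x))) =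
        (1 - (real q - 1) / real q * x)\<^sup>2" for x :: real
    proof -
      have "(\<Sum>a=1..q. \<Sum>b=1..q. 1 / real (q\<^sup>2) * ((1 - (of_bool (1 < a) + of_bool (a < q)) / 2 * x) * (1 - (of_bool (1 < b) + of_bool (b < q)) / 2 * x))) =
        1 / real (q\<^sup>2) * ((\<Sum>a=1..q. 1 - (of_bool (1 < a) + of_bool (a < q)) / 2 * x) * (\<Sum>b=1..q. 1 - (of_bool (1 < b) + of_bool (b < q)) / 2 * x))"
        unfolding sum_product by (simp only: sum_distrib_left)
      also have "\<dots> = ((real q - (real q - 1) * x) / real q)\<^sup>2"
        unfolding sum_boundary_sides[OF q] by (simp add: power2_eq_square)
      also have "(real q - (real q - 1) * x) / real q = 1 - (real q - 1) / real q * x"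
        using q by (simp add: field_simps)
      finally show ?thesis .
    qed
    show ?thesis
      unfolding p[symmetric]
      by (simp only: Bochner_Integration.integral_sum Bochner_Integration.integrable_sum integrable_mult_right i integral_mult_right_zero)
  qed
  finally have "prob {w\<in>space M. s_hat w = s0 w} = expectation (\<lambda>w. (1 - (real q - 1) / real q * e w)\<^sup>2)" .
  \<comment> \<open>After passing to the complement below, the coefficients of \<open>e\<close> and
    \<open>e\<^sup>2\<close> are the two values of \<open>sep_weight\<close>.\<close>
  also have "\<dots> = expectation (\<lambda>w. 1 - 2 * ((real q - 1) / real q) * e w ^ 1 + ((real q - 1) / real q)\<^sup>2 * e w ^ 2)"
    by (intro Bochner_Integration.integral_cong refl) (simp add: power2_eq_square algebra_simps)
  also have "\<dots> = 1 - 2 * ((real q - 1) / real q) * expectation (\<lambda>w. e w ^ 1) + ((real q - 1) / real q)\<^sup>2 * expectation (\<lambda>w. e w ^ 2)"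
    using integrable_e_power[of 1] integrable_e_power[of 2] by (simp add: prob_space)
  finally have C: "prob {w\<in>space M. s_hat w = s0 w} = \<dots>" .
  have "{w\<in>space M. s_hat w \<noteq> s0 w} = space M - {w\<in>space M. s_hat w = s0 w}" by auto
  hence "prob {w\<in>space M. s_hat w \<noteq> s0 w} = 1 - prob {w\<in>space M. s_hat w = s0 w}"
    using prob_compl[of "{w\<in>space M. s_hat w = s0 w}"] by simp
  thus ?thesis unfolding C by simp
qed

end

theorem theorem2:
  fixes \<Omega> :: "'a measure"
    and lam P N0 r0 \<eta> :: real
    and M :: nat
    and s0 h0 n s_hat :: "'a \<Rightarrow> complex"
    and \<sigma> h :: "nat \<Rightarrow> 'a \<Rightarrow> complex"
    and X :: "nat \<Rightarrow> 'a \<Rightarrow> real ^ 2"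
  assumes "prob_space \<Omega>"
    and "lam > 0" and "P > 0" and "N0 > 0" and "r0 > 0" and "\<eta> > 2"
    and "M \<ge> 4" and "\<exists>q :: nat. M = q\<^sup>2"
    and "uniform_rv \<Omega> (qam M) s0" and "\<And>k. uniform_rv \<Omega> (qam M) (\<sigma> k)"
    and "complex_gaussian \<Omega> 1 h0" and "\<And>k. complex_gaussian \<Omega> 1 (h k)"
    and "complex_gaussian \<Omega> N0 n"
    and "\<And>k. X k \<in> borel_measurable \<Omega>"
    and "AE \<omega> in \<Omega>. inj (\<lambda>k. X k \<omega>)"
    and "poisson_point_process \<Omega> lam {x. norm x > r0} (\<lambda>\<omega>. range (\<lambda>k. X k \<omega>))"
    and "mutually_independent \<Omega> s0 \<sigma> h0 h n X"
    and "s_hat \<in> borel_measurable \<Omega>"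
    and "\<And>\<omega>. \<omega> \<in> space \<Omega> \<Longrightarrow>
           is_arg_min
             (\<lambda>s. cmod (received_signal P \<eta> r0 (s0 \<omega>) (\<lambda>k. \<sigma> k \<omega>) (h0 \<omega>) (\<lambda>k. h k \<omega>) (n \<omega>) (\<lambda>k. X k \<omega>)
                        - of_real (sqrt P) * h0 \<omega> * of_real (r0 powr (- \<eta> / 2)) * s))
             (\<lambda>s. s \<in> qam M) (s_hat \<omega>)"
  shows "measure \<Omega> {\<omega>\<in>space \<Omega>. s_hat \<omega> \<noteq> s0 \<omega>} =
    (\<Sum>c\<in>{1..2::nat}. sep_weight M c *
       (1 - real c / sqrt pi *
          (LBINT z:{0<..}.
             erfc (sqrt z * (if c = 2 then 1 else 0)) / sqrt z *
             exp (- z * (1 + N0 * r0 powr \<eta> / (P * sep_beta M c))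
                  - pi * lam * r0\<^sup>2 *
                    (1 / real M *
                       (\<Sum>s\<in>qam M. kummer_1F1 (- 2 / \<eta>) (1 - 2 / \<eta>) (- (z * (cmod s)\<^sup>2 / sep_beta M c)))
                     - 1)))))"
proof -
  obtain q where M: "M = q\<^sup>2" using assms(8) by auto
  have q: "2 \<le> q"
  proof (rule ccontr)
    assume "\<not> 2 \<le> q"
    hence "q\<^sup>2 \<le> 1\<^sup>2" by (intro power_mono) auto
    thus False using assms(7) M by simp
  qed
  interpret prob_space \<Omega> by fact
  interpret qam_downlink \<Omega> lam P N0 r0 \<eta> q s0 h0 n \<sigma> h X
    by unfold_locales (use assms q in \<open>simp_all add: M\<close>)
  have sq: "sqrt (real M) = real q" by (simp add: M)
  have b: "sep_beta M c = beta" for c by (simp add: sep_beta_def beta_def M)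
  have w: "sep_weight M 1 = 2 * ((real q - 1) / real q)" "sep_weight M 2 = - (((real q - 1) / real q)\<^sup>2)"
    unfolding sep_weight_def sq by simp_all
  have sum2: "(\<Sum>c\<in>{1..2::nat}. g c) = g 1 + g 2" for g :: "nat \<Rightarrow> real"
    by (simp add: numeral_2_eq_2)
  have "(\<Sum>c\<in>{1..2::nat}. sep_weight M c * expectation (\<lambda>w. e w ^ c)) =
      prob {w\<in>space \<Omega>. s_hat w \<noteq> s0 w}"
    using symbol_error_probability[OF assms(18) assms(19)[unfolded M]] unfolding sum2 w by linarith
  moreover have "expectation (\<lambda>w. e w ^ c) = 1 - real c / sqrt pi *
          (LBINT z:{0<..}.
             erfc (sqrt z * (if c = 2 then 1 else 0)) / sqrt z *
             exp (- z * (1 + N0 * r0 powr \<eta> / (P * sep_beta M c))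
                  - pi * lam * r0\<^sup>2 *
                    (1 / real M *
                       (\<Sum>s\<in>qam M. kummer_1F1 (- 2 / \<eta>) (1 - 2 / \<eta>) (- (z * (cmod s)\<^sup>2 / sep_beta M c)))
                     - 1)))" if "c \<in> {1..2}" for c
    unfolding b unfolding M by (rule expectation_e_power) (use that in auto)
  ultimately show ?thesis by simp
qed

end
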